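(* For every integer $n\geq 1$ we have $\mathcal{F}_n^{\mathsf{Bur}}(x_1,\dots,x_n) = \mathcal{F}_n^{\mathsf{Ok}}(x_1,\dots,x_n)$.
   Context: Let $\zeta(x) := e^{x/2}-e^{-x/2}$. Define $P_1(a_1;x_1):=1/x_1$ and, for $n\geq 2$, $$P_n(a_1,\dots,a_n;x_1,\dots,x_n) := \sum_{\substack{\tau\in S_n\\ \tau(1)=1}} \frac{\prod_{j=2}^{n-1} x_{\tau(j)} \prod_{j=1}^{n-1}\zeta\Big(\big(\sum_{k=1}^{j} a_{\tau(k)}\big)x_{\tau(j+1)} - a_{\tau(j+1)}\big(\sum_{k=1}^{j} x_{\tau(k)}\big)\Big)}{\prod_{j=1}^{n-1}\big(a_{\tau(j)}x_{\tau(j+1)} - a_{\tau(j+1)}x_{\tau(j)}\big)};$$ this is a formal power series in all its variables. Define (with $\mathsf{i}=\sqrt{-1}$) $$\mathcal{F}_n^{\mathsf{Bur}}(x_1,\dots,x_n) := \frac{e^{(\sum_{j=1}^n x_j)^3/24}}{(\sum_{j=1}^n x_j)\prod_{j=1}^n\sqrt{2\pi x_j}}\int_{\mathbb{R}^n}\Big[\prod_{j=1}^n e^{-a_j^2/(2x_j)}da_j\Big] P_n(\mathsf{i}a_1,\dots,\mathsf{i}a_n;x_1,\dots,x_n).$$ Define $$\mathcal{E}(x_1,\dots,x_n) := \frac{e^{(\sum_{j=1}^n x_j^3)/12}}{\prod_{j=1}^n\sqrt{4\pi x_j}}\int_{\mathbb{R}_{\geq 0}^n}\Big[\prod_{j=1}^n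 ds_j\Big]\exp\Big(-\sum_{j=1}^n\Big(\frac{(s_j-s_{j+1})^2}{4x_j}+\frac{(s_j+s_{j+1})x_j}{2}\Big)\Big),$$ where $s_{n+1}:=s_1$, and $\mathcal{E}^{\circlearrowleft}(x_1,\dots,x_n):=\sum_{\sigma\in S_n/\mathbb{Z}_n}\mathcal{E}(x_{\sigma(1)},\dots,x_{\sigma(n)})$ (sum over cyclic orderings). Let $\Pi_n$ be the set of all partitions of $\{1,\dots,n\}$ into a disjoint union of unordered nonempty subsets $I_1\sqcup\dots\sqcup I_\ell$ ($\ell=1,\dots,n$), and $x_I:=\sum_{j\in I}x_j$. Define $\mathcal{G}(x_1,\dots,x_n):=\sum_{\sqcup_{j=1}^\ell I_j\in\Pi_n}(-1)^{\ell+1}\mathcal{E}^{\circlearrowleft}(x_{I_1},\dots,x_{I_\ell})$ and $$\mathcal{F}_n^{\mathsf{Ok}}(x_1,\dots,x_n):=\frac{(2\pi)^{n/2}}{\prod_{j=1}^n\sqrt{x_j}}\,\mathcal{G}\Big(\frac{x_1}{2^{1/3}},\dots,\frac{x_n}{2^{1/3}}\Big).$$ The variables $x_j$ are positive reals. *)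

theory Defs
  imports "HOL-Analysis.Analysis" "HOL-Library.Disjoint_Sets"
begin

(* Indices are shifted: the paper's variables x_1..x_n are x 0 .. x (n-1). *)

definition zeta :: "complex \<Rightarrow> complex" where
  "zeta z = exp (z / 2) - exp (- z / 2)"

(* P_n(a;x), as a (complex-valued) function; off the measure-zero union of
   hyperplanes where a denominator vanishes it equals the entire function given
   by the formal power series. *)
definition Pn :: "nat \<Rightarrow> (nat \<Rightarrow> complex) \<Rightarrow> (nat \<Rightarrow> complex) \<Rightarrow> complex" where
  "Pn n a x =
    (if n = 1 then 1 / x 0 else
     (\<Sum>\<tau> \<in> {\<tau>. \<tau> permutes {..<n} \<and> \<tau> 0 = 0}.
        ((\<Prod>j\<in>{1..n-2}. x (\<tau> j)) *
         (\<Prod>j\<in>{0..n-2}. zeta ((\<Sum>k\<in>{0..j}. a (\<tau> k)) * x (\<tau> (j+1))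
                                  - a (\<tau> (j+1)) * (\<Sum>k\<in>{0..j}. x (\<tau> k)))))
        / (\<Prod>j\<in>{0..n-2}. a (\<tau> j) * x (\<tau> (j+1)) - a (\<tau> (j+1)) * x (\<tau> j))))"

definition F_Bur :: "nat \<Rightarrow> (nat \<Rightarrow> real) \<Rightarrow> complex" where
  "F_Bur n x =
    complex_of_real (exp ((\<Sum>j<n. x j) ^ 3 / 24)
      / ((\<Sum>j<n. x j) * (\<Prod>j<n. sqrt (2 * pi * x j))))
    * (\<integral>a. complex_of_real (\<Prod>j<n. exp (- (a j)\<^sup>2 / (2 * x j)))
              * Pn n (\<lambda>j. \<i> * complex_of_real (a j)) (\<lambda>j. complex_of_real (x j))
       \<partial>(PiM {..<n} (\<lambda>_. lborel)))"

definition E_fun :: "nat \<Rightarrow> (nat \<Rightarrow> real) \<Rightarrow> real" where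
  "E_fun l y =
    exp ((\<Sum>j<l. y j ^ 3) / 12) / (\<Prod>j<l. sqrt (4 * pi * y j))
    * (LINT s : {s. \<forall>j<l. 0 \<le> s j} | PiM {..<l} (\<lambda>_. lborel).
         exp (- (\<Sum>j<l. (s j - s ((j+1) mod l))\<^sup>2 / (4 * y j)
                        + (s j + s ((j+1) mod l)) * y j / 2)))"

definition orderings :: "'b set \<Rightarrow> (nat \<Rightarrow> 'b) set" where
  "orderings B = {f. bij_betw f {..<card B} B \<and> f \<in> extensional {..<card B}}"

definition cyc_rel :: "'b set \<Rightarrow> ((nat \<Rightarrow> 'b) \<times> (nat \<Rightarrow> 'b)) set" where
  "cyc_rel B = {(f, g). f \<in> orderings B \<and> g \<in> orderings B \<and>
      (\<exists>m. \<forall>k<card B. g k = f ((k + m) mod card B))}"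

definition E_circ :: "'b set \<Rightarrow> ('b \<Rightarrow> real) \<Rightarrow> real" where
  "E_circ B y = (\<Sum>C \<in> orderings B // cyc_rel B.
       E_fun (card B) (\<lambda>k. y ((SOME f. f \<in> C) k)))"

definition G_fun :: "nat \<Rightarrow> (nat \<Rightarrow> real) \<Rightarrow> real" where
  "G_fun n x = (\<Sum>P \<in> {P. partition_on {..<n} P}.
       (-1) ^ (card P + 1) * E_circ P (\<lambda>I. \<Sum>j\<in>I. x j))"

definition F_Ok :: "nat \<Rightarrow> (nat \<Rightarrow> real) \<Rightarrow> real" where
  "F_Ok n x = (2 * pi) powr (real n / 2) / (\<Prod>j<n. sqrt (x j))
     * G_fun n (\<lambda>j. x j / 2 powr (1/3))"

end

theory Submission
  imports Defs "HOL-Probability.Probability" "HOL-Complex_Analysis.Complex_Analysis"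
    "HOL-Combinatorics.Multiset_Permutations"
begin

text \<open>Write \<open>b\<^sub>j = a\<^sub>j / x\<^sub>j\<close>. Expanding every factor \<^const>\<open>zeta\<close> of a summand of \<^const>\<open>Pn\<close> places the next letter to the left
  or to the right of the word built so far, and the shuffle identity for products of \<open>1 / (b\<^sub>u - b\<^sub>v)\<close> collects the
  terms belonging to one word. So \<open>x\<^sub>1 \<cdots> x\<^sub>n P\<^sub>n\<close> is a sum over all permutations of an exponential times a chain
  \<open>\<Prod> 1 / (b\<^sub>u - b\<^sub>v)\<close> of consecutive letters.

  The poles cancel only in the sum. Shifting \<open>\<i> b\<^sub>j\<close> by \<open>\<delta> j\<close> separates the summands, and the maximum principle in
  the shift parameter bounds the sum uniformly, so \<open>\<delta> \<rightarrow> 0\<close> is a dominated limit. Each shifted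
  pole is the Laplace transform of a step function, supported on \<open>t > 0\<close> at a descent and, with sign \<open>-1\<close>, on \<open>t \<le> 0\<close> at an
  ascent. Integrating out the Gaussian variables leaves a Gaussian chain with step constraints. Writing the descent
  indicator as 1 minus the complementary one and using the semigroup law of the Gaussian kernel merges
  descending runs into blocks, which gives the signed sum over ordered set partitions.

  On the other side, splitting the loop integral defining \<^const>\<open>E_fun\<close> according to the position of its minimum turns
  the sum over cyclic orderings into a sum over linear orderings, and completing the square in the linear potential
  produces the same constrained Gaussian chains.\<close>

text \<open>The root letter of \<open>Pn\<close> is not special: the sum over words that comes out
  of the expansion does not mention it. Hence any letter may serve as root, and rooting at one
  letter of a colliding pair puts the pole of that pair under a \<open>zeta\<close> factor that
  vanishes at the same point. No residue has to be computed.

  Single words have no majorant uniform in the shift. The shift is therefore made complex: on a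
  circle of radius at least 2 that keeps away from all collisions every word is bounded on its own,
  independently of the integration variables, and the maximum principle carries the bound of the sum
  inside. Genericity ensures that only one pair collides at a time.

  The parabola \<open>threshold\<close> has a different source on each side: the antisymmetric phase
  in the Fourier integral, the linear potential in the loop integral. It vanishes at 0 and at the
  total \<open>X\<close>, so both sides are evaluated at the end point 0. The factor k = 2^(1/3)
  equates the two Gaussian scales: stretching lengths by k and dividing the parameter y by k turns
  1/(4y) into k^3/(4y), which is 1/(2y).\<close>

abbreviation lborel_pow :: "'i set \<Rightarrow> ('i \<Rightarrow> real) measure" where
  "lborel_pow I \<equiv> PiM I (\<lambda>_. lborel)"

section \<open>Nested products and words\<close>

text \<open>With \<open>\<beta> = a / x\<close> this is the determinant
  \<open>a p * x q - a q * x p\<close> of the original summands. Its antisymmetry lets phases be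
  collected in whatever order the letters arrive.\<close>

definition cross :: "('a \<Rightarrow> complex) \<Rightarrow> ('a \<Rightarrow> complex) \<Rightarrow> 'a \<Rightarrow> 'a \<Rightarrow> complex" where
  "cross x \<beta> p q = x p * x q * (\<beta> p - \<beta> q)"

definition cross_sum :: "('a \<Rightarrow> complex) \<Rightarrow> ('a \<Rightarrow> complex) \<Rightarrow> 'a list \<Rightarrow> 'a \<Rightarrow> complex" where
  "cross_sum x \<beta> ws v = (\<Sum>k\<leftarrow>ws. cross x \<beta> k v)"

text \<open>Words are stored in reverse: the head of the list is the last letter.\<close>

fun word_term :: "('a \<Rightarrow> complex) \<Rightarrow> ('a \<Rightarrow> complex) \<Rightarrow> 'a list \<Rightarrow> complex" where
  "word_term x \<beta> [] = 1"
| "word_term x \<beta> [v] = 1"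
| "word_term x \<beta> (v # u # ws) =
     word_term x \<beta> (u # ws) * exp (cross_sum x \<beta> (u # ws) v / 2) / (\<beta> u - \<beta> v)"

text \<open>One summand of \<open>Pn\<close> times the product of all \<open>x\<close>:
  \<open>vis\<close> holds the letters placed so far in order of placement, and \<open>u\<close> is
  the most recent of them.\<close>

fun nested_term :: "('a \<Rightarrow> complex) \<Rightarrow> ('a \<Rightarrow> complex) \<Rightarrow> 'a list \<Rightarrow> 'a \<Rightarrow> 'a list \<Rightarrow> complex" where
  "nested_term x \<beta> vis u [] = 1"
| "nested_term x \<beta> vis u (v # vs) =
     zeta (cross_sum x \<beta> vis v) / (\<beta> u - \<beta> v) * nested_term x \<beta> (vis @ [v]) v vs"

fun chain_term :: "('a \<Rightarrow> complex) \<Rightarrow> 'a \<Rightarrow> 'a list \<Rightarrow> complex" where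
  "chain_term \<beta> u [] = 1"
| "chain_term \<beta> u (v # vs) = chain_term \<beta> v vs / (\<beta> u - \<beta> v)"

fun word_phase :: "('a \<Rightarrow> complex) \<Rightarrow> ('a \<Rightarrow> complex) \<Rightarrow> 'a list \<Rightarrow> complex" where
  "word_phase x \<beta> [] = 0"
| "word_phase x \<beta> (v # vs) = (\<Sum>k\<leftarrow>vs. cross x \<beta> v k) + word_phase x \<beta> vs"

text \<open>The phase collected when the letters of \<open>R\<close> take the first exponential of
  \<open>zeta\<close> and those of \<open>L\<close> the second, each list in order of placement. The
  interleaving of the two lists does not matter: a mixed pair contributes
  \<open>cross x \<beta> l r\<close> whichever of the two came first, by antisymmetry.\<close>

definition split_phase :: "('a \<Rightarrow> complex) \<Rightarrow> ('a \<Rightarrow> complex) \<Rightarrow> 'a list \<Rightarrow> 'a list \<Rightarrow> 'a list \<Rightarrow> complex" where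
  "split_phase x \<beta> vis L R =
     (\<Sum>r\<leftarrow>R. cross_sum x \<beta> vis r) - (\<Sum>l\<leftarrow>L. cross_sum x \<beta> vis l)
     + (\<Sum>r\<leftarrow>R. cross_sum x \<beta> L r) + word_phase x \<beta> R - word_phase x \<beta> L"

definition splits :: "'a set \<Rightarrow> ('a list \<times> 'a list) set" where
  "splits B = {(L, R). distinct (L @ R) \<and> set (L @ R) = B}"

definition split_term :: "('a \<Rightarrow> complex) \<Rightarrow> ('a \<Rightarrow> complex) \<Rightarrow> 'a list \<Rightarrow> 'a list \<Rightarrow> 'a list \<Rightarrow> complex" where
  "split_term x \<beta> vis L R = (- 1) ^ length L * exp (split_phase x \<beta> vis L R / 2)"

lemma cross_antisym: "cross x \<beta> p q = - cross x \<beta> q p"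
  by (simp add: cross_def algebra_simps)

lemma cross_sum_simps [simp]:
  "cross_sum x \<beta> [] v = 0"
  "cross_sum x \<beta> (k # ws) v = cross x \<beta> k v + cross_sum x \<beta> ws v"
  "cross_sum x \<beta> (ws @ ws') v = cross_sum x \<beta> ws v + cross_sum x \<beta> ws' v"
  by (simp_all add: cross_sum_def)

lemma finite_splits: "finite B \<Longrightarrow> finite (splits B)"
proof (rule finite_subset)
  assume B: "finite B"
  show "splits B \<subseteq> {xs. set xs \<subseteq> B \<and> length xs \<le> card B} \<times> {xs. set xs \<subseteq> B \<and> length xs \<le> card B}"
    unfolding splits_def
    using B by (auto simp: distinct_card[symmetric] intro!: card_mono)
  show "finite ({xs. set xs \<subseteq> B \<and> length xs \<le> card B} \<times> {xs. set xs \<subseteq> B \<and> length xs \<le> card B})"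
    using finite_lists_length_le[OF B] by auto
qed

lemma distinct_hd_tl: "distinct xs \<Longrightarrow> xs \<noteq> [] \<Longrightarrow> hd xs \<notin> set (tl xs) \<and> set xs = insert (hd xs) (set (tl xs)) \<and> distinct (tl xs)"
  by (cases xs) auto

lemma splits_empty: "splits {} = {([], [])}"
  by (auto simp: splits_def)

lemma split_phase_Cons_right:
  "split_phase x \<beta> vis L (v # R) = split_phase x \<beta> (vis @ [v]) L R + cross_sum x \<beta> vis v"
proof -
  have "(\<Sum>l\<leftarrow>L. cross x \<beta> v l) = - cross_sum x \<beta> L v"
    by (induction L) (simp_all add: cross_antisym[of x \<beta> v])
  moreover have "(\<Sum>k\<leftarrow>R. cross x \<beta> v k) = (\<Sum>r\<leftarrow>R. cross x \<beta> v r)" ..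
  ultimately show ?thesis
    by (simp add: split_phase_def sum_list_addf)
qed

lemma split_phase_Cons_left:
  "split_phase x \<beta> vis (v # L) R = split_phase x \<beta> (vis @ [v]) L R - cross_sum x \<beta> vis v"
  by (simp add: split_phase_def sum_list_addf)

text \<open>The two exponentials of \<open>zeta\<close> are the two sides on which the next letter
  can be placed; the lists record order of placement from \<open>v\<close> on, so \<open>v\<close>
  goes to the front.\<close>

lemma split_term_Cons:
  "(split_term x \<beta> vis L (v # R) + split_term x \<beta> vis (v # L) R) =
   zeta (cross_sum x \<beta> vis v) * split_term x \<beta> (vis @ [v]) L R"
proof -
  have "exp ((a + c) / 2) = exp (a / 2) * exp (c / 2)" "exp ((a - c) / 2) = exp (a / 2) * exp (- c / 2)"
    for a c :: complex
    by (simp_all add: add_divide_distrib diff_divide_distrib flip: exp_add)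
  then show ?thesis
    by (simp add: split_term_def split_phase_Cons_left split_phase_Cons_right zeta_def algebra_simps)
qed

text \<open>One step of the shuffle identity for two chains out of \<open>u\<close>: the first
  letter of a shuffle is \<open>hd R\<close> or \<open>hd L\<close>, and these cases are the partial
  fractions of 1/(pq) with p = \<open>\<beta> u - \<beta> l\<close> and q =
  \<open>\<beta> u - \<beta> r\<close>. If one list is empty, one summand drops out and the other is
  the product itself.\<close>

lemma chain_term_mult:
  assumes "L \<noteq> [] \<or> R \<noteq> []" "inj_on \<beta> (insert u (set L \<union> set R))"
    and "u \<notin> set L \<union> set R" "distinct (L @ R)"
  shows "chain_term \<beta> u L * chain_term \<beta> u R =
    (if R = [] then 0 else chain_term \<beta> (hd R) L * chain_term \<beta> (hd R) (tl R) / (\<beta> u - \<beta> (hd R)))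
  + (if L = [] then 0 else chain_term \<beta> (hd L) (tl L) * chain_term \<beta> (hd L) R / (\<beta> u - \<beta> (hd L)))"
proof (cases L)
  case Nil
  then show ?thesis using assms by (cases R) auto
next
  case (Cons l L')
  show ?thesis
  proof (cases R)
    case Nil
    then show ?thesis using Cons by simp
  next
    case R: (Cons r R')
    have "\<beta> u \<noteq> \<beta> l" "\<beta> u \<noteq> \<beta> r" "\<beta> l \<noteq> \<beta> r"
      using assms Cons R by (auto simp: inj_on_def)
    then have nz: "\<beta> u - \<beta> l \<noteq> 0" "\<beta> u - \<beta> r \<noteq> 0" "\<beta> l - \<beta> r \<noteq> 0" "\<beta> r - \<beta> l \<noteq> 0" by auto
    have id: "1 / (p * q) = 1 / ((p - q) * q) + 1 / ((q - p) * p)"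
      if "p \<noteq> 0" "q \<noteq> 0" "p - q \<noteq> 0" "q - p \<noteq> 0" for p q :: complex
    proof -
      have "1 / ((q - p) * p) = - (1 / ((p - q) * p))"
        by (metis minus_diff_eq minus_divide_right mult_minus_left)
      then show ?thesis using that by (simp add: divide_simps) (simp add: algebra_simps)
    qed
    have "1 / ((\<beta> u - \<beta> l) * (\<beta> u - \<beta> r))
        = 1 / ((\<beta> r - \<beta> l) * (\<beta> u - \<beta> r)) + 1 / ((\<beta> l - \<beta> r) * (\<beta> u - \<beta> l))"
      using id[of "\<beta> u - \<beta> l" "\<beta> u - \<beta> r"] nz by simp
    then have "chain_term \<beta> l L' * chain_term \<beta> r R' * (1 / ((\<beta> u - \<beta> l) * (\<beta> u - \<beta> r)))
        = chain_term \<beta> l L' * chain_term \<beta> r R' * (1 / ((\<beta> r - \<beta> l) * (\<beta> u - \<beta> r)) + 1 / ((\<beta> l - \<beta> r) * (\<beta> u - \<beta> l)))"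
      by simp
    then show ?thesis using Cons R by (simp add: ring_distribs mult.commute)
  qed
qed

text \<open>Summing over the order of arrival sums over all interleavings of \<open>L\<close> and
  \<open>R\<close>. The phase ignores the interleaving, so the denominators add up, by the shuffle
  identity, to a product of two chains that both start at \<open>u\<close>.\<close>

lemma sum_permutations_nested:
  assumes "finite B" "u \<notin> B" "inj_on \<beta> (insert u B)"
  shows "(\<Sum>vs\<in>permutations_of_set B. nested_term x \<beta> vis u vs) =
    (\<Sum>(L, R)\<in>splits B. split_term x \<beta> vis L R * (chain_term \<beta> u L * chain_term \<beta> u R))"
  using assms
proof (induction "card B" arbitrary: B u vis)
  case 0
  then have "B = {}" by simp
  then show ?case by (simp add: splits_empty split_term_def split_phase_def)
next
  case (Suc n)
  note fin = \<open>finite B\<close>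
  have ne: "B \<noteq> {}" using Suc.hyps(2) by auto
  let ?c = "\<lambda>L R. split_term x \<beta> vis L R"
  let ?F = "chain_term \<beta>"
  have Sg: "(\<Sum>v\<in>B. \<Sum>p\<in>splits (B - {v}). g v p) = (\<Sum>q\<in>Sigma B (\<lambda>v. splits (B - {v})). g (fst q) (snd q))"
    for g :: "'a \<Rightarrow> 'a list \<times> 'a list \<Rightarrow> complex"
    by (simp add: sum.Sigma fin finite_splits case_prod_unfold)
  have "(\<Sum>vs\<in>permutations_of_set B. nested_term x \<beta> vis u vs) =
      (\<Sum>v\<in>B. \<Sum>vs\<in>permutations_of_set (B - {v}). nested_term x \<beta> vis u (v # vs))"
    unfolding permutations_of_set_nonempty[OF ne]
    by (subst sum.UNION_disjoint) (auto simp: fin sum.reindex)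
  also have "\<dots> = (\<Sum>v\<in>B. zeta (cross_sum x \<beta> vis v) / (\<beta> u - \<beta> v) *
      (\<Sum>(L, R)\<in>splits (B - {v}). split_term x \<beta> (vis @ [v]) L R * (?F v L * ?F v R)))"
  proof (rule sum.cong[OF refl])
    fix v assume v: "v \<in> B"
    have "inj_on \<beta> (insert v (B - {v}))"
      using Suc.prems(3) by (rule inj_on_subset) (use v in auto)
    then show "(\<Sum>vs\<in>permutations_of_set (B - {v}). nested_term x \<beta> vis u (v # vs)) =
      zeta (cross_sum x \<beta> vis v) / (\<beta> u - \<beta> v) *
      (\<Sum>(L, R)\<in>splits (B - {v}). split_term x \<beta> (vis @ [v]) L R * (?F v L * ?F v R))"
      using Suc.hyps(1)[of "B - {v}" v "vis @ [v]"] Suc.hyps(2) fin v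
      by (simp flip: sum_distrib_left sum_divide_distrib)
  qed
  also have "\<dots> = (\<Sum>v\<in>B. \<Sum>(L, R)\<in>splits (B - {v}).
        ?c L (v # R) * (?F v L * ?F v R / (\<beta> u - \<beta> v)) + ?c (v # L) R * (?F v L * ?F v R / (\<beta> u - \<beta> v)))"
    unfolding sum_distrib_left
    by (intro sum.cong refl) (auto simp: mult.assoc[symmetric] split_term_Cons[symmetric] ring_distribs add_divide_distrib)
  also have "\<dots> = (\<Sum>v\<in>B. \<Sum>(L, R)\<in>splits (B - {v}). ?c L (v # R) * (?F v L * ?F v R / (\<beta> u - \<beta> v)))
     + (\<Sum>v\<in>B. \<Sum>(L, R)\<in>splits (B - {v}). ?c (v # L) R * (?F v L * ?F v R / (\<beta> u - \<beta> v)))"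
    by (simp add: sum.distrib case_prod_unfold)
  \<comment> \<open>The letter \<open>v\<close> is recovered as the head of the list that received
    it, so the sum runs over the splits whose right list is nonempty; the second sum is treated
    likewise with the left list.\<close>
  also have "(\<Sum>v\<in>B. \<Sum>(L, R)\<in>splits (B - {v}). ?c L (v # R) * (?F v L * ?F v R / (\<beta> u - \<beta> v))) =
     (\<Sum>(L, R)\<in>{p \<in> splits B. snd p \<noteq> []}. ?c L R * (?F (hd R) L * ?F (hd R) (tl R) / (\<beta> u - \<beta> (hd R))))"
    unfolding Sg
    by (rule sum.reindex_bij_witness[where j = "\<lambda>q. (fst (snd q), fst q # snd (snd q))" and
          i = "\<lambda>p. (hd (snd p), fst p, tl (snd p))"])
       (auto simp: splits_def case_prod_unfold dest: distinct_hd_tl)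
  also have "(\<Sum>v\<in>B. \<Sum>(L, R)\<in>splits (B - {v}). ?c (v # L) R * (?F v L * ?F v R / (\<beta> u - \<beta> v))) =
     (\<Sum>(L, R)\<in>{p \<in> splits B. fst p \<noteq> []}. ?c L R * (?F (hd L) (tl L) * ?F (hd L) R / (\<beta> u - \<beta> (hd L))))"
    unfolding Sg
    by (rule sum.reindex_bij_witness[where j = "\<lambda>q. (fst q # fst (snd q), snd (snd q))" and
          i = "\<lambda>p. (hd (fst p), tl (fst p), snd p)"])
       (auto simp: splits_def case_prod_unfold dest: distinct_hd_tl)
  also have "(\<Sum>(L, R)\<in>{p \<in> splits B. snd p \<noteq> []}. ?c L R * (?F (hd R) L * ?F (hd R) (tl R) / (\<beta> u - \<beta> (hd R)))) +
     (\<Sum>(L, R)\<in>{p \<in> splits B. fst p \<noteq> []}. ?c L R * (?F (hd L) (tl L) * ?F (hd L) R / (\<beta> u - \<beta> (hd L)))) =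
     (\<Sum>(L, R)\<in>splits B. ?c L R * (?F u L * ?F u R))"
    unfolding sum.inter_filter[OF finite_splits[OF fin]] sum.distrib[symmetric]
  proof (rule sum.cong[OF refl], clarify)
    fix L R assume LR: "(L, R) \<in> splits B"
    have "?F u L * ?F u R =
        (if R = [] then 0 else ?F (hd R) L * ?F (hd R) (tl R) / (\<beta> u - \<beta> (hd R)))
      + (if L = [] then 0 else ?F (hd L) (tl L) * ?F (hd L) R / (\<beta> u - \<beta> (hd L)))"
      by (rule chain_term_mult) (use LR Suc.prems ne in \<open>auto simp: splits_def\<close>)
    then show "(if snd (L, R) \<noteq> [] then ?c L R * (?F (hd R) L * ?F (hd R) (tl R) / (\<beta> u - \<beta> (hd R))) else 0) +
      (if fst (L, R) \<noteq> [] then ?c L R * (?F (hd L) (tl L) * ?F (hd L) R / (\<beta> u - \<beta> (hd L))) else 0) =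
      ?c L R * (?F u L * ?F u R)"
      by (simp add: ring_distribs)
  qed
  finally show ?case .
qed

lemma word_term_rev_append:
  "word_term x \<beta> (rev R @ u # ws) = word_term x \<beta> (u # ws) *
     exp (((\<Sum>r\<leftarrow>R. cross_sum x \<beta> (u # ws) r) + word_phase x \<beta> R) / 2) * chain_term \<beta> u R"
proof (induction R arbitrary: u ws)
  case (Cons r R)
  have "word_term x \<beta> (rev (r # R) @ u # ws) = word_term x \<beta> (rev R @ r # u # ws)" by simp
  also have "\<dots> = word_term x \<beta> (r # u # ws) *
     exp (((\<Sum>r'\<leftarrow>R. cross_sum x \<beta> (r # u # ws) r') + word_phase x \<beta> R) / 2) * chain_term \<beta> r R"
    by (rule Cons.IH)
  finally show ?case
    by (simp add: sum_list_addf exp_add add_divide_distrib)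
qed simp

text \<open>Read outwards from the root, the chain of \<open>L\<close> has every difference
  reversed. The resulting power of -1 is the sign of the second exponential in
  \<open>zeta\<close>.\<close>

lemma word_term_Cons_chain:
  "word_term x \<beta> (u # L) = (- 1) ^ length L *
     exp (- ((\<Sum>l\<leftarrow>L. cross x \<beta> u l) + word_phase x \<beta> L) / 2) * chain_term \<beta> u L"
proof (induction L arbitrary: u)
  case (Cons l L)
  have 1: "cross_sum x \<beta> (l # L) u = - (\<Sum>k\<leftarrow>l # L. cross x \<beta> u k)"
    by (induction L) (simp_all add: cross_antisym[of x \<beta> u])
  have 2: "chain_term \<beta> l L / (\<beta> l - \<beta> u) = - (chain_term \<beta> l L / (\<beta> u - \<beta> l))"
    by (metis minus_diff_eq minus_divide_right)
  have "word_term x \<beta> (u # l # L) = word_term x \<beta> (l # L) * exp (cross_sum x \<beta> (l # L) u / 2) / (\<beta> l - \<beta> u)" by simp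
  also have "\<dots> = (- 1) ^ length L * (exp (- ((\<Sum>l'\<leftarrow>L. cross x \<beta> l l') + word_phase x \<beta> L) / 2) *
      exp (- (\<Sum>k\<leftarrow>l # L. cross x \<beta> u k) / 2)) * (chain_term \<beta> l L / (\<beta> l - \<beta> u))"
    unfolding Cons.IH 1 by simp
  also have "exp (- ((\<Sum>l'\<leftarrow>L. cross x \<beta> l l') + word_phase x \<beta> L) / 2) * exp (- (\<Sum>k\<leftarrow>l # L. cross x \<beta> u k) / 2)
      = exp (- ((\<Sum>k\<leftarrow>l # L. cross x \<beta> u k) + word_phase x \<beta> (l # L)) / 2)"
    unfolding exp_add[symmetric] by (rule arg_cong[of _ _ exp]) (simp add: field_simps)
  finally show ?case unfolding 2 by (simp add: mult_ac)
qed simp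

text \<open>In reversed storage the word spelled around the root is \<open>rev R @ i # L\<close>.
  Every word is cut at \<open>i\<close> in exactly one way, so the right side no longer depends on
  \<open>i\<close>; this freedom is what removes the poles.\<close>

theorem sum_nested_eq_sum_words:
  assumes "finite A" "i \<in> A" "inj_on \<beta> A"
  shows "(\<Sum>vs\<in>permutations_of_set (A - {i}). nested_term x \<beta> [i] i vs) =
    (\<Sum>w\<in>permutations_of_set A. word_term x \<beta> w)"
proof -
  have "(\<Sum>vs\<in>permutations_of_set (A - {i}). nested_term x \<beta> [i] i vs) =
    (\<Sum>(L, R)\<in>splits (A - {i}). split_term x \<beta> [i] L R * (chain_term \<beta> i L * chain_term \<beta> i R))"
    using assms by (intro sum_permutations_nested) (auto simp: insert_absorb)
  also have "\<dots> = (\<Sum>(L, R)\<in>splits (A - {i}). word_term x \<beta> (rev R @ i # L))"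
  proof (rule sum.cong[OF refl], clarify)
    fix L R :: "'a list"
    show "split_term x \<beta> [i] L R * (chain_term \<beta> i L * chain_term \<beta> i R) = word_term x \<beta> (rev R @ i # L)"
    proof -
      have "split_phase x \<beta> [i] L R = ((\<Sum>r\<leftarrow>R. cross_sum x \<beta> (i # L) r) + word_phase x \<beta> R)
        + - ((\<Sum>l\<leftarrow>L. cross x \<beta> i l) + word_phase x \<beta> L)"
        by (simp add: split_phase_def sum_list_addf)
      then have "exp (split_phase x \<beta> [i] L R / 2) = exp (((\<Sum>r\<leftarrow>R. cross_sum x \<beta> (i # L) r) + word_phase x \<beta> R) / 2)
        * exp (- ((\<Sum>l\<leftarrow>L. cross x \<beta> i l) + word_phase x \<beta> L) / 2)"
        by (simp only: add_divide_distrib exp_add)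
      then show ?thesis
        unfolding word_term_rev_append word_term_Cons_chain split_term_def by (simp only: mult_ac)
    qed
  qed
  also have "\<dots> = (\<Sum>w\<in>permutations_of_set A. word_term x \<beta> w)"
  proof (rule sum.reindex_bij_witness[where j = "\<lambda>(L, R). rev R @ i # L" and
        i = "\<lambda>w. (tl (dropWhile (\<lambda>k. k \<noteq> i) w), rev (takeWhile (\<lambda>k. k \<noteq> i) w))"])
    fix p assume "p \<in> splits (A - {i})"
    then obtain L R where p: "p = (L, R)" "distinct (L @ R)" "set (L @ R) = A - {i}"
      by (auto simp: splits_def)
    have "i \<notin> set R" using p by auto
    then have "takeWhile (\<lambda>k. k \<noteq> i) (rev R @ i # L) = rev R" "dropWhile (\<lambda>k. k \<noteq> i) (rev R @ i # L) = i # L"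
      by (auto simp: takeWhile_append dropWhile_append)
    then show "(tl (dropWhile (\<lambda>k. k \<noteq> i) (case p of (L, R) \<Rightarrow> rev R @ i # L)),
       rev (takeWhile (\<lambda>k. k \<noteq> i) (case p of (L, R) \<Rightarrow> rev R @ i # L))) = p"
      using p by simp
    show "(case p of (L, R) \<Rightarrow> rev R @ i # L) \<in> permutations_of_set A"
      using p assms by (auto simp: permutations_of_set_def)
  next
    fix w assume w: "w \<in> permutations_of_set A"
    then have "i \<in> set w" using assms by (auto simp: permutations_of_set_def)
    then obtain ys zs where ys: "w = ys @ i # zs" "i \<notin> set ys"
      by (metis split_list_first)
    then have tw: "takeWhile (\<lambda>k. k \<noteq> i) w = ys" "dropWhile (\<lambda>k. k \<noteq> i) w = i # zs"
      by (auto simp: takeWhile_append dropWhile_append)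
    then show "(case (tl (dropWhile (\<lambda>k. k \<noteq> i) w), rev (takeWhile (\<lambda>k. k \<noteq> i) w)) of (L, R) \<Rightarrow> rev R @ i # L) = w"
      using ys by simp
    show "(tl (dropWhile (\<lambda>k. k \<noteq> i) w), rev (takeWhile (\<lambda>k. k \<noteq> i) w)) \<in> splits (A - {i})"
      using w ys tw by (auto simp: splits_def permutations_of_set_def)
  qed auto
  finally show ?thesis .
qed

section \<open>The defining sum of P_n as a sum of nested products\<close>

lemma nested_term_prod:
  assumes "k < n"
  shows "nested_term x \<beta> (map \<tau> [0..<Suc k]) (\<tau> k) (map \<tau> [Suc k..<n]) =
    (\<Prod>j\<in>{k..<n - 1}. zeta (\<Sum>i\<in>{0..j}. cross x \<beta> (\<tau> i) (\<tau> (Suc j))) / (\<beta> (\<tau> j) - \<beta> (\<tau> (Suc j))))"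
  using assms
proof (induction "n - k" arbitrary: k)
  case (Suc m)
  show ?case
  proof (cases "Suc k < n")
    case False
    then have "n = Suc k" using Suc by simp
    then show ?thesis by simp
  next
    case True
    have 1: "map \<tau> [Suc k..<n] = \<tau> (Suc k) # map \<tau> [Suc (Suc k)..<n]"
      using True by (simp add: upt_conv_Cons)
    have 2: "map \<tau> [0..<Suc k] @ [\<tau> (Suc k)] = map \<tau> [0..<Suc (Suc k)]" by simp
    have 3: "cross_sum x \<beta> (map \<tau> [0..<Suc k]) v = (\<Sum>i\<in>{0..k}. cross x \<beta> (\<tau> i) v)" for v
      unfolding cross_sum_def map_map interv_sum_list_conv_sum_set_nat o_def
      by (rule sum.cong) auto
    have 4: "{k..<n - 1} = insert k {Suc k..<n - 1}" using True by auto
    show ?thesis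
      unfolding 1 nested_term.simps 2 3 4
      using Suc.hyps(1)[of "Suc k"] Suc.hyps(2) True by simp
  qed
qed simp

lemma permutes_fixing_lists:
  assumes "n \<ge> 1"
  shows "(\<Sum>\<tau> | \<tau> permutes {..<n} \<and> \<tau> 0 = 0. f (map \<tau> [Suc 0..<n])) =
    (\<Sum>vs\<in>permutations_of_set ({..<n} - {0}). f vs)"
proof (rule sum.reindex_bij_witness[where j = "\<lambda>\<tau>. map \<tau> [Suc 0..<n]" and
      i = "\<lambda>vs k. if 0 < k \<and> k < n then vs ! (k - 1) else k"])
  fix \<tau> assume "\<tau> \<in> {\<tau>. \<tau> permutes {..<n} \<and> \<tau> 0 = 0}"
  then have \<tau>: "\<tau> permutes {..<n}" "\<tau> 0 = 0" by auto
  show "(\<lambda>k. if 0 < k \<and> k < n then map \<tau> [Suc 0..<n] ! (k - 1) else k) = \<tau>"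
    using \<tau> by (auto simp: fun_eq_iff permutes_def)
  have "\<tau> ` ({..<n} - {0}) = {..<n} - {0}"
    using \<tau> permutes_image[OF \<tau>(1)] permutes_inj[OF \<tau>(1)] by (simp add: image_set_diff)
  moreover have "{Suc 0..<n} = {..<n} - {0}" by auto
  ultimately show "map \<tau> [Suc 0..<n] \<in> permutations_of_set ({..<n} - {0})"
    using permutes_inj[OF \<tau>(1)]
    by (simp add: permutations_of_set_def distinct_map inj_on_def)
next
  fix vs assume vs: "vs \<in> permutations_of_set ({..<n} - {0})"
  have len: "length vs = n - 1"
    using length_finite_permutations_of_set[OF vs] assms by simp
  have d: "distinct vs" and st: "set vs = {..<n} - {0}"
    using vs by (auto simp: permutations_of_set_def)
  let ?t = "\<lambda>k. if 0 < k \<and> k < n then vs ! (k - 1) else k"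
  show "map ?t [Suc 0..<n] = vs"
    using len by (intro nth_equalityI) auto
  have "?t permutes {..<n}"
  proof (rule bij_imp_permutes)
    have inj: "inj_on ?t {..<n}"
    proof (rule inj_onI)
      fix a b assume ab: "a \<in> {..<n}" "b \<in> {..<n}" "?t a = ?t b"
      have m: "vs ! (k - 1) \<noteq> 0" if "0 < k" "k < n" for k
        using nth_mem[of "k - 1" vs] st len that by auto
      show "a = b"
        using ab m[of a] m[of b] d len nth_eq_iff_index_eq[OF d, of "a - 1" "b - 1"]
        by (auto split: if_splits)
    qed
    have "?t k \<in> {..<n}" if "k \<in> {..<n}" for k
      using nth_mem[of "k - 1" vs] st len that by (auto split: if_splits)
    then have "?t ` {..<n} \<subseteq> {..<n}" by blast
    with inj show "bij_betw ?t {..<n} {..<n}"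
      unfolding bij_betw_def using endo_inj_surj[OF finite_lessThan] by blast
  qed auto
  then show "?t \<in> {\<tau>. \<tau> permutes {..<n} \<and> \<tau> 0 = 0}" by simp
qed auto

theorem Pn_eq_sum_nested:
  assumes n: "n \<ge> 1" and x: "\<And>j. j < n \<Longrightarrow> x j \<noteq> 0"
  shows "Pn n a x =
    (\<Sum>vs\<in>permutations_of_set ({..<n} - {0}). nested_term x (\<lambda>j. a j / x j) [0] 0 vs) / (\<Prod>j<n. x j)"
proof (cases "n = 1")
  case True
  have "{..<Suc 0} - {0} = ({} :: nat set)" by auto
  then have "permutations_of_set ({..<Suc 0} - {0}) = {[] :: nat list}"
    by (simp only: permutations_of_set_empty)
  then show ?thesis using True by (simp add: Pn_def)
next
  case False
  with n have n2: "n \<ge> 2" by simp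
  let ?\<beta> = "\<lambda>j. a j / x j"
  have cr: "cross x ?\<beta> p q = a p * x q - a q * x p" if "p < n" "q < n" for p q
    using x that by (simp add: cross_def field_simps)
  have "Pn n a x = (\<Sum>\<tau> | \<tau> permutes {..<n} \<and> \<tau> 0 = 0. nested_term x ?\<beta> [0] 0 (map \<tau> [Suc 0..<n]) / (\<Prod>j<n. x j))"
    unfolding Pn_def if_not_P[OF False]
  proof (rule sum.cong[OF refl])
    fix \<tau> assume "\<tau> \<in> {\<tau>. \<tau> permutes {..<n} \<and> \<tau> 0 = 0}"
    then have \<tau>: "\<tau> permutes {..<n}" "\<tau> 0 = 0" by auto
    have lt: "\<tau> k < n" if "k < n" for k using permutes_in_image[OF \<tau>(1), of k] that by simp
    have I: "{0..n - 2} = {0..<n - 1}" using n2 by auto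
    have num: "(\<Sum>k\<in>{0..j}. a (\<tau> k)) * x (\<tau> (j+1)) - a (\<tau> (j+1)) * (\<Sum>k\<in>{0..j}. x (\<tau> k))
        = (\<Sum>i\<in>{0..j}. cross x ?\<beta> (\<tau> i) (\<tau> (Suc j)))" if "j < n - 1" for j
    proof -
      have "(\<Sum>i\<in>{0..j}. cross x ?\<beta> (\<tau> i) (\<tau> (Suc j))) = (\<Sum>i\<in>{0..j}. a (\<tau> i) * x (\<tau> (Suc j)) - a (\<tau> (Suc j)) * x (\<tau> i))"
        by (intro sum.cong refl cr lt) (use that in auto)
      then show ?thesis by (simp add: sum_subtractf sum_distrib_left sum_distrib_right)
    qed
    have den: "a (\<tau> j) * x (\<tau> (j+1)) - a (\<tau> (j+1)) * x (\<tau> j) = x (\<tau> j) * x (\<tau> (Suc j)) * (?\<beta> (\<tau> j) - ?\<beta> (\<tau> (Suc j)))"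
      if "j < n - 1" for j
      using cr[of "\<tau> j" "\<tau> (Suc j)"] lt that by (simp add: cross_def)
    have px: "(\<Prod>j<n. x j) = (\<Prod>j<n. x (\<tau> j))"
      using prod.permute[OF \<tau>(1), of x] by (simp add: comp_def)
    have e1: "(\<Prod>j<n. x (\<tau> j)) = (\<Prod>j\<in>{0..<n-1}. x (\<tau> j)) * x (\<tau> (n - 1))"
      using n2 by (cases n) (auto simp: lessThan_atLeast0)
    have e2: "(\<Prod>j\<in>{0..<n-1}. x (\<tau> (Suc j))) = (\<Prod>j\<in>{1..n-2}. x (\<tau> j)) * x (\<tau> (n - 1))"
    proof -
      have "(\<Prod>j\<in>{0..<n-1}. x (\<tau> (Suc j))) = (\<Prod>j\<in>{Suc 0..<Suc (n-1)}. x (\<tau> j))"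
        by (simp add: prod.shift_bounds_Suc_ivl del: prod.op_ivl_Suc)
      also have "{Suc 0..<Suc (n-1)} = insert (n - 1) {1..n-2}" using n2 by auto
      finally have "(\<Prod>j\<in>{0..<n-1}. x (\<tau> (Suc j))) = (\<Prod>j\<in>insert (n - 1) {1..n-2}. x (\<tau> j))" .
      also have "\<dots> = x (\<tau> (n - 1)) * (\<Prod>j\<in>{1..n-2}. x (\<tau> j))"
        by (rule prod.insert) (use n2 in auto)
      finally show ?thesis by (simp add: mult.commute)
    qed
    have nz: "(\<Prod>j\<in>{1..n-2}. x (\<tau> j)) \<noteq> 0" using x lt n2 by auto
    have "nested_term x ?\<beta> [0] 0 (map \<tau> [Suc 0..<n]) = nested_term x ?\<beta> (map \<tau> [0..<Suc 0]) (\<tau> 0) (map \<tau> [Suc 0..<n])"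
      using \<tau> by simp
    also have "\<dots> = (\<Prod>j\<in>{0..<n - 1}. zeta (\<Sum>i\<in>{0..j}. cross x ?\<beta> (\<tau> i) (\<tau> (Suc j))) / (?\<beta> (\<tau> j) - ?\<beta> (\<tau> (Suc j))))"
      by (rule nested_term_prod) (use n in simp)
    finally have nt: "nested_term x ?\<beta> [0] 0 (map \<tau> [Suc 0..<n]) =
       (\<Prod>j\<in>{0..<n - 1}. zeta (\<Sum>i\<in>{0..j}. cross x ?\<beta> (\<tau> i) (\<tau> (Suc j)))) / (\<Prod>j\<in>{0..<n - 1}. ?\<beta> (\<tau> j) - ?\<beta> (\<tau> (Suc j)))"
      by (simp only: prod_dividef)
    have A: "(\<Prod>j\<in>{0..<n-1}. zeta ((\<Sum>k\<in>{0..j}. a (\<tau> k)) * x (\<tau> (j+1)) - a (\<tau> (j+1)) * (\<Sum>k\<in>{0..j}. x (\<tau> k))))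
      = (\<Prod>j\<in>{0..<n - 1}. zeta (\<Sum>i\<in>{0..j}. cross x ?\<beta> (\<tau> i) (\<tau> (Suc j))))"
      by (intro prod.cong refl arg_cong[where f=zeta] num) simp
    \<comment> \<open>Inner letters of the ordering occur in two denominators, the two end letters
      in one. The numerator cancels one copy of each inner letter, so one factor \<open>x\<close>
      per letter remains.\<close>
    have B: "(\<Prod>j\<in>{0..<n-1}. a (\<tau> j) * x (\<tau> (j+1)) - a (\<tau> (j+1)) * x (\<tau> j)) =
       (\<Prod>j\<in>{0..<n-1}. x (\<tau> j)) * ((\<Prod>j\<in>{1..n-2}. x (\<tau> j)) * x (\<tau> (n - 1))) * (\<Prod>j\<in>{0..<n - 1}. ?\<beta> (\<tau> j) - ?\<beta> (\<tau> (Suc j)))"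
      unfolding e2[symmetric] prod.distrib[symmetric] by (intro prod.cong refl den) simp
    show "(\<Prod>j\<in>{1..n-2}. x (\<tau> j)) *
         (\<Prod>j\<in>{0..n-2}. zeta ((\<Sum>k\<in>{0..j}. a (\<tau> k)) * x (\<tau> (j+1)) - a (\<tau> (j+1)) * (\<Sum>k\<in>{0..j}. x (\<tau> k))))
        / (\<Prod>j\<in>{0..n-2}. a (\<tau> j) * x (\<tau> (j+1)) - a (\<tau> (j+1)) * x (\<tau> j)) =
        nested_term x ?\<beta> [0] 0 (map \<tau> [Suc 0..<n]) / (\<Prod>j<n. x j)"
      unfolding I nt px e1 A B using nz by simp
  qed
  also have "\<dots> = (\<Sum>\<tau> | \<tau> permutes {..<n} \<and> \<tau> 0 = 0. nested_term x ?\<beta> [0] 0 (map \<tau> [Suc 0..<n])) / (\<Prod>j<n. x j)"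
    by (simp add: sum_divide_distrib)
  also have "(\<Sum>\<tau> | \<tau> permutes {..<n} \<and> \<tau> 0 = 0. nested_term x ?\<beta> [0] 0 (map \<tau> [Suc 0..<n])) =
     (\<Sum>vs\<in>permutations_of_set ({..<n} - {0}). nested_term x ?\<beta> [0] 0 vs)"
    by (rule permutes_fixing_lists) (use n in simp)
  finally show ?thesis .
qed

section \<open>Boundedness of the regularized word sum\<close>

text \<open>The points are filled in one at a time. Near each remaining point the extended function
  agrees with the old one, so the limit condition survives.\<close>

lemma removable_finite:
  assumes "finite K" "f holomorphic_on (UNIV - K)"
    and "\<And>k. k \<in> K \<Longrightarrow> ((\<lambda>z. (z - k) * f z) \<longlongrightarrow> 0) (at k)"
  obtains g where "g holomorphic_on UNIV" "\<And>z. z \<notin> K \<Longrightarrow> g z = f z"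
proof -
  have "\<exists>g. g holomorphic_on UNIV \<and> (\<forall>z. z \<notin> K \<longrightarrow> g z = f z)"
    using assms
  proof (induction K arbitrary: f rule: finite_induct)
    case (insert k K)
    have op: "open (UNIV - K)" using insert.hyps finite_imp_closed by blast
    have "f holomorphic_on (UNIV - K) - {k}"
      using insert.prems(1) by (rule holomorphic_on_subset) auto
    moreover have "k \<in> interior (UNIV - K)" using op insert.hyps by (simp add: interior_open)
    ultimately obtain g where g: "g holomorphic_on UNIV - K" "\<And>z. z \<in> UNIV - K - {k} \<Longrightarrow> g z = f z"
      using holomorphic_on_extend_lim[of f "UNIV - K" k] insert.prems(2)[of k] by auto
    have "((\<lambda>z. (z - k') * g z) \<longlongrightarrow> 0) (at k')" if "k' \<in> K" for k'
    proof (rule Lim_transform_eventually[OF insert.prems(2)])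
      have "\<forall>\<^sub>F z in at k'. z \<in> UNIV - (insert k K - {k'})"
        by (rule eventually_at_in_open') (use insert.hyps in \<open>auto intro!: open_Diff finite_imp_closed\<close>)
      moreover have "\<forall>\<^sub>F z in at k'. z \<noteq> k'" by (simp add: eventually_at_filter)
      ultimately show "\<forall>\<^sub>F z in at k'. (z - k') * f z = (z - k') * g z"
        by eventually_elim (use g(2) in auto)
    qed (use that in auto)
    from insert.IH[OF g(1) this] obtain h where
      "h holomorphic_on UNIV" "\<forall>z. z \<notin> K \<longrightarrow> h z = g z" by auto
    then show ?case using g(2) by auto
  qed auto
  then show thesis using that by auto
qed

text \<open>The value \<open>\<i> * b p\<close> with its shift, the shift parameter \<open>z\<close>
  being complex. The slope is the integer index \<open>p\<close>, so a real \<open>z > 0\<close>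
  separates any two letters by at least \<open>z\<close>; complex \<open>z\<close> gives room for
  the maximum principle.\<close>

definition line_pt :: "(nat \<Rightarrow> real) \<Rightarrow> complex \<Rightarrow> nat \<Rightarrow> complex" where
  "line_pt b z p = \<i> * of_real (b p) + z * of_nat p"

text \<open>The only shift at which the distinct letters \<open>p\<close> and \<open>q\<close>
  collide; it lies on the imaginary axis.\<close>

definition coincidence :: "(nat \<Rightarrow> real) \<Rightarrow> nat \<Rightarrow> nat \<Rightarrow> complex" where
  "coincidence b p q = - \<i> * of_real ((b p - b q) / (real p - real q))"

text \<open>Different pairs collide at different shifts, so at each collision a single difference
  vanishes; \<open>inj_on b\<close> keeps the shift 0 free of collisions.\<close>

definition generic :: "nat set \<Rightarrow> (nat \<Rightarrow> real) \<Rightarrow> bool" where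
  "generic A b \<longleftrightarrow> inj_on b A \<and> (\<forall>p\<in>A. \<forall>q\<in>A. \<forall>r\<in>A. \<forall>s\<in>A.
     p \<noteq> q \<longrightarrow> r \<noteq> s \<longrightarrow> {p, q} \<noteq> {r, s} \<longrightarrow> coincidence b p q \<noteq> coincidence b r s)"

lemma line_pt_diff:
  assumes "p \<noteq> q"
  shows "line_pt b z p - line_pt b z q = of_real (real p - real q) * (z - coincidence b p q)"
  using assms by (simp add: line_pt_def coincidence_def field_simps)

lemma line_pt_eq_iff:
  "p \<noteq> q \<Longrightarrow> line_pt b z p = line_pt b z q \<longleftrightarrow> z = coincidence b p q"
  using line_pt_diff[of p q b z] by auto

lemma holomorphic_line_pt [holomorphic_intros]: "(\<lambda>z. line_pt b z p) holomorphic_on S"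
  unfolding line_pt_def by (intro holomorphic_intros)

lemma holomorphic_cross_sum [holomorphic_intros]:
  "(\<lambda>z. cross_sum x (line_pt b z) ws v) holomorphic_on S"
  by (induction ws) (auto simp: cross_def intro!: holomorphic_intros)

lemma isCont_line_pt [continuous_intros]: "isCont (\<lambda>z. line_pt b z p) k"
  unfolding line_pt_def by (intro continuous_intros)

lemma isCont_cross_sum [continuous_intros]: "isCont (\<lambda>z. cross_sum x (line_pt b z) ws v) k"
  by (induction ws) (auto simp: cross_def intro!: continuous_intros)

lemma isCont_zeta_cross_sum [continuous_intros]:
  "isCont (\<lambda>z. zeta (cross_sum x (line_pt b z) ws v)) k"
  unfolding zeta_def by (intro continuous_intros) auto

lemma holomorphic_word_term:
  assumes "distinct w" "\<And>z. z \<in> S \<Longrightarrow> inj_on (line_pt b z) (set w)"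
  shows "(\<lambda>z. word_term x (line_pt b z) w) holomorphic_on S"
  using assms
proof (induction w rule: induct_list012)
  case (3 v u ws)
  have "(\<lambda>z. word_term x (line_pt b z) (u # ws)) holomorphic_on S"
    by (rule "3.IH"(2)) (use "3.prems" in \<open>auto intro: inj_on_subset\<close>)
  moreover have "line_pt b z u - line_pt b z v \<noteq> 0" if "z \<in> S" for z
    using "3.prems"(1) "3.prems"(2)[OF that] by (auto simp: inj_on_def)
  ultimately show ?case by (auto intro!: holomorphic_intros simp del: cross_sum_simps)
qed simp_all

lemma isCont_nested_term:
  assumes "distinct (u # vs)" "inj_on (line_pt b k) (set (u # vs))"
  shows "isCont (\<lambda>z. nested_term x (line_pt b z) vis u vs) k"
  using assms
proof (induction vs arbitrary: vis u)
  case (Cons v vs)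
  have "isCont (\<lambda>z. nested_term x (line_pt b z) (vis @ [v]) v vs) k"
    by (rule Cons.IH) (use Cons.prems in \<open>auto intro: inj_on_subset\<close>)
  moreover have "line_pt b k u - line_pt b k v \<noteq> 0"
    using Cons.prems by (auto simp: inj_on_def)
  ultimately show ?case by (auto intro!: continuous_intros simp del: cross_sum_simps)
qed simp

text \<open>The nested form is rooted at \<open>i\<close>, one of the two letters that collide at
  \<open>k\<close>. As \<open>i\<close> occurs only at the root, the difference of \<open>i\<close>
  and \<open>j\<close> is a denominator only when \<open>j\<close> is placed immediately after it,
  and there the numerator, \<open>zeta\<close> of the cross term of \<open>i\<close> and
  \<open>j\<close>, vanishes at \<open>k\<close> as well. Genericity keeps all other denominators
  away from 0 at \<open>k\<close>.\<close>

lemma word_term_removable: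
  assumes fin: "finite A" and gen: "generic A b" and ij: "i \<in> A" "j \<in> A" "i \<noteq> j"
    and K: "K = {coincidence b p q |p q. p \<in> A \<and> q \<in> A \<and> p \<noteq> q}"
  defines "k \<equiv> coincidence b i j"
  shows "((\<lambda>z. (z - k) * (\<Sum>w\<in>permutations_of_set A. word_term x (line_pt b z) w)) \<longlongrightarrow> 0) (at k)"
proof (rule Lim_transform_eventually)
  have injk: "line_pt b k p \<noteq> line_pt b k q" if "p \<in> A" "q \<in> A" "p \<noteq> q" "{p, q} \<noteq> {i, j}" for p q
    using gen ij that unfolding generic_def k_def by (metis line_pt_eq_iff)
  let ?nt = "\<lambda>z vs. nested_term x (line_pt b z) [i] i vs"
  have 1: "((\<lambda>z. (z - k) * ?nt z vs) \<longlongrightarrow> 0) (at k)" if vs: "vs \<in> permutations_of_set (A - {i})" for vs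
  proof (cases vs)
    case Nil
    then have "isCont (\<lambda>z. (z - k) * ?nt z vs) k" by (auto intro!: continuous_intros)
    then show ?thesis by (simp add: isCont_def)
  next
    case (Cons v vs')
    have d: "distinct (v # vs')" and st: "set (v # vs') = A - {i}"
      using vs Cons by (auto simp: permutations_of_set_def)
    have "inj_on (line_pt b k) (set (v # vs'))"
      unfolding st by (rule inj_onI) (use injk in \<open>auto simp: doubleton_eq_iff\<close>)
    from isCont_nested_term[OF d this]
    have c: "isCont (\<lambda>z. nested_term x (line_pt b z) ([i] @ [v]) v vs') k" .
    have v: "v \<in> A" "v \<noteq> i" using st by auto
    show ?thesis
    proof (cases "v = j")
      case False
      then have "line_pt b k i - line_pt b k v \<noteq> 0"
        using injk[of i v] v ij by (auto simp: doubleton_eq_iff)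
      then have "isCont (\<lambda>z. (z - k) * ?nt z vs) k"
        using c Cons by (auto intro!: continuous_intros simp del: cross_sum_simps)
      then show ?thesis by (simp add: isCont_def)
    next
      case True
      have z0: "zeta (cross_sum x (line_pt b k) [i] v) = 0"
      proof -
        have "line_pt b k i = line_pt b k v" using True ij line_pt_eq_iff[of i j b k] k_def by simp
        then show ?thesis by (simp add: cross_def zeta_def)
      qed
      \<comment> \<open>The factor \<open>z - k\<close> cancels against the denominator, which is
        \<open>real i - real v\<close> times \<open>z - k\<close>. What is left is continuous and
        vanishes at \<open>k\<close> together with \<open>zeta\<close>.\<close>
      have "isCont (\<lambda>z. zeta (cross_sum x (line_pt b z) [i] v) / of_real (real i - real v)
          * nested_term x (line_pt b z) ([i] @ [v]) v vs') k"
        using c v by (auto intro!: continuous_intros simp del: cross_sum_simps)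
      then have "((\<lambda>z. zeta (cross_sum x (line_pt b z) [i] v) / of_real (real i - real v)
          * nested_term x (line_pt b z) ([i] @ [v]) v vs') \<longlongrightarrow> 0) (at k)"
        using z0 by (simp add: isCont_def)
      then show ?thesis
      proof (rule Lim_transform_eventually)
        have "\<forall>\<^sub>F z in at k. z \<noteq> k" by (simp add: eventually_at_filter)
        then show "\<forall>\<^sub>F z in at k. zeta (cross_sum x (line_pt b z) [i] v) / of_real (real i - real v)
          * nested_term x (line_pt b z) ([i] @ [v]) v vs' = (z - k) * ?nt z vs"
        proof eventually_elim
          case (elim z)
          have "line_pt b z i - line_pt b z v = of_real (real i - real v) * (z - k)"
            using line_pt_diff[of i j b z] True ij k_def by simp
          then show ?case using elim Cons by (simp del: cross_sum_simps)
        qed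
      qed
    qed
  qed
  have "((\<lambda>z. (\<Sum>vs\<in>permutations_of_set (A - {i}). (z - k) * ?nt z vs)) \<longlongrightarrow> (\<Sum>vs\<in>permutations_of_set (A - {i}). 0)) (at k)"
    by (rule tendsto_sum) (rule 1)
  then show "((\<lambda>z. (z - k) * (\<Sum>vs\<in>permutations_of_set (A - {i}). ?nt z vs)) \<longlongrightarrow> 0) (at k)"
    by (simp add: sum_distrib_left)
  have finK: "finite K"
  proof (rule finite_subset)
    show "K \<subseteq> (\<lambda>(p, q). coincidence b p q) ` (A \<times> A)" unfolding K by auto
  qed (use fin in auto)
  have "\<forall>\<^sub>F z in at k. z \<in> UNIV - (K - {k})"
    by (rule eventually_at_in_open') (use finK in \<open>auto intro!: open_Diff finite_imp_closed\<close>)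
  moreover have "\<forall>\<^sub>F z in at k. z \<noteq> k" by (simp add: eventually_at_filter)
  ultimately show "\<forall>\<^sub>F z in at k. (z - k) * (\<Sum>vs\<in>permutations_of_set (A - {i}). ?nt z vs) =
     (z - k) * (\<Sum>w\<in>permutations_of_set A. word_term x (line_pt b z) w)"
  proof eventually_elim
    case (elim z)
    then have "inj_on (line_pt b z) A"
      unfolding K inj_on_def using line_pt_eq_iff[of _ _ b z] by blast
    then show ?case using sum_nested_eq_sum_words[OF fin ij(1)] by simp
  qed
qed

text \<open>Only the separation \<open>d\<close> and the radius \<open>R\<close> enter: the real
  parts of the exponents do not involve \<open>b\<close>, so one constant serves all
  \<open>b\<close> at once.\<close>

lemma word_term_bound:
  fixes x :: "nat \<Rightarrow> real"
  assumes "R \<ge> 0" "d > 0" "distinct w"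
  shows "\<exists>C\<ge>0. \<forall>b z. norm z \<le> R \<longrightarrow> (\<forall>p\<in>set w. \<forall>q\<in>set w. p \<noteq> q \<longrightarrow> d \<le> norm (line_pt b z p - line_pt b z q)) \<longrightarrow>
     norm (word_term (\<lambda>k. of_real (x k)) (line_pt b z) w) \<le> C"
  using assms(3)
proof (induction w rule: induct_list012)
  case (3 v u ws)
  then obtain C where C: "C \<ge> 0" "\<And>b z. norm z \<le> R \<Longrightarrow>
     (\<forall>p\<in>set (u # ws). \<forall>q\<in>set (u # ws). p \<noteq> q \<longrightarrow> d \<le> norm (line_pt b z p - line_pt b z q)) \<Longrightarrow>
     norm (word_term (\<lambda>k. of_real (x k)) (line_pt b z) (u # ws)) \<le> C"
    by (metis distinct.simps(2))
  define D where "D = (\<Sum>k\<leftarrow>u # ws. \<bar>x k * x v\<bar> * \<bar>real k - real v\<bar>)"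
  have re: "Re (cross_sum (\<lambda>k. of_real (x k)) (line_pt b z) vs v) \<le>
      R * (\<Sum>k\<leftarrow>vs. \<bar>x k * x v\<bar> * \<bar>real k - real v\<bar>)" if "norm z \<le> R" for b z vs
  proof (induction vs)
    case (Cons k vs)
    have "Re (cross (\<lambda>k. of_real (x k)) (line_pt b z) k v) = Re z * (x k * x v * (real k - real v))"
      by (simp add: cross_def line_pt_def algebra_simps)
    also have "\<dots> \<le> \<bar>Re z\<bar> * (\<bar>x k * x v\<bar> * \<bar>real k - real v\<bar>)"
      by (metis abs_ge_self abs_mult)
    also have "\<dots> \<le> R * (\<bar>x k * x v\<bar> * \<bar>real k - real v\<bar>)"
      using abs_Re_le_cmod[of z] that by (intro mult_right_mono) auto
    finally show ?case using Cons by (simp add: ring_distribs)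
  qed simp
  show ?case
  proof (intro exI[of _ "C * exp (R * D / 2) / d"] conjI allI impI)
    fix b z
    assume z: "norm z \<le> R" "\<forall>p\<in>set (v # u # ws). \<forall>q\<in>set (v # u # ws). p \<noteq> q \<longrightarrow> d \<le> norm (line_pt b z p - line_pt b z q)"
    have "norm (line_pt b z u - line_pt b z v) \<ge> d"
      using z(2) "3.prems" by auto
    moreover have "norm (word_term (\<lambda>k. of_real (x k)) (line_pt b z) (u # ws)) \<le> C"
      by (rule C(2)) (use z in auto)
    moreover have "norm (exp (cross_sum (\<lambda>k. of_real (x k)) (line_pt b z) (u # ws) v / 2)) \<le> exp (R * D / 2)"
      using re[OF z(1), of b "u # ws"] unfolding D_def norm_exp_eq_Re by simp
    ultimately show "norm (word_term (\<lambda>k. of_real (x k)) (line_pt b z) (v # u # ws)) \<le> C * exp (R * D / 2) / d"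
      unfolding word_term.simps norm_divide norm_mult
      using assms(2) C(1) by (intro frac_le mult_mono) auto
  qed (use assms C in auto)
qed (auto intro: exI[of _ 1])

text \<open>Pigeonhole: at most \<open>N\<close> integers are roundings of elements of
  \<open>S\<close>, while \<open>N + 1\<close> candidates are available.\<close>

lemma avoiding_radius:
  fixes S :: "real set"
  assumes "finite S" "card S \<le> N"
  obtains R :: nat where "2 \<le> R" "R \<le> N + 2" "\<And>s. s \<in> S \<Longrightarrow> 1 / 2 \<le> \<bar>real R - s\<bar>"
proof -
  let ?I = "int ` {2..N + 2}"
  have "\<not> ?I \<subseteq> round ` S"
  proof
    assume "?I \<subseteq> round ` S"
    then have "card ?I \<le> card (round ` S)" by (rule card_mono[rotated]) (use assms in auto)
    also have "\<dots> \<le> N" using card_image_le[OF assms(1), of round] assms(2) by simp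
    finally show False by (simp add: card_image)
  qed
  then obtain R where R: "R \<in> {2..N + 2}" "int R \<notin> round ` S" by blast
  have "1 / 2 \<le> \<bar>real R - s\<bar>" if "s \<in> S" for s
  proof (rule ccontr)
    assume "\<not> ?thesis"
    then have "\<bar>s - of_int (int R)\<bar> < 1 / 2" by (simp add: abs_minus_commute)
    then have "round s = int R" by (rule round_unique')
    then show False using R that by force
  qed
  then show thesis using that R by auto
qed

text \<open>On a circle whose radius differs by at least 1/2 from the moduli of all collisions, each
  word is bounded separately. The number of collisions is bounded in terms of \<open>card A\<close>
  alone, hence so is the radius, and the estimate is uniform in \<open>b\<close>. Inside the circle
  only the sum, not the single words, extends across the collisions.\<close>

theorem word_sum_bounded:
  fixes x :: "nat \<Rightarrow> real"
  assumes fin: "finite A"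
  shows "\<exists>C. \<forall>b z. generic A b \<longrightarrow> norm z \<le> 1 \<longrightarrow> inj_on (line_pt b z) A \<longrightarrow>
     norm (\<Sum>w\<in>permutations_of_set A. word_term (\<lambda>k. of_real (x k)) (line_pt b z) w) \<le> C"
proof -
  let ?P = "permutations_of_set A" and ?x = "\<lambda>k. of_real (x k) :: complex"
  define N where "N = card (A \<times> A)"
  have "\<exists>C\<ge>0. \<forall>b z. norm z \<le> real (N + 2) \<longrightarrow> (\<forall>p\<in>set w. \<forall>q\<in>set w. p \<noteq> q \<longrightarrow> 1/2 \<le> norm (line_pt b z p - line_pt b z q)) \<longrightarrow>
     norm (word_term ?x (line_pt b z) w) \<le> C" if "w \<in> ?P" for w
    by (rule word_term_bound) (use that in \<open>auto simp: permutations_of_set_def\<close>)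
  then obtain C where C: "\<And>w b z. w \<in> ?P \<Longrightarrow> norm z \<le> real (N + 2) \<Longrightarrow>
     (\<forall>p\<in>set w. \<forall>q\<in>set w. p \<noteq> q \<longrightarrow> 1/2 \<le> norm (line_pt b z p - line_pt b z q)) \<Longrightarrow>
     norm (word_term ?x (line_pt b z) w) \<le> C w"
    by metis
  show ?thesis
  proof (intro exI[of _ "\<Sum>w\<in>?P. C w"] allI impI)
    fix b z
    assume gen: "generic A b" and z: "norm z \<le> 1" "inj_on (line_pt b z) A"
    define f where "f = (\<lambda>z. \<Sum>w\<in>?P. word_term ?x (line_pt b z) w)"
    define K where "K = {coincidence b p q |p q. p \<in> A \<and> q \<in> A \<and> p \<noteq> q}"
    have Ksub: "K \<subseteq> (\<lambda>(p, q). coincidence b p q) ` (A \<times> A)" unfolding K_def by auto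
    have finK: "finite K" using finite_subset[OF Ksub] fin by auto
    have "card K \<le> N"
      unfolding N_def using order_trans[OF card_mono[OF _ Ksub] card_image_le] fin by simp
    then have "card (norm ` K) \<le> N" using card_image_le[OF finK, of norm] by simp
    then obtain R where R: "2 \<le> R" "R \<le> N + 2" "\<And>s. s \<in> norm ` K \<Longrightarrow> 1 / 2 \<le> \<bar>real R - s\<bar>"
      using avoiding_radius[of "norm ` K" N] finK by auto
    have notK: "inj_on (line_pt b z) A \<longleftrightarrow> z \<notin> K" for z
      unfolding K_def inj_on_def using line_pt_eq_iff by blast
    have "f holomorphic_on (UNIV - K)"
      unfolding f_def
    proof (intro holomorphic_on_sum holomorphic_word_term)
      fix w z assume "w \<in> ?P" "z \<in> UNIV - K"
      then show "inj_on (line_pt b z) (set w)"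
        using notK by (auto simp: permutations_of_set_def)
    qed (auto simp: permutations_of_set_def)
    moreover have "((\<lambda>z. (z - k) * f z) \<longlongrightarrow> 0) (at k)" if "k \<in> K" for k
      using that unfolding f_def K_def
      by clarify (rule word_term_removable[OF fin gen _ _ _ refl], auto)
    ultimately obtain g where g: "g holomorphic_on UNIV" "\<And>z. z \<notin> K \<Longrightarrow> g z = f z"
      using removable_finite[OF finK] by blast
    have circ: "norm (g y) \<le> (\<Sum>w\<in>?P. C w)" if y: "norm y = real R" for y
    proof -
      have "y \<notin> K" using R(3)[of "norm y"] y by (metis abs_zero diff_self half_gt_zero imageI not_le zero_less_one)
      then have "g y = f y" by (rule g(2))
      also have "norm \<dots> \<le> (\<Sum>w\<in>?P. C w)"
        unfolding f_def
      proof (intro sum_norm_le C ballI impI)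
        fix w p q assume w: "w \<in> ?P" and pq: "p \<in> set w" "q \<in> set w" "p \<noteq> q"
        then have "p \<in> A" "q \<in> A" by (auto simp: permutations_of_set_def)
        then have "1 / 2 \<le> \<bar>norm y - norm (coincidence b p q)\<bar>"
          using R(3)[of "norm (coincidence b p q)"] y pq unfolding K_def by auto
        also have "\<dots> \<le> norm (y - coincidence b p q)" by (rule norm_triangle_ineq3)
        also have "\<dots> \<le> \<bar>real p - real q\<bar> * norm (y - coincidence b p q)"
        proof -
          have "1 \<le> \<bar>real p - real q\<bar>" using pq(3) by linarith
          then show ?thesis using mult_right_mono[of 1 "\<bar>real p - real q\<bar>"] by simp
        qed
        also have "\<dots> = norm (line_pt b y p - line_pt b y q)"
          unfolding line_pt_diff[OF pq(3)] norm_mult norm_of_real ..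
        finally show "1 / 2 \<le> norm (line_pt b y p - line_pt b y q)" .
      qed (use y R in auto)
      finally show ?thesis .
    qed
    \<comment> \<open>The radius is at least 2, so the unit disc of shifts lies inside.\<close>
    have "norm (g z) \<le> (\<Sum>w\<in>?P. C w)"
    proof (rule maximum_modulus_frontier[of g "cball 0 (real R)"])
      show "g holomorphic_on interior (cball 0 (real R))" "continuous_on (closure (cball 0 (real R))) g"
        using g(1) by (auto intro: holomorphic_on_subset holomorphic_on_imp_continuous_on)
      show "z \<in> cball 0 (real R)" using z(1) R(1) by simp
      show "norm (g y) \<le> (\<Sum>w\<in>?P. C w)" if "y \<in> frontier (cball 0 (real R))" for y
        by (rule circ) (use that R(1) in \<open>simp add: frontier_cball\<close>)
    qed auto
    then show "norm (\<Sum>w\<in>?P. word_term ?x (line_pt b z) w) \<le> (\<Sum>w\<in>?P. C w)"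
      using g(2)[of z] notK z(2) unfolding f_def by simp
  qed
qed

section \<open>Constrained Gaussian chains\<close>

definition gauss :: "real \<Rightarrow> real \<Rightarrow> real" where
  "gauss y p = exp (- p\<^sup>2 / (2 * y)) / sqrt (2 * pi * y)"

definition gauss_conv :: "real \<Rightarrow> (real \<Rightarrow> real) \<Rightarrow> real \<Rightarrow> real" where
  "gauss_conv y f q = (\<integral>r. f r * gauss y (q - r) \<partial>lborel)"

definition bdd_borel :: "(real \<Rightarrow> real) \<Rightarrow> bool" where
  "bdd_borel f \<longleftrightarrow> f \<in> borel_measurable borel \<and> (\<exists>M. \<forall>r. \<bar>f r\<bar> \<le> M)"

text \<open>A parabola in the partial sum \<open>c\<close>, zero at \<open>c = 0\<close> and at
  \<open>c = X\<close>.\<close>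

definition threshold :: "real \<Rightarrow> real \<Rightarrow> real" where
  "threshold X c = c * (X - c) / 2"

lemma gauss_eq_normal: "y > 0 \<Longrightarrow> gauss y p = normal_density 0 (sqrt y) p"
  by (simp add: gauss_def normal_density_def)

lemma gauss_measurable [measurable]: "gauss y \<in> borel_measurable borel"
  unfolding gauss_def by measurable

lemma gauss_nonneg: "y > 0 \<Longrightarrow> 0 \<le> gauss y p"
  by (simp add: gauss_def)

lemma gauss_le: "y > 0 \<Longrightarrow> gauss y p \<le> 1 / sqrt (2 * pi * y)"
  unfolding gauss_def by (intro divide_right_mono) auto

lemma gauss_commute: "gauss y (p - q) = gauss y (q - p)"
  by (simp add: gauss_def power2_commute)

lemma gauss_shift:
  assumes "y > 0"
  shows gauss_integrable: "integrable lborel (\<lambda>r. gauss y (q - r))"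
    and gauss_integral: "(\<integral>r. gauss y (q - r) \<partial>lborel) = 1"
proof -
  have "(\<lambda>r. gauss y (q - r)) = normal_density q (sqrt y)"
    using assms by (auto simp: gauss_def normal_density_def power2_commute)
  then show "integrable lborel (\<lambda>r. gauss y (q - r))" "(\<integral>r. gauss y (q - r) \<partial>lborel) = 1"
    using assms by auto
qed

lemma gauss_shift':
  assumes "y > 0"
  shows "integrable lborel (\<lambda>r. gauss y (r - q))" "(\<integral>r. gauss y (r - q) \<partial>lborel) = 1"
  using gauss_shift[OF assms, of q] by (simp_all add: gauss_commute[of y _ q])

lemma bdd_borelE:
  assumes "bdd_borel f"
  obtains M where "M \<ge> 0" "f \<in> borel_measurable borel" "\<And>r. \<bar>f r\<bar> \<le> M"
  using assms unfolding bdd_borel_def by (metis abs_ge_zero order_trans)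

lemma bdd_borel_measurable: "bdd_borel f \<Longrightarrow> f \<in> borel_measurable borel"
  by (simp add: bdd_borel_def)

lemma integrable_gauss_conv:
  assumes "y > 0" "bdd_borel f"
  shows "integrable lborel (\<lambda>r. f r * gauss y (q - r))"
proof -
  from assms(2) obtain M where M: "M \<ge> 0" "f \<in> borel_measurable borel" "\<And>r. \<bar>f r\<bar> \<le> M"
    by (rule bdd_borelE) blast
  note [measurable] = M(2)
  have "integrable lborel (\<lambda>r. M * gauss y (q - r))"
    using gauss_integrable[OF assms(1)] by simp
  then show ?thesis
    by (rule Bochner_Integration.integrable_bound)
       (use M gauss_nonneg[OF assms(1)] in \<open>auto simp: abs_mult intro!: mult_right_mono\<close>)
qed

lemma gauss_conv_abs_le:
  assumes "y > 0" "f \<in> borel_measurable borel" "\<And>r. \<bar>f r\<bar> \<le> M"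
  shows "\<bar>gauss_conv y f q\<bar> \<le> M"
proof -
  have "norm (gauss_conv y f q) \<le> (\<integral>r. M * gauss y (q - r) \<partial>lborel)"
    unfolding gauss_conv_def
  proof (rule Bochner_Integration.integral_norm_bound_integral)
    show "integrable lborel (\<lambda>r. f r * gauss y (q - r))"
      using assms by (intro integrable_gauss_conv) (auto simp: bdd_borel_def)
    show "integrable lborel (\<lambda>r. M * gauss y (q - r))"
      using gauss_integrable[OF assms(1)] by simp
    show "norm (f r * gauss y (q - r)) \<le> M * gauss y (q - r)" for r
      using assms(3)[of r] gauss_nonneg[OF assms(1)] by (auto simp: abs_mult intro!: mult_right_mono)
  qed
  then show ?thesis using gauss_integral[OF assms(1)] by simp
qed

lemma gauss_conv_measurable:
  assumes [measurable]: "f \<in> borel_measurable borel"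
  shows "gauss_conv y f \<in> borel_measurable borel"
  unfolding gauss_conv_def by measurable

lemma bdd_borel_gauss_conv:
  assumes "y > 0" "bdd_borel f"
  shows "bdd_borel (gauss_conv y f)"
  using assms(2) gauss_conv_abs_le[OF assms(1), of f] gauss_conv_measurable[of f y]
  unfolding bdd_borel_def by metis

lemma bdd_borel_gauss: "y > 0 \<Longrightarrow> bdd_borel (gauss y)"
  unfolding bdd_borel_def using gauss_le gauss_nonneg by (metis abs_of_nonneg gauss_measurable)

lemma bdd_borel_mult:
  assumes "bdd_borel f" "bdd_borel g"
  shows "bdd_borel (\<lambda>r. f r * g r)"
proof -
  obtain M where M: "M \<ge> 0" "f \<in> borel_measurable borel" "\<And>r. \<bar>f r\<bar> \<le> M" using assms(1) by (rule bdd_borelE) blast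
  obtain N where N: "N \<ge> 0" "g \<in> borel_measurable borel" "\<And>r. \<bar>g r\<bar> \<le> N" using assms(2) by (rule bdd_borelE) blast
  have "\<bar>f r * g r\<bar> \<le> M * N" for r unfolding abs_mult using M N by (intro mult_mono) auto
  then show ?thesis unfolding bdd_borel_def using M N by auto
qed

lemma bdd_borel_sum:
  assumes "\<And>i. i \<in> I \<Longrightarrow> bdd_borel (f i)"
  shows "bdd_borel (\<lambda>r. \<Sum>i\<in>I. f i r)"
proof (cases "finite I")
  case True
  have "\<exists>M. \<forall>r. \<bar>f i r\<bar> \<le> M" if "i \<in> I" for i using assms[OF that] by (simp add: bdd_borel_def)
  then obtain M where M: "\<And>i r. i \<in> I \<Longrightarrow> \<bar>f i r\<bar> \<le> M i" by metis
  have "\<bar>\<Sum>i\<in>I. f i r\<bar> \<le> sum M I" for r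
    using M by (intro order_trans[OF sum_abs] sum_mono) auto
  then show ?thesis using assms unfolding bdd_borel_def by (intro conjI borel_measurable_sum) auto
qed (auto simp: bdd_borel_def)

lemma bdd_borel_step: "bdd_borel (\<lambda>r. if c \<le> r then 1 else 0)"
  unfolding bdd_borel_def by (auto intro!: exI[of _ 1])

lemma bdd_borel_uminus: "bdd_borel f \<Longrightarrow> bdd_borel (\<lambda>r. - f r)"
  by (auto simp: bdd_borel_def)

lemma gauss_conv_sum:
  assumes "y > 0" "\<And>i. i \<in> I \<Longrightarrow> bdd_borel (f i)"
  shows "gauss_conv y (\<lambda>r. \<Sum>i\<in>I. f i r) q = (\<Sum>i\<in>I. gauss_conv y (f i) q)"
  unfolding gauss_conv_def sum_distrib_right
  using integrable_gauss_conv[OF assms(1)] assms(2) by (intro Bochner_Integration.integral_sum) auto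

lemma gauss_conv_diff:
  assumes "y > 0" "bdd_borel f" "bdd_borel g"
  shows "gauss_conv y (\<lambda>r. f r - g r) q = gauss_conv y f q - gauss_conv y g q"
  unfolding gauss_conv_def left_diff_distrib
  using integrable_gauss_conv[OF assms(1)] assms(2,3) by (intro Bochner_Integration.integral_diff) auto

lemma gauss_conv_uminus: "gauss_conv y (\<lambda>r. - f r) q = - gauss_conv y f q"
  unfolding gauss_conv_def by simp

lemma gauss_conv_gauss:
  assumes "y > 0" "z > 0"
  shows "gauss_conv y (gauss z) q = gauss (y + z) q"
proof -
  have "(\<lambda>x. \<integral>\<^sup>+t. ennreal (normal_density 0 (sqrt y) (x - t) * normal_density 0 (sqrt z) t) \<partial>lborel) =
    normal_density 0 (sqrt ((sqrt y)\<^sup>2 + (sqrt z)\<^sup>2))"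
    by (rule conv_normal_density_zero_mean) (use assms in auto)
  from fun_cong[OF this, of q] have "(\<integral>\<^sup>+t. ennreal (gauss z t * gauss y (q - t)) \<partial>lborel) = ennreal (gauss (y + z) q)"
    using assms by (simp add: gauss_eq_normal mult.commute)
  then show ?thesis
    unfolding gauss_conv_def using assms
    by (subst integral_eq_nn_integral) (auto simp: gauss_nonneg)
qed

text \<open>Fubini reduces this to the semigroup law of the kernel itself. It is the step that fuses
  two neighbouring blocks into one.\<close>

lemma gauss_conv_gauss_conv:
  assumes y: "y > 0" "z > 0" and f: "bdd_borel f"
  shows "gauss_conv y (gauss_conv z f) q = gauss_conv (y + z) f q"
proof -
  from f obtain M where M: "M \<ge> 0" "f \<in> borel_measurable borel" "\<And>r. \<bar>f r\<bar> \<le> M"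
    by (rule bdd_borelE) blast
  note [measurable] = M(2)
  let ?h = "\<lambda>r s. f s * gauss z (r - s) * gauss y (q - r)"
  have int: "integrable (lborel \<Otimes>\<^sub>M lborel) (\<lambda>(r, s). ?h r s)"
  proof (rule Bochner_Integration.integrable_bound)
    show "integrable (lborel \<Otimes>\<^sub>M lborel) (\<lambda>(r, s). M * gauss z (r - s) * gauss y (q - r))"
    proof (rule lborel_pair.Fubini_integrable)
      show "integrable lborel (\<lambda>r. \<integral>s. norm (case (r, s) of (r, s) \<Rightarrow> M * gauss z (r - s) * gauss y (q - r)) \<partial>lborel)"
        using gauss_integral[OF y(2)] gauss_integrable[OF y(1)] gauss_nonneg[OF y(1)] gauss_nonneg[OF y(2)] M(1)
        by (simp add: abs_mult)
    qed (use gauss_integrable[OF y(2)] in auto)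
  qed (use M gauss_nonneg[OF y(1)] gauss_nonneg[OF y(2)] in \<open>auto simp: abs_mult intro!: mult_right_mono AE_I2\<close>)
  have "gauss_conv y (gauss_conv z f) q = (\<integral>r. (\<integral>s. ?h r s \<partial>lborel) \<partial>lborel)"
    unfolding gauss_conv_def by simp
  also have "\<dots> = (\<integral>s. (\<integral>r. ?h r s \<partial>lborel) \<partial>lborel)"
    by (rule lborel_pair.Fubini_integral[symmetric]) (use int in simp)
  also have "\<dots> = (\<integral>s. f s * gauss (y + z) (q - s) \<partial>lborel)"
  proof (rule Bochner_Integration.integral_cong[OF refl])
    fix s
    have "(\<integral>r. gauss z (r - s) * gauss y (q - r) \<partial>lborel) = (\<integral>t. gauss z t * gauss y (q - s - t) \<partial>lborel)"
      using lborel_integral_real_affine[of 1 "\<lambda>r. gauss z (r - s) * gauss y (q - r)" s] by (simp add: algebra_simps)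
    also have "\<dots> = gauss (y + z) (q - s)"
      using gauss_conv_gauss[OF y] unfolding gauss_conv_def .
    finally show "(\<integral>r. ?h r s \<partial>lborel) = f s * gauss (y + z) (q - s)"
      by (simp add: mult.assoc)
  qed
  finally show ?thesis unfolding gauss_conv_def .
qed

text \<open>The density at \<open>q\<close> of a Gaussian walk from 0 whose step variances are the
  list entries read from the end, restricted to paths that lie on or above \<open>threshold\<close>
  at each intermediate time.\<close>

fun block_chain :: "real \<Rightarrow> real list \<Rightarrow> real \<Rightarrow> real" where
  "block_chain X [] q = 0"
| "block_chain X [y] q = gauss y q"
| "block_chain X (y # z # zs) q =
     gauss_conv y (\<lambda>r. (if threshold X (sum_list (z # zs)) \<le> r then 1 else 0) * block_chain X (z # zs) r) q"

definition step_sign :: "nat \<Rightarrow> nat \<Rightarrow> real \<Rightarrow> real" where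
  "step_sign u v t = (if u > v then (if t > 0 then 1 else 0) else (if t > 0 then 0 else - 1))"

text \<open>What Gaussian integration makes of a shifted word, up to a constant
  (\<open>word_integral_eq_chain\<close>). Both exponentials stem from the real parts of the shift
  and become 1 at \<open>\<delta> = 0\<close>.\<close>

fun word_chain :: "real \<Rightarrow> (nat \<Rightarrow> real) \<Rightarrow> real \<Rightarrow> nat list \<Rightarrow> real \<Rightarrow> real" where
  "word_chain X x \<delta> [] q = 0"
| "word_chain X x \<delta> [v] q = gauss (x v) q"
| "word_chain X x \<delta> (v # u # ws) q =
     exp (\<delta> / 2 * (\<Sum>k\<leftarrow>u # ws. x k * x v * (real k - real v))) *
     gauss_conv (x v) (\<lambda>r. step_sign u v (threshold X (\<Sum>k\<leftarrow>u # ws. x k) - r) *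
        exp (- \<delta> * (real u - real v) * (threshold X (\<Sum>k\<leftarrow>u # ws. x k) - r)) *
        word_chain X x \<delta> (u # ws) r) q"

lemma bdd_borel_block_chain:
  assumes "\<And>y. y \<in> set ys \<Longrightarrow> y > 0"
  shows "bdd_borel (block_chain X ys)"
  using assms
proof (induction ys rule: induct_list012)
  case 1
  then show ?case by (auto simp: bdd_borel_def)
next
  case (2 y)
  then show ?case using bdd_borel_gauss[of y] by (simp add: fun_eq_iff[symmetric])
next
  case (3 y z zs)
  have "bdd_borel (block_chain X (z # zs))" by (rule "3.IH"(2)) (use "3.prems" in auto)
  then have "bdd_borel (gauss_conv y (\<lambda>r. (if threshold X (sum_list (z # zs)) \<le> r then 1 else 0) * block_chain X (z # zs) r))"
    using "3.prems" by (intro bdd_borel_gauss_conv bdd_borel_mult bdd_borel_step) auto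
  then show ?case by simp
qed

text \<open>\<open>step_sign\<close> is supported where \<open>(real u - real v) * t\<close> is
  nonnegative, and there the exponential does not exceed 1. Descents and ascents thus share a bound
  that is uniform in \<open>\<delta>\<close>, as dominated convergence requires.\<close>

lemma step_sign_exp_le:
  assumes "\<delta> \<ge> 0"
  shows "\<bar>step_sign u v t * exp (- \<delta> * (real u - real v) * t)\<bar> \<le> 1"
proof -
  have "\<bar>step_sign u v t * exp (- \<delta> * (real u - real v) * t)\<bar> \<le> 1"
  proof (cases "step_sign u v t = 0")
    case False
    then have s: "\<bar>step_sign u v t\<bar> = 1" "0 \<le> (real u - real v) * t"
      by (auto simp: step_sign_def mult_nonneg_nonneg mult_nonpos_nonpos split: if_splits)
    have "- \<delta> * (real u - real v) * t \<le> 0"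
      using mult_nonneg_nonneg[OF assms s(2)] by (simp add: mult.assoc)
    then show ?thesis using s by (simp add: abs_mult)
  qed auto
  then show ?thesis .
qed

lemma step_sign_measurable [measurable]: "step_sign u v \<in> borel_measurable borel"
  unfolding step_sign_def by measurable

lemma word_chain_measurable [measurable]: "word_chain X x \<delta> w \<in> borel_measurable borel"
proof (induction w rule: induct_list012)
  case (2 v)
  then show ?case by (simp add: gauss_measurable)
next
  case (3 v u ws)
  note [measurable] = "3.IH"(2)
  show ?case
    unfolding word_chain.simps
    by (intro borel_measurable_times borel_measurable_const gauss_conv_measurable) measurable
qed simp

lemma word_chain_bounded:
  assumes "\<And>v. v \<in> set w \<Longrightarrow> x v > 0"
  shows "\<exists>M\<ge>0. \<forall>\<delta> q. 0 \<le> \<delta> \<longrightarrow> \<delta> \<le> 1 \<longrightarrow> \<bar>word_chain X x \<delta> w q\<bar> \<le> M"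
  using assms
proof (induction w rule: induct_list012)
  case (2 v)
  then show ?case
    using gauss_le[of "x v"] gauss_nonneg[of "x v"] by (auto intro!: exI[of _ "1 / sqrt (2 * pi * x v)"])
next
  case (3 v u ws)
  then obtain M where M: "M \<ge> 0" "\<And>\<delta> q. 0 \<le> \<delta> \<Longrightarrow> \<delta> \<le> 1 \<Longrightarrow> \<bar>word_chain X x \<delta> (u # ws) q\<bar> \<le> M"
    by force
  let ?D = "\<Sum>k\<leftarrow>u # ws. x k * x v * (real k - real v)"
  show ?case
  proof (intro exI[of _ "exp (\<bar>?D\<bar> / 2) * M"] conjI allI impI)
    fix \<delta> q :: real assume \<delta>: "0 \<le> \<delta>" "\<delta> \<le> 1"
    let ?T = "threshold X (\<Sum>k\<leftarrow>u # ws. x k)"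
    have "\<bar>step_sign u v (?T - r) * exp (- \<delta> * (real u - real v) * (?T - r)) * word_chain X x \<delta> (u # ws) r\<bar> \<le> 1 * M" for r
      unfolding abs_mult[of "_ * _" "word_chain X x \<delta> (u # ws) r"]
      by (intro mult_mono step_sign_exp_le M \<delta>) auto
    then have 1: "\<bar>gauss_conv (x v) (\<lambda>r. step_sign u v (?T - r) * exp (- \<delta> * (real u - real v) * (?T - r)) *
        word_chain X x \<delta> (u # ws) r) q\<bar> \<le> 1 * M"
      using "3.prems" by (intro gauss_conv_abs_le) auto
    have "\<delta> * ?D \<le> \<delta> * \<bar>?D\<bar>" using \<delta> by (intro mult_left_mono) auto
    also have "\<dots> \<le> 1 * \<bar>?D\<bar>" using \<delta> by (intro mult_right_mono) auto
    finally have "exp (\<delta> / 2 * ?D) \<le> exp (\<bar>?D\<bar> / 2)" by simp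
    then show "\<bar>word_chain X x \<delta> (v # u # ws) q\<bar> \<le> exp (\<bar>?D\<bar> / 2) * M"
      unfolding word_chain.simps abs_mult using 1 by (intro mult_mono) auto
  qed (use M in auto)
qed (auto intro: exI[of _ 0])

lemma bdd_borel_word_chain:
  assumes "\<And>v. v \<in> set w \<Longrightarrow> x v > 0"
  shows "bdd_borel (word_chain X x 0 w)"
  unfolding bdd_borel_def using word_chain_bounded[OF assms] by force

text \<open>The step functions do not depend on the shift, so the integrands converge pointwise and
  dominated convergence applies at each convolution in turn.\<close>

lemma word_chain_tendsto:
  fixes \<delta> :: "nat \<Rightarrow> real"
  assumes "\<delta> \<longlonglongrightarrow> 0" "\<And>n. 0 \<le> \<delta> n" "\<And>n. \<delta> n \<le> 1" and "\<And>v. v \<in> set w \<Longrightarrow> x v > 0"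
  shows "(\<lambda>n. word_chain X x (\<delta> n) w q) \<longlonglongrightarrow> word_chain X x 0 w q"
  using assms(4)
proof (induction w arbitrary: q rule: induct_list012)
  case (3 v u ws)
  have IH: "(\<lambda>n. word_chain X x (\<delta> n) (u # ws) r) \<longlonglongrightarrow> word_chain X x 0 (u # ws) r" for r
    by (rule "3.IH"(2)) (use "3.prems" in auto)
  have "\<exists>M\<ge>0. \<forall>\<delta> q. 0 \<le> \<delta> \<longrightarrow> \<delta> \<le> 1 \<longrightarrow> \<bar>word_chain X x \<delta> (u # ws) q\<bar> \<le> M"
    by (rule word_chain_bounded) (use "3.prems" in auto)
  then obtain M where M: "M \<ge> 0" "\<And>\<delta> q. 0 \<le> \<delta> \<Longrightarrow> \<delta> \<le> 1 \<Longrightarrow> \<bar>word_chain X x \<delta> (u # ws) q\<bar> \<le> M"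
    by blast
  have xv: "x v > 0" using "3.prems" by simp
  let ?T = "threshold X (\<Sum>k\<leftarrow>u # ws. x k)"
  let ?f = "\<lambda>d r. step_sign u v (?T - r) * exp (- d * (real u - real v) * (?T - r)) * word_chain X x d (u # ws) r"
  have "(\<lambda>n. gauss_conv (x v) (?f (\<delta> n)) q) \<longlonglongrightarrow> gauss_conv (x v) (?f 0) q"
    unfolding gauss_conv_def
  proof (rule integral_dominated_convergence[where w = "\<lambda>r. M * gauss (x v) (q - r)"])
    show "integrable lborel (\<lambda>r. M * gauss (x v) (q - r))"
      using gauss_integrable[OF xv] by simp
    show "AE r in lborel. (\<lambda>n. ?f (\<delta> n) r * gauss (x v) (q - r)) \<longlonglongrightarrow> ?f 0 r * gauss (x v) (q - r)"
      by (intro AE_I2 tendsto_intros IH assms(1))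
    show "AE r in lborel. norm (?f (\<delta> n) r * gauss (x v) (q - r)) \<le> M * gauss (x v) (q - r)" for n
    proof (rule AE_I2)
      fix r
      have "\<bar>?f (\<delta> n) r\<bar> \<le> 1 * M"
        unfolding abs_mult[of "_ * _" "word_chain X x (\<delta> n) (u # ws) r"]
        by (intro mult_mono step_sign_exp_le M assms) auto
      then show "norm (?f (\<delta> n) r * gauss (x v) (q - r)) \<le> M * gauss (x v) (q - r)"
        using gauss_nonneg[OF xv] by (simp add: abs_mult mult_right_mono)
    qed
  qed measurable
  moreover have "(\<lambda>n. exp (\<delta> n / 2 * (\<Sum>k\<leftarrow>u # ws. x k * x v * (real k - real v)))) \<longlonglongrightarrow>
      exp (0 / 2 * (\<Sum>k\<leftarrow>u # ws. x k * x v * (real k - real v)))"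
    by (intro tendsto_intros assms(1)) simp
  ultimately show ?case unfolding word_chain.simps by (rule tendsto_mult[rotated])
qed simp_all

section \<open>Ordered set partitions and the merging of descending runs\<close>

definition ordered_partitions :: "'a set \<Rightarrow> 'a set list set" where
  "ordered_partitions A = {Bs. distinct Bs \<and> partition_on A (set Bs)}"

definition word_sum :: "real \<Rightarrow> (nat \<Rightarrow> real) \<Rightarrow> nat set \<Rightarrow> real \<Rightarrow> real" where
  "word_sum X x A q = (\<Sum>w\<in>permutations_of_set A. word_chain X x 0 w q)"

definition block_sum :: "real \<Rightarrow> (nat \<Rightarrow> real) \<Rightarrow> nat set \<Rightarrow> real \<Rightarrow> real" where
  "block_sum X x A q = (\<Sum>Bs\<in>ordered_partitions A. (- 1) ^ (length Bs + 1) * block_chain X (map (sum x) Bs) q)"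

text \<open>The share of the configurations whose outermost block is \<open>B\<close>. The function
  \<open>W\<close> for the remaining letters is a parameter, so that word sums and block sums can
  satisfy one and the same recursion. The minus sign accounts for one more block.\<close>

definition last_block :: "real \<Rightarrow> (nat \<Rightarrow> real) \<Rightarrow> (nat set \<Rightarrow> real \<Rightarrow> real) \<Rightarrow> nat set \<Rightarrow> nat set \<Rightarrow> real \<Rightarrow> real" where
  "last_block X x W A B q = (if B = A then gauss (sum x B) q else
     - gauss_conv (sum x B) (\<lambda>r. (if threshold X (sum x (A - B)) \<le> r then 1 else 0) * W (A - B) r) q)"

lemma bdd_borel_word_sum:
  assumes "\<And>v. v \<in> A \<Longrightarrow> x v > 0"
  shows "bdd_borel (word_sum X x A)"
  unfolding word_sum_def using assms
  by (intro bdd_borel_sum bdd_borel_word_chain) (auto simp: permutations_of_set_def)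

lemma bdd_borel_last_block:
  assumes A: "\<And>v. v \<in> A \<Longrightarrow> x v > 0" and B: "B \<subseteq> A" "B \<noteq> {}" "finite A"
  shows "bdd_borel (last_block X x (word_sum X x) A B)"
proof -
  have "sum x B > 0" using assms by (intro sum_pos) (auto intro: finite_subset)
  then show ?thesis
    unfolding last_block_def using A
    by (cases "B = A") (auto intro!: bdd_borel_gauss bdd_borel_uminus bdd_borel_gauss_conv bdd_borel_mult
        bdd_borel_step bdd_borel_word_sum simp del: mult_if_delta)
qed

lemma sum_permutations_Cons:
  assumes "A \<noteq> {}" "finite A"
  shows "(\<Sum>w\<in>permutations_of_set A. f w) = (\<Sum>v\<in>A. \<Sum>w\<in>permutations_of_set (A - {v}). f (v # w))"
  unfolding permutations_of_set_nonempty[OF assms(1)]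
  using assms by (subst sum.UNION_disjoint) (auto simp: sum.reindex)

text \<open>A descending run is determined by its set of letters, and its last letter is the minimum
  \<open>v\<close>.\<close>

definition min_blocks :: "nat set \<Rightarrow> nat \<Rightarrow> nat set set" where
  "min_blocks A v = {B. v \<in> B \<and> B \<subseteq> A \<and> (\<forall>k\<in>B. v \<le> k)}"

lemma finite_min_blocks: "finite A \<Longrightarrow> finite (min_blocks A v)"
  by (rule finite_subset[of _ "Pow A"]) (auto simp: min_blocks_def)

text \<open>The factor \<^term>\<open>step_sign u v\<close> of a descent is 1 minus the threshold indicator and that of an ascent is minus
  the indicator, so the words ending in a descending run telescope, by the semigroup law, into a single block.\<close>

lemma word_sum_last:
  assumes "finite A" "v \<in> A" "\<And>v. v \<in> A \<Longrightarrow> x v > 0"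
  shows "(\<Sum>w\<in>permutations_of_set (A - {v}). word_chain X x 0 (v # w) q) =
    (\<Sum>B\<in>min_blocks A v. last_block X x (word_sum X x) A B q)"
  using assms
proof (induction "card A" arbitrary: A v q)
  case (Suc n)
  note fin = \<open>finite A\<close> and v = \<open>v \<in> A\<close> and pos = Suc.prems(3)
  let ?W = "word_sum X x" and ?K = "last_block X x (word_sum X x)"
  let ?A = "A - {v}"
  show ?case
  proof (cases "?A = {}")
    case True
    then have A: "A = {v}" using v by auto
    have "min_blocks {v} v = {{v}}" by (auto simp: min_blocks_def)
    then show ?thesis unfolding A by (simp add: last_block_def)
  next
    case False
    have xv: "x v > 0" using pos v by auto
    let ?T = "threshold X (sum x ?A)"
    let ?step = "\<lambda>r. if ?T \<le> r then 1 else 0 :: real"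
    let ?V = "\<lambda>u r. \<Sum>w\<in>permutations_of_set (?A - {u}). word_chain X x 0 (u # w) r"
    let ?U = "{u \<in> ?A. v < u}"
    have wc: "word_chain X x 0 (v # w) q = gauss_conv (x v) (\<lambda>r. step_sign (hd w) v (?T - r) * word_chain X x 0 w r) q"
      if w: "w \<in> permutations_of_set ?A" for w
    proof -
      obtain u ws where uw: "w = u # ws" using w False by (cases w) (auto simp: permutations_of_set_def)
      have "(\<Sum>k\<leftarrow>u # ws. x k) = sum x ?A"
        using sum_list_distinct_conv_sum_set[of w x] w
        by (simp only: uw permutations_of_set_def mem_Collect_eq)
      then show ?thesis unfolding uw word_chain.simps by simp
    qed
    have bw: "bdd_borel (\<lambda>r. step_sign (hd w) v (?T - r) * word_chain X x 0 w r)" if "w \<in> permutations_of_set ?A" for w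
    proof (rule bdd_borel_mult)
      show "bdd_borel (\<lambda>r. step_sign (hd w) v (?T - r))"
        unfolding bdd_borel_def
        by (intro conjI exI[of _ 1] allI) (measurable, simp add: step_sign_def)
      show "bdd_borel (word_chain X x 0 w)"
        by (rule bdd_borel_word_chain) (use that pos in \<open>auto simp: permutations_of_set_def\<close>)
    qed
    have bV: "bdd_borel (?V u)" if "u \<in> ?A" for u
      by (intro bdd_borel_sum bdd_borel_word_chain) (use that pos in \<open>auto simp: permutations_of_set_def\<close>)
    have bW: "bdd_borel (\<lambda>r. ?step r * ?W ?A r)"
      by (intro bdd_borel_mult bdd_borel_step bdd_borel_word_sum) (use pos in auto)
    \<comment> \<open>Both cases of \<open>step_sign\<close> contain minus the indicator of
      \<open>?T \<le> r\<close>. A descent contains an additional 1, which lifts the constraint and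
      leaves \<open>?V u\<close> alone.\<close>
    have split: "(\<Sum>w\<in>permutations_of_set ?A. step_sign (hd w) v (?T - r) * word_chain X x 0 w r) =
       (\<Sum>u\<in>?U. ?V u r) - ?step r * ?W ?A r" for r
    proof -
      have "(\<Sum>w\<in>permutations_of_set ?A. step_sign (hd w) v (?T - r) * word_chain X x 0 w r) =
         (\<Sum>u\<in>?A. step_sign u v (?T - r) * ?V u r)"
        using fin by (subst sum_permutations_Cons[OF False]) (auto simp: sum_distrib_left)
      also have "\<dots> = (\<Sum>u\<in>?A. (if v < u then ?V u r else 0) - ?step r * ?V u r)"
        by (intro sum.cong refl) (auto simp: step_sign_def)
      also have "\<dots> = (\<Sum>u\<in>?U. ?V u r) - ?step r * (\<Sum>u\<in>?A. ?V u r)"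
        unfolding sum_subtractf sum_distrib_left using fin by (subst sum.inter_filter) auto
      also have "(\<Sum>u\<in>?A. ?V u r) = ?W ?A r"
        unfolding word_sum_def using fin by (subst sum_permutations_Cons[OF False]) auto
      finally show ?thesis .
    qed
    have "(\<Sum>w\<in>permutations_of_set ?A. word_chain X x 0 (v # w) q) =
        gauss_conv (x v) (\<lambda>r. \<Sum>w\<in>permutations_of_set ?A. step_sign (hd w) v (?T - r) * word_chain X x 0 w r) q"
      using wc bw xv by (subst gauss_conv_sum) auto
    also have "\<dots> = gauss_conv (x v) (\<lambda>r. \<Sum>u\<in>?U. ?V u r) q - gauss_conv (x v) (\<lambda>r. ?step r * ?W ?A r) q"
      unfolding split by (intro gauss_conv_diff xv bW bdd_borel_sum bV) auto
    also have "gauss_conv (x v) (\<lambda>r. \<Sum>u\<in>?U. ?V u r) q = (\<Sum>u\<in>?U. gauss_conv (x v) (?V u) q)"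
      by (intro gauss_conv_sum xv bV) auto
    \<comment> \<open>By the induction hypothesis the words ending in \<open>u\<close> amount to
      blocks \<open>B\<close> with minimum \<open>u\<close>. Convolution with the kernel of the
      smaller letter \<open>v\<close> enlarges the outermost block to
      \<open>insert v B\<close>.\<close>
    also have "(\<Sum>u\<in>?U. gauss_conv (x v) (?V u) q) = (\<Sum>u\<in>?U. \<Sum>B\<in>min_blocks ?A u. ?K A (insert v B) q)"
    proof (rule sum.cong[OF refl])
      fix u assume u: "u \<in> ?U"
      have "?V u = (\<lambda>r. \<Sum>B\<in>min_blocks ?A u. ?K ?A B r)"
        using Suc.hyps(1)[of ?A u] Suc.hyps(2) fin v u pos by (auto simp: fun_eq_iff)
      then have "gauss_conv (x v) (?V u) q = (\<Sum>B\<in>min_blocks ?A u. gauss_conv (x v) (?K ?A B) q)"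
        using xv fin pos by (auto simp: min_blocks_def intro!: gauss_conv_sum bdd_borel_last_block)
      also have "\<dots> = (\<Sum>B\<in>min_blocks ?A u. ?K A (insert v B) q)"
      proof (rule sum.cong[OF refl])
        fix B assume B: "B \<in> min_blocks ?A u"
        then have B': "B \<subseteq> ?A" "B \<noteq> {}" "finite B" using fin by (auto simp: min_blocks_def intro: finite_subset)
        have sB: "sum x B > 0" using B' pos by (intro sum_pos) auto
        have ins: "sum x (insert v B) = x v + sum x B" using B' by (subst sum.insert) auto
        have eqA: "insert v B = A \<longleftrightarrow> B = ?A" using B' v by auto
        have dif: "A - insert v B = ?A - B" by auto
        show "gauss_conv (x v) (?K ?A B) q = ?K A (insert v B) q"
        proof (cases "B = ?A")
          case True
          have "?K ?A ?A = gauss (sum x ?A)" by (rule ext) (simp add: last_block_def)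
          then show ?thesis
            using gauss_conv_gauss[OF xv sB] eqA ins True by (simp add: last_block_def)
        next
          case False
          have "gauss_conv (x v) (?K ?A B) q = - gauss_conv (x v) (gauss_conv (sum x B)
             (\<lambda>r. (if threshold X (sum x (?A - B)) \<le> r then 1 else 0) * ?W (?A - B) r)) q"
          proof -
            have "?K ?A B = (\<lambda>q. - gauss_conv (sum x B)
              (\<lambda>r. (if threshold X (sum x (?A - B)) \<le> r then 1 else 0) * ?W (?A - B) r) q)"
              by (rule ext) (simp only: last_block_def False if_False)
            then show ?thesis by (simp only: gauss_conv_uminus)
          qed
          also have "\<dots> = - gauss_conv (x v + sum x B)
             (\<lambda>r. (if threshold X (sum x (?A - B)) \<le> r then 1 else 0) * ?W (?A - B) r) q"
            by (subst gauss_conv_gauss_conv)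
               (use xv sB pos in \<open>auto intro!: bdd_borel_mult bdd_borel_step bdd_borel_word_sum simp del: mult_if_delta\<close>)
          also have "\<dots> = ?K A (insert v B) q"
            using False eqA ins dif by (simp add: last_block_def)
          finally show ?thesis .
        qed
      qed
      finally show "gauss_conv (x v) (?V u) q = (\<Sum>B\<in>min_blocks ?A u. ?K A (insert v B) q)" .
    qed
    also have "\<dots> = (\<Sum>p\<in>Sigma ?U (min_blocks ?A). ?K A (insert v (snd p)) q)"
      using fin by (subst sum.Sigma) (auto simp: finite_min_blocks case_prod_unfold)
    \<comment> \<open>These are the blocks with minimum \<open>v\<close> and at least two letters;
      the second smallest letter is the \<open>u\<close> that precedes \<open>v\<close> in the
      run.\<close>
    also have "\<dots> = (\<Sum>C\<in>min_blocks A v - {{v}}. ?K A C q)"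
    proof (rule sum.reindex_bij_witness[where j = "\<lambda>p. insert v (snd p)" and i = "\<lambda>C. (Min (C - {v}), C - {v})"])
      fix p assume "p \<in> Sigma ?U (min_blocks ?A)"
      then obtain u B where p: "p = (u, B)" "u \<in> ?U" "B \<in> min_blocks ?A u" by auto
      then have B: "u \<in> B" "B \<subseteq> ?A" "\<forall>k\<in>B. u \<le> k" "finite B" "v \<notin> B"
        using fin by (auto simp: min_blocks_def intro: finite_subset)
      then have "Min B = u" by (intro Min_eqI) auto
      then show "(Min (insert v (snd p) - {v}), insert v (snd p) - {v}) = p"
        using B p by simp
      show "insert v (snd p) \<in> min_blocks A v - {{v}}"
        using B p v by (force simp: min_blocks_def)
    next
      fix C assume C: "C \<in> min_blocks A v - {{v}}"
      then have C': "v \<in> C" "C \<subseteq> A" "\<forall>k\<in>C. v \<le> k" "finite C" "C - {v} \<noteq> {}"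
        using fin by (auto simp: min_blocks_def intro: finite_subset)
      show "insert v (snd (Min (C - {v}), C - {v})) = C" using C' by auto
      define m where "m = Min (C - {v})"
      have "m \<in> C - {v}" unfolding m_def using C' by (intro Min_in) auto
      moreover have "\<forall>k\<in>C - {v}. m \<le> k" unfolding m_def using C' by auto
      ultimately have "m \<in> ?U" "C - {v} \<in> min_blocks ?A m"
        using C' by (auto simp: min_blocks_def le_neq_implies_less)
      then show "(Min (C - {v}), C - {v}) \<in> Sigma ?U (min_blocks ?A)"
        by (simp add: m_def)
    qed simp
    \<comment> \<open>The subtracted convolution is the missing block \<open>{v}\<close>, a run of
      length one.\<close>
    also have "\<dots> - gauss_conv (x v) (\<lambda>r. ?step r * ?W ?A r) q = (\<Sum>C\<in>min_blocks A v. ?K A C q)"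
    proof -
      have "{v} \<in> min_blocks A v" using v by (auto simp: min_blocks_def)
      moreover have "?K A {v} q = - gauss_conv (x v) (\<lambda>r. ?step r * ?W ?A r) q"
        using False v by (auto simp: last_block_def)
      ultimately show ?thesis
        using sum.remove[OF finite_min_blocks[OF fin], of "{v}" v "\<lambda>C. ?K A C q"] by simp
    qed
    finally show ?thesis .
  qed
qed auto

text \<open>A nonempty block has exactly one minimum, so summing over the last letter of the word
  sums over all blocks.\<close>

lemma word_sum_rec:
  assumes "finite A" "A \<noteq> {}" "\<And>v. v \<in> A \<Longrightarrow> x v > 0"
  shows "word_sum X x A q = (\<Sum>B\<in>Pow A - {{}}. last_block X x (word_sum X x) A B q)"
proof -
  have "word_sum X x A q = (\<Sum>v\<in>A. \<Sum>B\<in>min_blocks A v. last_block X x (word_sum X x) A B q)"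
    unfolding word_sum_def[of X x A q] sum_permutations_Cons[OF assms(2,1)]
    by (intro sum.cong refl word_sum_last assms) auto
  also have "\<dots> = (\<Sum>p\<in>Sigma A (min_blocks A). last_block X x (word_sum X x) A (snd p) q)"
    using assms by (subst sum.Sigma) (auto simp: finite_min_blocks case_prod_unfold)
  also have "\<dots> = (\<Sum>B\<in>Pow A - {{}}. last_block X x (word_sum X x) A B q)"
  proof (rule sum.reindex_bij_witness[where j = snd and i = "\<lambda>B. (Min B, B)"])
    fix p assume "p \<in> Sigma A (min_blocks A)"
    then obtain u B where p: "p = (u, B)" "u \<in> B" "B \<subseteq> A" "\<forall>k\<in>B. u \<le> k"
      by (auto simp: min_blocks_def)
    then have "Min B = u" using finite_subset[OF p(3) assms(1)] by (intro Min_eqI) auto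
    then show "(Min (snd p), snd p) = p" "snd p \<in> Pow A - {{}}" using p by auto
  next
    fix B assume "B \<in> Pow A - {{}}"
    then have "B \<subseteq> A" "B \<noteq> {}" "finite B" using assms(1) by (auto intro: finite_subset)
    moreover from this have "Min B \<in> B" by (intro Min_in)
    moreover have "Min B \<in> A" using calculation by blast
    ultimately show "(Min B, B) \<in> Sigma A (min_blocks A)"
      by (auto simp: min_blocks_def)
  qed auto
  finally show ?thesis .
qed

lemma ordered_partitions_empty: "ordered_partitions {} = {[]}"
  by (auto simp: ordered_partitions_def partition_on_empty partition_on_def[of "{}"] simp flip: set_empty)

lemma finite_ordered_partitions:
  assumes "finite A"
  shows "finite (ordered_partitions A)"
proof (rule finite_subset)
  show "ordered_partitions A \<subseteq> (\<Union>P\<in>{P. partition_on A P}. permutations_of_set P)"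
    by (auto simp: ordered_partitions_def permutations_of_set_def)
  show "finite (\<Union>P\<in>{P. partition_on A P}. permutations_of_set P)"
    using finitely_many_partition_on[OF assms] by auto
qed

lemma ordered_partitions_Cons:
  assumes "B \<noteq> {}" "B \<subseteq> A"
  shows "B # Bs \<in> ordered_partitions A \<longleftrightarrow> Bs \<in> ordered_partitions (A - B)"
proof
  assume "B # Bs \<in> ordered_partitions A"
  then show "Bs \<in> ordered_partitions (A - B)"
    unfolding ordered_partitions_def partition_on_def disjoint_def by auto
next
  assume "Bs \<in> ordered_partitions (A - B)"
  then show "B # Bs \<in> ordered_partitions A"
    using assms unfolding ordered_partitions_def partition_on_def disjoint_def by auto
qed

lemma sum_list_ordered_partition:
  assumes "Bs \<in> ordered_partitions A" "finite A"
  shows "(\<Sum>B\<leftarrow>Bs. sum x B) = sum x A"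
proof -
  have "(\<Sum>B\<leftarrow>Bs. sum x B) = (\<Sum>B\<in>set Bs. sum x B)"
    using assms by (intro sum_list_distinct_conv_sum_set) (auto simp: ordered_partitions_def)
  also have "\<dots> = sum x (\<Union>(set Bs))"
    using assms
    by (subst sum.Union_disjoint) (auto simp: ordered_partitions_def partition_on_def disjoint_def intro: finite_subset)
  also have "\<Union>(set Bs) = A" using assms by (auto simp: ordered_partitions_def partition_on_def)
  finally show ?thesis .
qed

text \<open>The head of the list is the outermost convolution, and removing it shortens the list by
  one, whence the minus sign in \<open>last_block\<close>.\<close>

lemma block_sum_rec:
  assumes fin: "finite A" and ne: "A \<noteq> {}" and pos: "\<And>v. v \<in> A \<Longrightarrow> x v > 0"
  shows "block_sum X x A q = (\<Sum>B\<in>Pow A - {{}}. last_block X x (block_sum X x) A B q)"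
proof -
  let ?f = "\<lambda>Bs. (- 1) ^ (length Bs + 1) * block_chain X (map (sum x) Bs) q"
  have "block_sum X x A q = (\<Sum>p\<in>Sigma (Pow A - {{}}) (\<lambda>B. ordered_partitions (A - B)). ?f (fst p # snd p))"
    unfolding block_sum_def
  proof (rule sum.reindex_bij_witness[where i = "\<lambda>p. fst p # snd p" and j = "\<lambda>Bs. (hd Bs, tl Bs)"])
    fix Bs assume Bs: "Bs \<in> ordered_partitions A"
    then have "Bs \<noteq> []" using ne by (auto simp: ordered_partitions_def partition_on_def)
    then obtain B Bs' where B: "Bs = B # Bs'" by (cases Bs) auto
    have B': "B \<noteq> {}" "B \<subseteq> A" using Bs B by (auto simp: ordered_partitions_def partition_on_def)
    show "(hd Bs, tl Bs) \<in> Sigma (Pow A - {{}}) (\<lambda>B. ordered_partitions (A - B))"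
      using Bs B B' ordered_partitions_Cons[OF B', of Bs'] by auto
    show "fst (hd Bs, tl Bs) # snd (hd Bs, tl Bs) = Bs" using B by simp
    then show "?f (fst (hd Bs, tl Bs) # snd (hd Bs, tl Bs)) = ?f Bs" by simp
  next
    fix p assume "p \<in> Sigma (Pow A - {{}}) (\<lambda>B. ordered_partitions (A - B))"
    then show "fst p # snd p \<in> ordered_partitions A" "(hd (fst p # snd p), tl (fst p # snd p)) = p"
      by (cases p; auto simp: ordered_partitions_Cons)+
  qed
  also have "\<dots> = (\<Sum>B\<in>Pow A - {{}}. \<Sum>Bs\<in>ordered_partitions (A - B). ?f (B # Bs))"
    using fin by (subst sum.Sigma) (auto simp: finite_ordered_partitions case_prod_unfold)
  also have "\<dots> = (\<Sum>B\<in>Pow A - {{}}. last_block X x (block_sum X x) A B q)"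
  proof (rule sum.cong[OF refl])
    fix B assume "B \<in> Pow A - {{}}"
    then have B: "B \<subseteq> A" "B \<noteq> {}" "finite B" using fin by (auto intro: finite_subset)
    show "(\<Sum>Bs\<in>ordered_partitions (A - B). ?f (B # Bs)) = last_block X x (block_sum X x) A B q"
    proof (cases "B = A")
      case True
      then show ?thesis by (simp add: ordered_partitions_empty last_block_def)
    next
      case False
      have sB: "sum x B > 0" using B pos by (intro sum_pos) auto
      have posB: "y > 0" if "Bs \<in> ordered_partitions (A - B)" "y \<in> set (map (sum x) Bs)" for Bs y
      proof -
        from that obtain D where D: "D \<in> set Bs" "y = sum x D" by auto
        then have "D \<subseteq> A" "D \<noteq> {}" using that(1) by (auto simp: ordered_partitions_def partition_on_def)
        then show ?thesis using D pos fin by (auto intro!: sum_pos intro: finite_subset)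
      qed
      let ?st = "\<lambda>r. if threshold X (sum x (A - B)) \<le> r then 1 else 0 :: real"
      let ?g = "\<lambda>Bs r. (- 1) ^ (length Bs + 1) * block_chain X (map (sum x) Bs) r"
      have bd: "bdd_borel (?g Bs)" if "Bs \<in> ordered_partitions (A - B)" for Bs
        by (intro bdd_borel_mult bdd_borel_block_chain posB[OF that]) (auto simp: bdd_borel_def)
      have "?f (B # Bs) = - gauss_conv (sum x B) (\<lambda>r. ?st r * ?g Bs r) q"
        if Bs: "Bs \<in> ordered_partitions (A - B)" for Bs
      proof -
        have "Bs \<noteq> []" using Bs False B by (auto simp: ordered_partitions_def partition_on_def)
        then obtain D Ds where D: "Bs = D # Ds" by (cases Bs) auto
        have s: "sum_list (sum x D # map (sum x) Ds) = sum x (A - B)"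
          using sum_list_ordered_partition[OF Bs, of x] fin D by simp
        have "gauss_conv (sum x B) (\<lambda>r. ?st r * ?g Bs r) q = (-1) ^ (length Bs + 1) *
            gauss_conv (sum x B) (\<lambda>r. ?st r * block_chain X (map (sum x) Bs) r) q"
          unfolding gauss_conv_def integral_mult_right_zero[symmetric] by (simp add: mult_ac)
        then show ?thesis unfolding D list.map block_chain.simps s by simp
      qed
      then have "(\<Sum>Bs\<in>ordered_partitions (A - B). ?f (B # Bs)) =
          - (\<Sum>Bs\<in>ordered_partitions (A - B). gauss_conv (sum x B) (\<lambda>r. ?st r * ?g Bs r) q)"
        by (simp add: sum_negf)
      also have "(\<Sum>Bs\<in>ordered_partitions (A - B). gauss_conv (sum x B) (\<lambda>r. ?st r * ?g Bs r) q) =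
          gauss_conv (sum x B) (\<lambda>r. \<Sum>Bs\<in>ordered_partitions (A - B). ?st r * ?g Bs r) q"
        by (rule gauss_conv_sum[OF sB, symmetric]) (rule bdd_borel_mult[OF bdd_borel_step bd])
      also have "(\<lambda>r. \<Sum>Bs\<in>ordered_partitions (A - B). ?st r * ?g Bs r) = (\<lambda>r. ?st r * block_sum X x (A - B) r)"
        unfolding block_sum_def sum_distrib_left ..
      finally show ?thesis using False by (simp add: last_block_def)
    qed
  qed
  finally show ?thesis .
qed

text \<open>Both sides obey the recursion through \<open>last_block\<close>, which refers only to
  the smaller sets \<open>A - B\<close>.\<close>

theorem word_sum_eq_block_sum:
  assumes "finite A" "A \<noteq> {}" "\<And>v. v \<in> A \<Longrightarrow> x v > 0"
  shows "word_sum X x A q = block_sum X x A q"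
  using assms
proof (induction "card A" arbitrary: A q rule: less_induct)
  case less
  have "last_block X x (word_sum X x) A B q = last_block X x (block_sum X x) A B q" if B: "B \<in> Pow A - {{}}" for B
  proof (cases "B = A")
    case False
    have "card (A - B) < card A" using B less.prems by (intro psubset_card_mono) auto
    then have "word_sum X x (A - B) r = block_sum X x (A - B) r" for r
      using B False less.prems by (intro less.hyps) auto
    then show ?thesis by (simp add: last_block_def)
  qed (simp add: last_block_def)
  then have "(\<Sum>B\<in>Pow A - {{}}. last_block X x (word_sum X x) A B q) =
      (\<Sum>B\<in>Pow A - {{}}. last_block X x (block_sum X x) A B q)"
    by (rule sum.cong[OF refl])
  then show ?case
    using less.prems by (simp add: word_sum_rec block_sum_rec)
qed

section \<open>Fourier integration of the word terms\<close>

lemma nn_integral_exp_half_line: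
  fixes c :: real
  assumes "c > 0"
  shows "(\<integral>\<^sup>+ t. ennreal (exp (- c * t)) * indicator {0..} t \<partial>lborel) = ennreal (1 / c)"
proof -
  have "(\<integral>\<^sup>+ t. ennreal (exp (- c * t)) * indicator {0..} t \<partial>lborel) = ennreal (0 - (- exp (- c * 0) / c))"
  proof (rule nn_integral_FTC_atLeast)
    show "((\<lambda>t. - exp (- c * t) / c) \<longlongrightarrow> 0) at_top"
    proof -
      have "((\<lambda>t. exp (- c * t)) \<longlongrightarrow> 0) at_top"
      proof (rule filterlim_compose[OF exp_at_bot])
        show "filterlim (\<lambda>t. - c * t) at_bot at_top"
          using assms by (simp add: filterlim_uminus_at_bot filterlim_tendsto_pos_mult_at_top[OF tendsto_const _ filterlim_ident])
      qed
      then have "((\<lambda>t. - exp (- c * t) / c) \<longlongrightarrow> - 0 / c) at_top"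
        using assms by (intro tendsto_intros) auto
      then show ?thesis by simp
    qed
    show "DERIV (\<lambda>t. - exp (- c * t) / c) t :> exp (- c * t)" if "0 \<le> t" for t
      using assms by (auto intro!: derivative_eq_intros)
  qed auto
  then show ?thesis by simp
qed

lemma integrable_exp_half_line:
  fixes c :: real
  assumes "c > 0"
  shows "integrable lborel (\<lambda>t. indicator {0<..} t * exp (- c * t))"
proof (rule integrableI_nonneg)
  have "(\<integral>\<^sup>+ t. ennreal (indicator {0<..} t * exp (- c * t)) \<partial>lborel) \<le>
      (\<integral>\<^sup>+ t. ennreal (exp (- c * t)) * indicator {0..} t \<partial>lborel)"
    by (intro nn_integral_mono) (auto split: split_indicator)
  also have "\<dots> < \<infinity>" unfolding nn_integral_exp_half_line[OF assms] by simp
  finally show "(\<integral>\<^sup>+ t. ennreal (indicator {0<..} t * exp (- c * t)) \<partial>lborel) < \<infinity>" .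
qed auto

lemma exp_half_line:
  fixes z :: complex
  assumes "Re z > 0"
  shows "integrable lborel (\<lambda>t. indicator {0<..} t *\<^sub>R exp (- z * of_real t))"
    and "(\<integral>t. indicator {0<..} t *\<^sub>R exp (- z * of_real t) \<partial>lborel) = 1 / z"
proof -
  show int: "integrable lborel (\<lambda>t. indicator {0<..} t *\<^sub>R exp (- z * of_real t))"
    by (rule Bochner_Integration.integrable_bound[OF integrable_exp_half_line[OF assms]])
       (auto simp: norm_exp_eq_Re split: split_indicator)
  have z: "z \<noteq> 0" using assms by auto
  have "(LBINT t=0..\<infinity>. exp (- z * of_real t)) = 0 - (- (1 / z))"
  proof (rule interval_integral_FTC_integrable[where F = "\<lambda>t. - exp (- z * of_real t) / z"])
    show "((\<lambda>t. - exp (- z * of_real t) / z) has_vector_derivative exp (- z * of_real t)) (at t)" for t :: real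
      using z by (auto intro!: derivative_eq_intros has_vector_derivative_real_field)
    show "((((\<lambda>t. - exp (- z * of_real t) / z) \<circ> real_of_ereal)) \<longlongrightarrow> - (1 / z)) (at_right 0)"
    proof -
      have "((\<lambda>t. - exp (- z * of_real t) / z) \<longlongrightarrow> - exp (- z * of_real 0) / z) (at_right (0::real))"
        by (intro tendsto_intros) (use z in auto)
      then show ?thesis by (simp add: zero_ereal_def ereal_tendsto_simps)
    qed
    show "((((\<lambda>t. - exp (- z * of_real t) / z) \<circ> real_of_ereal)) \<longlongrightarrow> 0) (at_left \<infinity>)"
    proof -
      have "((\<lambda>t. exp (- Re z * t) / norm z) \<longlongrightarrow> 0 / norm z) at_top"
      proof (intro tendsto_divide tendsto_const)
        show "((\<lambda>t. exp (- Re z * t)) \<longlongrightarrow> 0) at_top"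
        proof (rule filterlim_compose[OF exp_at_bot])
          show "filterlim (\<lambda>t. - Re z * t) at_bot at_top"
            using assms by (simp add: filterlim_uminus_at_bot filterlim_tendsto_pos_mult_at_top[OF tendsto_const _ filterlim_ident])
        qed
      qed (use z in auto)
      then have "((\<lambda>t. norm (- exp (- z * of_real t) / z)) \<longlongrightarrow> 0) at_top"
        by (simp add: norm_divide norm_exp_eq_Re)
      then have "((\<lambda>t. - exp (- z * of_real t) / z) \<longlongrightarrow> 0) at_top"
        by (rule tendsto_norm_zero_cancel)
      then show ?thesis by (simp add: ereal_tendsto_simps)
    qed
    show "set_integrable lborel (einterval 0 \<infinity>) (\<lambda>t. exp (- z * of_real t))"
      using int by (simp add: set_integrable_def einterval_def greaterThan_def)
  qed (auto intro!: continuous_intros)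
  then show "(\<integral>t. indicator {0<..} t *\<^sub>R exp (- z * of_real t) \<partial>lborel) = 1 / z"
    by (simp add: interval_lebesgue_integral_def set_lebesgue_integral_def einterval_def greaterThan_def)
qed

text \<open>The hypothesis ties the sign of \<open>Re z\<close> to the order of \<open>u\<close> and
  \<open>v\<close>, so the supporting half line is the one on which the exponential decays. The
  ascent is the descent formula reflected at 0.\<close>

lemma step_sign_integral:
  fixes z :: complex
  assumes "u \<noteq> v" "Re z * (real u - real v) > 0"
  shows "integrable lborel (\<lambda>t. step_sign u v t *\<^sub>R exp (- z * of_real t))"
    and "(\<integral>t. step_sign u v t *\<^sub>R exp (- z * of_real t) \<partial>lborel) = 1 / z"
proof -
  have "integrable lborel (\<lambda>t. step_sign u v t *\<^sub>R exp (- z * of_real t)) \<and>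
     (\<integral>t. step_sign u v t *\<^sub>R exp (- z * of_real t) \<partial>lborel) = 1 / z"
  proof (cases "u > v")
    case True
    then have "Re z > 0" using zero_less_mult_pos2[OF assms(2)] by simp
    note h = exp_half_line[OF this]
    have "step_sign u v = indicator {0<..}"
      by (rule ext) (use True in \<open>simp add: step_sign_def indicator_def\<close>)
    then show ?thesis using h by (simp only: simp_thms)
  next
    case False
    then have "real v - real u > 0" using assms(1) by simp
    moreover have "0 < Re (- z) * (real v - real u)" using assms(2) by (simp add: algebra_simps)
    ultimately have "Re (- z) > 0" by (rule zero_less_mult_pos2[rotated])
    note h = exp_half_line[OF this]
    let ?g = "\<lambda>t. - (indicator {0<..} t *\<^sub>R exp (z * of_real t))"
    have i1: "integrable lborel ?g" and i2: "integral\<^sup>L lborel ?g = 1 / z"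
      using h by simp_all
    have r1: "integrable lborel (\<lambda>t. ?g (0 + (- 1) * t))"
      using lborel_integrable_real_affine[OF i1, of "- 1" 0] by simp
    have r2: "(\<integral>t. ?g (0 + (- 1) * t) \<partial>lborel) = 1 / z"
      using lborel_integral_real_affine[of "- 1" ?g 0] i2 by simp
    \<comment> \<open>The reflected open half line omits \<open>t = 0\<close>, where
      \<open>step_sign\<close> is -1; the two sides differ there only.\<close>
    have ae: "AE t in lborel. step_sign u v t *\<^sub>R exp (- z * of_real t) = ?g (0 + (- 1) * t)"
      using AE_lborel_singleton[of 0]
      by eventually_elim (use False in \<open>auto simp: step_sign_def split: split_indicator\<close>)
    have m: "(\<lambda>t. step_sign u v t *\<^sub>R exp (- z * of_real t)) \<in> borel_measurable lborel"
      "(\<lambda>t. ?g (0 + (- 1) * t)) \<in> borel_measurable lborel"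
      by measurable
    show ?thesis
      using integrable_cong_AE[OF m ae] integral_cong_AE[OF m ae] r1 r2 by simp
  qed
  then show "integrable lborel (\<lambda>t. step_sign u v t *\<^sub>R exp (- z * of_real t))"
    "(\<integral>t. step_sign u v t *\<^sub>R exp (- z * of_real t) \<partial>lborel) = 1 / z" by auto
qed

lemma gauss_weight_integrable:
  "y > 0 \<Longrightarrow> integrable lborel (\<lambda>a::real. exp (- a\<^sup>2 / (2 * y)))"
proof -
  assume y: "y > 0"
  have "(\<lambda>a. exp (- a\<^sup>2 / (2 * y))) = (\<lambda>a. sqrt (2 * pi * y) * gauss y (a - 0))"
    using y by (auto simp: gauss_def)
  then show ?thesis using gauss_shift'(1)[OF y, of 0] by simp
qed

text \<open>The characteristic function of the standard normal distribution, rescaled by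
  \<open>sqrt y\<close>. The weight is unnormalized and \<open>gauss\<close> on the right carries a
  normalization of its own, hence the factor \<open>2 * pi * y\<close> instead of its square
  root.\<close>

lemma gauss_fourier:
  assumes y: "y > 0"
  shows "integrable lborel (\<lambda>a. of_real (exp (- a\<^sup>2 / (2 * y))) * exp (\<i> * of_real (s * a / y)))"
    and "(\<integral>a. of_real (exp (- a\<^sup>2 / (2 * y))) * exp (\<i> * of_real (s * a / y)) \<partial>lborel) =
      of_real (2 * pi * y * gauss y s)"
proof -
  show int: "integrable lborel (\<lambda>a. of_real (exp (- a\<^sup>2 / (2 * y))) * exp (\<i> * of_real (s * a / y)))"
    by (rule Bochner_Integration.integrable_bound[OF gauss_weight_integrable[OF y]]) (auto simp: norm_mult)
  define t where "t = s / sqrt y"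
  have "char std_normal_distribution t = complex_of_real (exp (- (t^2) / 2))"
    by (simp add: char_std_normal_distribution)
  then have "(\<integral>a. std_normal_density a *\<^sub>R iexp (t * a) \<partial>lborel) = complex_of_real (exp (- (t^2) / 2))"
    unfolding char_def by (subst (asm) integral_density) auto
  also have "(\<integral>a. std_normal_density a *\<^sub>R iexp (t * a) \<partial>lborel) =
     \<bar>1 / sqrt y\<bar> *\<^sub>R (\<integral>a. std_normal_density (0 + 1 / sqrt y * a) *\<^sub>R iexp (t * (0 + 1 / sqrt y * a)) \<partial>lborel)"
    by (rule lborel_integral_real_affine) (use y in simp)
  also have "(\<lambda>a. std_normal_density (0 + 1 / sqrt y * a) *\<^sub>R iexp (t * (0 + 1 / sqrt y * a))) =
     (\<lambda>a. of_real (1 / sqrt (2 * pi)) * (of_real (exp (- a\<^sup>2 / (2 * y))) * exp (\<i> * of_real (s * a / y))))"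
    using y by (auto simp: fun_eq_iff std_normal_density_def t_def scaleR_conv_of_real power_divide real_sqrt_pow2
       power_mult_distrib)
  also have "(\<integral>a. of_real (1 / sqrt (2 * pi)) * (of_real (exp (- a\<^sup>2 / (2 * y))) * exp (\<i> * of_real (s * a / y))) \<partial>lborel)
     = of_real (1 / sqrt (2 * pi)) * (\<integral>a. of_real (exp (- a\<^sup>2 / (2 * y))) * exp (\<i> * of_real (s * a / y)) \<partial>lborel)"
    by (rule integral_mult_right_zero)
  finally have eq: "of_real (1 / sqrt y * (1 / sqrt (2 * pi))) * (\<integral>a. of_real (exp (- a\<^sup>2 / (2 * y))) * exp (\<i> * of_real (s * a / y)) \<partial>lborel)
     = complex_of_real (exp (- (t^2) / 2))"
    using y by (simp add: scaleR_conv_of_real)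
  have t2: "t^2 / 2 = s^2 / (2 * y)" using y by (simp add: t_def power_divide)
  have "(\<integral>a. of_real (exp (- a\<^sup>2 / (2 * y))) * exp (\<i> * of_real (s * a / y)) \<partial>lborel) =
     of_real (sqrt y * sqrt (2 * pi)) * (of_real (1 / sqrt y * (1 / sqrt (2 * pi))) * (\<integral>a. of_real (exp (- a\<^sup>2 / (2 * y))) * exp (\<i> * of_real (s * a / y)) \<partial>lborel))"
    unfolding mult.assoc[symmetric] of_real_mult[symmetric] using y by simp
  also have "\<dots> = of_real (sqrt (2 * pi * y) * exp (- (t^2) / 2))"
    unfolding eq by (simp add: real_sqrt_mult)
  also have "sqrt (2 * pi * y) * exp (- (t^2) / 2) = 2 * pi * y * gauss y s"
  proof -
    have "sqrt (2 * pi * y) * sqrt (2 * pi * y) = 2 * pi * y" using y by simp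
    then have "2 * pi * y / sqrt (2 * pi * y) = sqrt (2 * pi * y)" using y by (simp add: field_simps)
    then show ?thesis using t2 unfolding gauss_def
      by (metis (no_types, lifting) minus_divide_left mult.commute times_divide_eq_left times_divide_eq_right)
  qed
  finally show "(\<integral>a. of_real (exp (- a\<^sup>2 / (2 * y))) * exp (\<i> * of_real (s * a / y)) \<partial>lborel) =
      of_real (2 * pi * y * gauss y s)" .
qed

text \<open>Once the pole is replaced by its Laplace integral, the integrand in \<open>a\<close> is
  Gaussian again, with frequency \<open>s + t\<close>. The variable \<open>b\<close> of the
  neighbouring letter survives only in a phase, which the next integration absorbs.\<close>

lemma gauss_pole_fourier:
  assumes y: "y > 0" and uv: "u \<noteq> v" and d: "d = \<delta> * (real u - real v)" "\<delta> > 0"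
  shows "(\<integral>a. of_real (exp (- a\<^sup>2 / (2 * y))) * exp (\<i> * of_real (s * a / y)) / (\<i> * of_real (b - a / y) + of_real d) \<partial>lborel) =
    (\<integral>t. of_real (2 * pi * y * (step_sign u v t * exp (- d * t) * gauss y (s + t))) * exp (- \<i> * of_real (t * b)) \<partial>lborel)"
proof -
  let ?f = "\<lambda>a t. (of_real (exp (- a\<^sup>2 / (2 * y))) * exp (\<i> * of_real (s * a / y))) *
     (step_sign u v t *\<^sub>R exp (- (\<i> * of_real (b - a / y) + of_real d) * of_real t)) :: complex"
  have dpos: "d * (real u - real v) > 0"
  proof -
    have "0 < (real u - real v) * (real u - real v)"
      using uv by (cases "u < v") (auto intro: mult_neg_neg mult_pos_pos)
    then show ?thesis using d by (simp add: mult.assoc)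
  qed
  have re: "Re (of_real d) * (real u - real v) > 0" using dpos by simp
  have int0: "integrable lborel (\<lambda>t. norm (step_sign u v t *\<^sub>R exp (- complex_of_real d * of_real t)))"
    by (rule integrable_norm) (rule step_sign_integral(1)[OF uv re])
  have int: "integrable (lborel \<Otimes>\<^sub>M lborel) (\<lambda>(a, t). ?f a t)"
  proof (rule lborel_pair.Fubini_integrable)
    \<comment> \<open>The oscillating factors have modulus 1, so the modulus splits into a function
      of \<open>a\<close> times a function of \<open>t\<close> and the double integral converges
      absolutely.\<close>
    have "norm (case (a, t) of (a, t) \<Rightarrow> ?f a t) = exp (- a\<^sup>2 / (2 * y)) * norm (step_sign u v t *\<^sub>R exp (- complex_of_real d * of_real t))" for a t
      by (simp add: norm_mult norm_exp_eq_Re)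
    then show "integrable lborel (\<lambda>a. \<integral>t. norm (case (a, t) of (a, t) \<Rightarrow> ?f a t) \<partial>lborel)"
      by (simp only: integral_mult_right_zero) (intro integrable_mult_left gauss_weight_integrable[OF y])
    show "AE a in lborel. integrable lborel (\<lambda>t. case (a, t) of (a, t) \<Rightarrow> ?f a t)"
    proof (rule AE_I2)
      fix a
      have "integrable lborel (\<lambda>t. step_sign u v t *\<^sub>R exp (- (\<i> * of_real (b - a / y) + of_real d) * of_real t))"
        by (rule step_sign_integral(1)[OF uv]) (use dpos in simp)
      then show "integrable lborel (\<lambda>t. case (a, t) of (a, t) \<Rightarrow> ?f a t)"
        unfolding prod.case by (rule integrable_mult_right)
    qed
    show "(\<lambda>(a, t). ?f a t) \<in> borel_measurable (lborel \<Otimes>\<^sub>M lborel)" by measurable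
  qed
  have "(\<integral>a. of_real (exp (- a\<^sup>2 / (2 * y))) * exp (\<i> * of_real (s * a / y)) / (\<i> * of_real (b - a / y) + of_real d) \<partial>lborel) =
     (\<integral>a. (\<integral>t. ?f a t \<partial>lborel) \<partial>lborel)"
  proof (rule Bochner_Integration.integral_cong[OF refl])
    fix a
    have "(\<integral>t. step_sign u v t *\<^sub>R exp (- (\<i> * of_real (b - a / y) + of_real d) * of_real t) \<partial>lborel) =
        1 / (\<i> * of_real (b - a / y) + of_real d)"
      by (rule step_sign_integral(2)[OF uv]) (use dpos in simp)
    then show "of_real (exp (- a\<^sup>2 / (2 * y))) * exp (\<i> * of_real (s * a / y)) / (\<i> * of_real (b - a / y) + of_real d) =
      (\<integral>t. ?f a t \<partial>lborel)"
      by (simp only: integral_mult_right_zero times_divide_eq_right mult_1_right)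
  qed
  also have "\<dots> = (\<integral>t. (\<integral>a. ?f a t \<partial>lborel) \<partial>lborel)"
    by (rule lborel_pair.Fubini_integral[symmetric]) (use int in simp)
  also have "\<dots> = (\<integral>t. of_real (2 * pi * y * (step_sign u v t * exp (- d * t) * gauss y (s + t))) * exp (- \<i> * of_real (t * b)) \<partial>lborel)"
  proof (rule Bochner_Integration.integral_cong[OF refl])
    fix t
    have "?f a t = of_real (step_sign u v t * exp (- d * t)) * exp (- \<i> * of_real (t * b)) *
        (of_real (exp (- a\<^sup>2 / (2 * y))) * exp (\<i> * of_real ((s + t) * a / y)))" for a
    proof -
      have "exp (\<i> * of_real (s * a / y)) * exp (- (\<i> * of_real (b - a / y) + of_real d) * of_real t) =
        of_real (exp (- d * t)) * (exp (- \<i> * of_real (t * b)) * exp (\<i> * of_real ((s + t) * a / y)))"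
        unfolding exp_of_real[symmetric] exp_add[symmetric] by (rule arg_cong[of _ _ exp]) (simp add: field_simps add_divide_distrib)
      then show ?thesis by (simp add: scaleR_conv_of_real mult_ac)
    qed
    then have "(\<integral>a. ?f a t \<partial>lborel) = of_real (step_sign u v t * exp (- d * t)) * exp (- \<i> * of_real (t * b)) *
        of_real (2 * pi * y * gauss y (s + t))"
      by (simp only: integral_mult_right_zero gauss_fourier(2)[OF y])
    then show "(\<integral>a. ?f a t \<partial>lborel) = of_real (2 * pi * y * (step_sign u v t * exp (- d * t) * gauss y (s + t))) * exp (- \<i> * of_real (t * b))"
      by (simp add: mult_ac)
  qed
  finally show ?thesis .
qed

section \<open>Integrating out the letters one by one\<close>

definition gauss_weight :: "(nat \<Rightarrow> real) \<Rightarrow> nat set \<Rightarrow> (nat \<Rightarrow> real) \<Rightarrow> real" where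
  "gauss_weight x S a = (\<Prod>k\<in>S. exp (- (a k)\<^sup>2 / (2 * x k)))"

definition shifted_word :: "(nat \<Rightarrow> real) \<Rightarrow> real \<Rightarrow> nat list \<Rightarrow> (nat \<Rightarrow> real) \<Rightarrow> complex" where
  "shifted_word x \<delta> w a = word_term (\<lambda>k. of_real (x k)) (line_pt (\<lambda>k. a k / x k) (of_real \<delta>)) w"

text \<open>The integral of a shifted word with two extra phases, chosen so that integrating out the
  last letter gives integrals of the same kind for the shorter word. When \<open>X\<close> is the
  total over the letters of \<open>w\<close> and \<open>q = 0\<close>, both phases vanish.\<close>

definition word_integral :: "real \<Rightarrow> (nat \<Rightarrow> real) \<Rightarrow> real \<Rightarrow> nat list \<Rightarrow> real \<Rightarrow> complex" where
  "word_integral X x \<delta> w q =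
     (\<integral>a. of_real (gauss_weight x (set w) a) * shifted_word x \<delta> w a *
        exp (\<i> * of_real ((X - sum x (set w)) / 2 * sum a (set w) +
          (q - threshold X (sum x (set w))) * (a (hd w) / x (hd w))))
      \<partial>(lborel_pow (set w)))"

lemma gauss_weight_nonneg: "0 \<le> gauss_weight x S a"
  by (simp add: gauss_weight_def prod_nonneg)

lemma integrable_gauss_weight:
  assumes "finite S" "\<And>k. k \<in> S \<Longrightarrow> x k > 0"
  shows "integrable (lborel_pow S) (gauss_weight x S)"
proof -
  interpret product_sigma_finite "\<lambda>_::nat. lborel :: real measure" by standard
  show ?thesis
    unfolding gauss_weight_def
    by (rule product_integrable_prod) (use assms gauss_weight_integrable in auto)
qed

lemma cross_sum_cong:
  assumes "\<And>k. k \<in> insert v (set ws) \<Longrightarrow> \<beta> k = \<beta>' k"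
  shows "cross_sum x \<beta> ws v = cross_sum x \<beta>' ws v"
  using assms by (induction ws) (auto simp: cross_def)

lemma word_term_cong:
  assumes "\<And>k. k \<in> set w \<Longrightarrow> \<beta> k = \<beta>' k"
  shows "word_term x \<beta> w = word_term x \<beta>' w"
  using assms
proof (induction w rule: induct_list012)
  case (3 v u ws)
  have "word_term x \<beta> (u # ws) = word_term x \<beta>' (u # ws)"
    by (rule "3.IH"(2)) (use "3.prems" in auto)
  moreover have "cross_sum x \<beta> (u # ws) v = cross_sum x \<beta>' (u # ws) v"
    by (rule cross_sum_cong) (use "3.prems" in auto)
  ultimately show ?case using "3.prems" by (simp del: cross_sum_simps)
qed auto

lemma measurable_coordinate:
  "k \<in> S \<Longrightarrow> (\<lambda>a. a k) \<in> borel_measurable (lborel_pow S)"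
  using measurable_component_singleton[of k S "\<lambda>_. lborel"] by simp

lemma measurable_line_pt:
  assumes "k \<in> S"
  shows "(\<lambda>a. line_pt (\<lambda>k. a k / x k) z k) \<in> borel_measurable (lborel_pow S)"
  using measurable_coordinate[OF assms] unfolding line_pt_def by measurable

lemma measurable_cross_sum:
  assumes "insert v (set ws) \<subseteq> S"
  shows "(\<lambda>a. cross_sum y (line_pt (\<lambda>k. a k / x k) z) ws v) \<in> borel_measurable (lborel_pow S)"
  using assms
proof (induction ws)
  case (Cons k ws)
  have [measurable]: "(\<lambda>a. line_pt (\<lambda>k. a k / x k) z k) \<in> borel_measurable (lborel_pow S)"
    "(\<lambda>a. line_pt (\<lambda>k. a k / x k) z v) \<in> borel_measurable (lborel_pow S)"
    using Cons.prems by (auto intro!: measurable_line_pt)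
  have [measurable]: "(\<lambda>a. cross_sum y (line_pt (\<lambda>k. a k / x k) z) ws v) \<in> borel_measurable (lborel_pow S)"
    by (rule Cons.IH) (use Cons.prems in auto)
  show ?case unfolding cross_sum_simps cross_def by measurable
qed simp

lemma measurable_word_term:
  assumes "set w \<subseteq> S"
  shows "(\<lambda>a. word_term y (line_pt (\<lambda>k. a k / x k) z) w) \<in> borel_measurable (lborel_pow S)"
  using assms
proof (induction w rule: induct_list012)
  case (3 v u ws)
  have [measurable]: "(\<lambda>a. word_term y (line_pt (\<lambda>k. a k / x k) z) (u # ws)) \<in> borel_measurable (lborel_pow S)"
    by (rule "3.IH"(2)) (use "3.prems" in auto)
  have [measurable]: "(\<lambda>a. line_pt (\<lambda>k. a k / x k) z u) \<in> borel_measurable (lborel_pow S)"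
    "(\<lambda>a. line_pt (\<lambda>k. a k / x k) z v) \<in> borel_measurable (lborel_pow S)"
    using "3.prems" by (auto intro!: measurable_line_pt)
  have [measurable]: "(\<lambda>a. cross_sum y (line_pt (\<lambda>k. a k / x k) z) (u # ws) v) \<in> borel_measurable (lborel_pow S)"
    by (rule measurable_cross_sum) (use "3.prems" in auto)
  show ?case unfolding word_term.simps by measurable
qed simp_all

text \<open>A positive real shift keeps all denominators at modulus at least
  \<open>\<delta>\<close>, so the word is bounded and the Gaussian weight dominates.\<close>

lemma integrable_shifted_word:
  assumes w: "distinct w" "set w = S" and x: "\<And>k. k \<in> S \<Longrightarrow> x k > 0" and \<delta>: "0 < \<delta>" "\<delta> \<le> 1"
    and \<theta>: "\<theta> \<in> borel_measurable (lborel_pow S)"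
  shows "integrable (lborel_pow S) (\<lambda>a. of_real (gauss_weight x S a) * shifted_word x \<delta> w a * exp (\<i> * of_real (\<theta> a)))"
proof -
  have fin: "finite S" using w by auto
  obtain C where C: "C \<ge> 0" "\<And>b z. norm z \<le> 1 \<Longrightarrow>
     (\<forall>p\<in>set w. \<forall>q\<in>set w. p \<noteq> q \<longrightarrow> \<delta> \<le> norm (line_pt b z p - line_pt b z q)) \<Longrightarrow>
     norm (word_term (\<lambda>k. of_real (x k)) (line_pt b z) w) \<le> C"
    using word_term_bound[of 1 \<delta> w x] \<delta> w by auto
  have bound: "norm (shifted_word x \<delta> w a) \<le> C" for a
    unfolding shifted_word_def
  proof (rule C(2), use \<delta> in simp, intro ballI impI)
    fix p q :: nat assume pq: "p \<noteq> q"
    let ?b = "\<lambda>k. a k / x k"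
    have "Re (line_pt ?b (of_real \<delta>) p - line_pt ?b (of_real \<delta>) q) = \<delta> * (real p - real q)"
      by (simp add: line_pt_def algebra_simps)
    then have "\<bar>\<delta> * (real p - real q)\<bar> \<le> norm (line_pt ?b (of_real \<delta>) p - line_pt ?b (of_real \<delta>) q)"
      by (metis abs_Re_le_cmod)
    moreover have "1 \<le> \<bar>real p - real q\<bar>" using pq by linarith
    moreover from this \<delta> have "\<delta> * 1 \<le> \<delta> * \<bar>real p - real q\<bar>" by (intro mult_left_mono) auto
    ultimately show "\<delta> \<le> norm (line_pt ?b (of_real \<delta>) p - line_pt ?b (of_real \<delta>) q)"
      unfolding abs_mult abs_of_pos[OF \<delta>(1)] mult_1_right by linarith
  qed
  have int: "integrable (lborel_pow S) (\<lambda>a. C * gauss_weight x S a)"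
    using integrable_gauss_weight[OF fin x] by simp
  show ?thesis
  proof (rule Bochner_Integration.integrable_bound[OF int])
    have [measurable]: "shifted_word x \<delta> w \<in> borel_measurable (lborel_pow S)"
      unfolding shifted_word_def by (rule measurable_word_term) (use w in auto)
    have [measurable]: "gauss_weight x S \<in> borel_measurable (lborel_pow S)"
      using integrable_gauss_weight[OF fin x] by auto
    note [measurable] = \<theta>
    show "(\<lambda>a. of_real (gauss_weight x S a) * shifted_word x \<delta> w a * exp (\<i> * of_real (\<theta> a)))
        \<in> borel_measurable (lborel_pow S)" by measurable
    show "AE a in lborel_pow S. norm (of_real (gauss_weight x S a) * shifted_word x \<delta> w a * exp (\<i> * of_real (\<theta> a)))
        \<le> norm (C * gauss_weight x S a)"
      using bound gauss_weight_nonneg C(1)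
      by (intro AE_I2) (auto simp: norm_mult abs_mult mult.commute[of C] intro!: mult_left_mono)
  qed
qed

text \<open>The imaginary part is a linear phase in the Gaussian variables. The real part stems from
  the shift and is constant in \<open>a\<close>, so it leaves the integral as a factor.\<close>

lemma cross_sum_line_pt:
  assumes "distinct ws" "v \<notin> set ws" "\<And>k. k \<in> insert v (set ws) \<Longrightarrow> x k \<noteq> 0"
  shows "cross_sum (\<lambda>k. of_real (x k)) (line_pt (\<lambda>k. a k / x k) (of_real \<delta>)) ws v =
     \<i> * of_real (x v * sum a (set ws) - sum x (set ws) * a v) +
     of_real (\<delta> * (\<Sum>k\<leftarrow>ws. x k * x v * (real k - real v)))"
  using assms
proof (induction ws)
  case (Cons k ws)
  have "cross (\<lambda>k. of_real (x k)) (line_pt (\<lambda>k. a k / x k) (of_real \<delta>)) k v =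
     \<i> * of_real (x v * a k - x k * a v) + of_real (\<delta> * (x k * x v * (real k - real v)))"
    using Cons.prems by (simp add: cross_def line_pt_def field_simps)
  moreover have "cross_sum (\<lambda>k. of_real (x k)) (line_pt (\<lambda>k. a k / x k) (of_real \<delta>)) ws v =
     \<i> * of_real (x v * sum a (set ws) - sum x (set ws) * a v) +
     of_real (\<delta> * (\<Sum>k\<leftarrow>ws. x k * x v * (real k - real v)))"
    by (rule Cons.IH) (use Cons.prems in auto)
  ultimately show ?case
    using Cons.prems(1) unfolding cross_sum_simps(2) by (simp only:) (simp add: algebra_simps)
qed simp

lemma threshold_add: "threshold X (c + y) - threshold X c = y * (X - c - y - c) / 2"
  by (simp add: threshold_def field_simps)

text \<open>The variable of the last letter \<open>v\<close> enters through its Gaussian weight, a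
  single pole and a linear phase, so \<open>gauss_pole_fourier\<close> applies. The phase that it
  leaves behind belongs to \<open>u\<close> and changes the argument of the shorter word to
  \<open>T - t\<close>.\<close>

lemma word_integral_Cons:
  fixes X :: real
  assumes w: "distinct (v # u # ws)" and x: "\<And>k. k \<in> set (v # u # ws) \<Longrightarrow> x k > 0"
    and \<delta>: "0 < \<delta>" "\<delta> \<le> 1"
  defines "T \<equiv> threshold X (sum x (set (u # ws)))"
  shows "word_integral X x \<delta> (v # u # ws) q =
    of_real (exp (\<delta> / 2 * (\<Sum>k\<leftarrow>u # ws. x k * x v * (real k - real v)))) *
    (\<integral>t. of_real (2 * pi * x v * (step_sign u v t * exp (- (\<delta> * (real u - real v)) * t) * gauss (x v) (q - T + t))) *
       word_integral X x \<delta> (u # ws) (T - t) \<partial>lborel)"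
proof -
  interpret P: product_sigma_finite "\<lambda>_::nat. lborel :: real measure" by standard
  define I where "I = set (u # ws)"
  have fin: "finite I" and vI: "v \<notin> I" and uI: "u \<in> I" and uv: "u \<noteq> v"
    using w by (auto simp: I_def)
  have xv: "x v > 0" and xI: "\<And>k. k \<in> I \<Longrightarrow> x k > 0" using x by (auto simp: I_def)
  let ?M = "lborel_pow I"
  define c where "c = sum x I"
  define D where "D = (\<Sum>k\<leftarrow>u # ws. x k * x v * (real k - real v))"
  define d where "d = \<delta> * (real u - real v)"
  define s where "s = q - T"
  have T: "T = threshold X c" by (simp add: T_def c_def I_def)
  define G where "G = (\<lambda>a. of_real (gauss_weight x I a) * shifted_word x \<delta> (u # ws) a * exp (\<i> * of_real ((X - c) / 2 * sum a I)))"
  let ?K = "\<lambda>t. 2 * pi * x v * (step_sign u v t * exp (- d * t) * gauss (x v) (s + t))"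
  have st: "set (v # u # ws) = insert v I" by (simp add: I_def)
  define f where "f = (\<lambda>a. of_real (gauss_weight x (insert v I) a) * shifted_word x \<delta> (v # u # ws) a *
        exp (\<i> * of_real ((X - sum x (insert v I)) / 2 * sum a (insert v I) +
          (q - threshold X (sum x (insert v I))) * (a v / x v))))"
  have wi: "word_integral X x \<delta> (v # u # ws) q = (\<integral>a. f a \<partial>lborel_pow (insert v I))"
    unfolding word_integral_def st f_def by simp
  have intf: "integrable (lborel_pow (insert v I)) f"
    unfolding f_def
  proof (rule integrable_shifted_word[OF w st _ \<delta>])
    show "(\<lambda>a. (X - sum x (insert v I)) / 2 * sum a (insert v I) +
          (q - threshold X (sum x (insert v I))) * (a v / x v)) \<in> borel_measurable (lborel_pow (insert v I))"
      by (intro borel_measurable_add borel_measurable_times borel_measurable_const borel_measurable_sum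
          borel_measurable_divide measurable_coordinate) auto
  qed (use x I_def in auto)
  have intG: "integrable ?M G"
    unfolding G_def
  proof (rule integrable_shifted_word[OF _ _ xI \<delta>])
    show "(\<lambda>a. (X - c) / 2 * sum a I) \<in> borel_measurable ?M"
      by (intro borel_measurable_times borel_measurable_const borel_measurable_sum measurable_coordinate)
  qed (use w I_def in auto)
  have upd: "f (a(v := y)) = of_real (exp (\<delta> / 2 * D)) * (G a * (of_real (exp (- y\<^sup>2 / (2 * x v))) * exp (\<i> * of_real (s * y / x v)) /
      (\<i> * of_real (a u / x u - y / x v) + of_real d)))" for a y
  proof -
    let ?a = "a(v := y)"
    let ?\<beta> = "line_pt (\<lambda>k. ?a k / x k) (of_real \<delta>)"
    have sI: "sum ?a I = sum a I" using vI by (intro sum.cong) auto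
    have gw: "gauss_weight x (insert v I) ?a = exp (- y\<^sup>2 / (2 * x v)) * gauss_weight x I a"
    proof -
      have "(\<Prod>k\<in>I. exp (- (?a k)\<^sup>2 / (2 * x k))) = (\<Prod>k\<in>I. exp (- (a k)\<^sup>2 / (2 * x k)))"
        using vI by (intro prod.cong) auto
      then show ?thesis unfolding gauss_weight_def prod.insert[OF fin vI] by simp
    qed
    have wt: "word_term (\<lambda>k. of_real (x k)) ?\<beta> (u # ws) = shifted_word x \<delta> (u # ws) a"
      unfolding shifted_word_def
      by (rule word_term_cong) (use vI in \<open>auto simp: line_pt_def I_def\<close>)
    have cs: "cross_sum (\<lambda>k. of_real (x k)) ?\<beta> (u # ws) v = \<i> * of_real (x v * sum a I - c * y) + of_real (\<delta> * D)"
    proof -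
      have nz: "x k \<noteq> 0" if "k \<in> insert v (set (u # ws))" for k
        using x[of k] that by auto
      have "cross_sum (\<lambda>k. of_real (x k)) ?\<beta> (u # ws) v =
          \<i> * of_real (x v * sum ?a (set (u # ws)) - sum x (set (u # ws)) * ?a v) + of_real (\<delta> * D)"
        unfolding D_def by (rule cross_sum_line_pt) (use w nz in auto)
      then show ?thesis
        by (simp only: I_def[symmetric] c_def[symmetric] sI fun_upd_same)
    qed
    have den: "?\<beta> u - ?\<beta> v = \<i> * of_real (a u / x u - y / x v) + of_real d"
      using uv by (simp add: line_pt_def d_def algebra_simps)
    have sw: "shifted_word x \<delta> (v # u # ws) ?a = shifted_word x \<delta> (u # ws) a *
        exp ((\<i> * of_real (x v * sum a I - c * y) + of_real (\<delta> * D)) / 2) / (\<i> * of_real (a u / x u - y / x v) + of_real d)"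
      unfolding shifted_word_def[of x \<delta> "v # u # ws"] word_term.simps wt cs den ..
    have sx: "sum x (insert v I) = c + x v" "sum ?a (insert v I) = sum a I + y"
      using fin vI sI by (simp_all add: c_def)
    have ex: "exp ((\<i> * of_real (x v * sum a I - c * y) + of_real (\<delta> * D)) / 2) *
        exp (\<i> * of_real ((X - (c + x v)) / 2 * (sum a I + y) + (q - threshold X (c + x v)) * (?a v / x v))) =
        of_real (exp (\<delta> / 2 * D)) * (exp (\<i> * of_real ((X - c) / 2 * sum a I)) * exp (\<i> * of_real (s * y / x v)))"
    proof -
      have th: "threshold X (c + x v) = T + x v * (X - c - x v - c) / 2"
        using threshold_add[of X c "x v"] T by simp
      \<comment> \<open>This identity is the origin of \<open>threshold\<close>: the coefficients of
        \<open>y\<close> combine to the single frequency \<open>s\<close> precisely because of its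
        increment from \<open>c\<close> to \<open>c + x v\<close>, and the coefficient of
        \<open>sum a I\<close> returns to \<open>(X - c) / 2\<close>.\<close>
      have re: "(x v * sum a I - c * y) / 2 + ((X - (c + x v)) / 2 * (sum a I + y) + (q - threshold X (c + x v)) * (y / x v))
          = (X - c) / 2 * sum a I + s * y / x v"
        unfolding th s_def using xv by (simp add: field_simps)
      have "(\<i> * of_real (x v * sum a I - c * y) + of_real (\<delta> * D)) / 2 +
          \<i> * of_real ((X - (c + x v)) / 2 * (sum a I + y) + (q - threshold X (c + x v)) * (y / x v)) =
          of_real (\<delta> / 2 * D) + \<i> * of_real ((x v * sum a I - c * y) / 2 + ((X - (c + x v)) / 2 * (sum a I + y) + (q - threshold X (c + x v)) * (y / x v)))"
      proof -
        have "(\<i> * of_real A + of_real B) / 2 + \<i> * of_real E = of_real (B / 2) + \<i> * of_real (A / 2 + E)" for A B E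
          by (simp add: complex_eq_iff)
        then show ?thesis by (simp only: times_divide_eq_left)
      qed
      also have "\<dots> = of_real (\<delta> / 2 * D) + (\<i> * of_real ((X - c) / 2 * sum a I) + \<i> * of_real (s * y / x v))"
        unfolding re by (simp add: algebra_simps)
      finally show ?thesis
        unfolding exp_of_real[symmetric] exp_add[symmetric] by simp
    qed
    have "f ?a = of_real (exp (- y\<^sup>2 / (2 * x v))) * of_real (gauss_weight x I a) * shifted_word x \<delta> (u # ws) a *
       (exp ((\<i> * of_real (x v * sum a I - c * y) + of_real (\<delta> * D)) / 2) *
        exp (\<i> * of_real ((X - (c + x v)) / 2 * (sum a I + y) + (q - threshold X (c + x v)) * (?a v / x v)))) /
        (\<i> * of_real (a u / x u - y / x v) + of_real d)"
      unfolding f_def sx gw sw by simp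
    then show ?thesis unfolding ex G_def by simp
  qed
  have "word_integral X x \<delta> (v # u # ws) q = (\<integral>a. (\<integral>y. f (a(v := y)) \<partial>lborel) \<partial>?M)"
    unfolding wi by (rule P.product_integral_insert[OF fin vI intf])
  also have "\<dots> = of_real (exp (\<delta> / 2 * D)) * (\<integral>a. G a * (\<integral>t. of_real (?K t) * exp (- \<i> * of_real (t * (a u / x u))) \<partial>lborel) \<partial>?M)"
    unfolding upd integral_mult_right_zero gauss_pole_fourier[OF xv uv d_def \<delta>(1)] ..
  also have "(\<integral>a. G a * (\<integral>t. of_real (?K t) * exp (- \<i> * of_real (t * (a u / x u))) \<partial>lborel) \<partial>?M) =
      (\<integral>a. (\<integral>t. of_real (?K t) * (G a * exp (- \<i> * of_real (t * (a u / x u)))) \<partial>lborel) \<partial>?M)"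
    unfolding integral_mult_right_zero[symmetric] by (simp only: mult_ac)
  also have "\<dots> = (\<integral>t. (\<integral>a. of_real (?K t) * (G a * exp (- \<i> * of_real (t * (a u / x u)))) \<partial>?M) \<partial>lborel)"
  proof -
    interpret Q: sigma_finite_measure ?M by (rule P.sigma_finite[OF fin])
    interpret pair_sigma_finite ?M lborel by standard
    \<comment> \<open>The step function tames the exponential of either sign, so the kernel is
      dominated by a shifted Gaussian in \<open>t\<close>.\<close>
    have Kint: "integrable lborel (\<lambda>t. norm (?K t))"
    proof (rule Bochner_Integration.integrable_bound)
      show "integrable lborel (\<lambda>t. 2 * pi * x v * gauss (x v) (t - (- s)))"
        using gauss_shift'(1)[OF xv, of "- s"] by simp
      have "\<bar>step_sign u v t * exp (- d * t)\<bar> \<le> 1" for t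
        using step_sign_exp_le[of \<delta> u v t] \<delta> by (simp add: d_def)
      then have "norm (norm (?K t)) \<le> norm (2 * pi * x v * gauss (x v) (t - (- s)))" for t
      proof -
        have "\<bar>step_sign u v t * exp (- d * t)\<bar> * gauss (x v) (s + t) \<le> 1 * gauss (x v) (s + t)"
          by (intro mult_right_mono \<open>\<And>t. \<bar>step_sign u v t * exp (- d * t)\<bar> \<le> 1\<close> gauss_nonneg[OF xv])
        then show ?thesis
          using xv gauss_nonneg[OF xv] by (simp add: abs_mult add.commute mult.assoc)
      qed
      then show "AE t in lborel. norm (norm (?K t)) \<le> norm (2 * pi * x v * gauss (x v) (t - (- s)))"
        by simp
    qed simp
    have [measurable]: "G \<in> borel_measurable ?M" using intG by auto
    have [measurable]: "(\<lambda>a. a u) \<in> borel_measurable ?M" by (rule measurable_coordinate[OF uI])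
    have meas: "(\<lambda>(a, t). of_real (?K t) * (G a * exp (- \<i> * of_real (t * (a u / x u))))) \<in> borel_measurable (?M \<Otimes>\<^sub>M lborel)"
      by measurable
    have "integrable (?M \<Otimes>\<^sub>M lborel) (\<lambda>(a, t). of_real (?K t) * (G a * exp (- \<i> * of_real (t * (a u / x u)))))"
    proof (rule Fubini_integrable[OF meas])
      have n: "norm (case (a, t) of (a, t) \<Rightarrow> of_real (?K t) * (G a * exp (- \<i> * of_real (t * (a u / x u))))) = norm (?K t) * norm (G a)" for a t
        by (simp add: norm_mult abs_mult)
      show "integrable ?M (\<lambda>a. \<integral>t. norm (case (a, t) of (a, t) \<Rightarrow> of_real (?K t) * (G a * exp (- \<i> * of_real (t * (a u / x u))))) \<partial>lborel)"
        unfolding n integral_mult_left_zero by (intro integrable_mult_right integrable_norm intG)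
      show "AE a in ?M. integrable lborel (\<lambda>t. case (a, t) of (a, t) \<Rightarrow> of_real (?K t) * (G a * exp (- \<i> * of_real (t * (a u / x u)))))"
      proof (rule AE_I2)
        fix a
        show "integrable lborel (\<lambda>t. case (a, t) of (a, t) \<Rightarrow> of_real (?K t) * (G a * exp (- \<i> * of_real (t * (a u / x u)))))"
        proof (rule Bochner_Integration.integrable_bound)
          show "integrable lborel (\<lambda>t. norm (?K t) * norm (G a))" by (intro integrable_mult_left Kint)
        qed (auto simp: norm_mult abs_mult)
      qed
    qed
    then show ?thesis by (intro Fubini_integral[symmetric]) simp
  qed
  also have "\<dots> = (\<integral>t. of_real (?K t) * word_integral X x \<delta> (u # ws) (T - t) \<partial>lborel)"
  proof (rule Bochner_Integration.integral_cong[OF refl])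
    fix t
    have "G a * exp (- \<i> * of_real (t * (a u / x u))) = of_real (gauss_weight x (set (u # ws)) a) * shifted_word x \<delta> (u # ws) a *
        exp (\<i> * of_real ((X - sum x (set (u # ws))) / 2 * sum a (set (u # ws)) +
          (T - t - threshold X (sum x (set (u # ws)))) * (a (hd (u # ws)) / x (hd (u # ws)))))" for a
    proof -
      have "exp (\<i> * of_real ((X - c) / 2 * sum a I)) * exp (- \<i> * of_real (t * (a u / x u))) =
        exp (\<i> * of_real ((X - c) / 2 * sum a I + (T - t - threshold X c) * (a u / x u)))"
        unfolding exp_add[symmetric] by (rule arg_cong[of _ _ exp]) (simp add: T algebra_simps)
      then show ?thesis unfolding G_def c_def[symmetric] I_def[symmetric] by (simp add: mult.assoc)
    qed
    then show "(\<integral>a. of_real (?K t) * (G a * exp (- \<i> * of_real (t * (a u / x u)))) \<partial>?M) =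
        of_real (?K t) * word_integral X x \<delta> (u # ws) (T - t)"
      unfolding integral_mult_right_zero word_integral_def I_def by simp
  qed
  finally show ?thesis unfolding D_def d_def s_def .
qed

lemma word_integral_eq_chain:
  assumes "distinct w" "w \<noteq> []" "\<And>k. k \<in> set w \<Longrightarrow> x k > 0" "0 < \<delta>" "\<delta> \<le> 1"
  shows "word_integral X x \<delta> w q = of_real ((\<Prod>k\<in>set w. 2 * pi * x k) * word_chain X x \<delta> w q)"
  using assms
proof (induction w arbitrary: q rule: induct_list012)
  case (2 v)
  interpret P: product_sigma_finite "\<lambda>_::nat. lborel :: real measure" by standard
  have xv: "x v > 0" using 2 by simp
  have e: "(X - x v) / 2 * y + (q - threshold X (x v)) * (y / x v) = q * y / x v" for y
    using xv by (simp add: threshold_def field_simps)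
  have "word_integral X x \<delta> [v] q = (\<integral>a. (\<lambda>y. of_real (exp (- y\<^sup>2 / (2 * x v))) * exp (\<i> * of_real (q * y / x v))) (a v)
      \<partial>lborel_pow {v})"
    unfolding word_integral_def using e by (simp add: gauss_weight_def shifted_word_def)
  also have "\<dots> = (\<integral>y. of_real (exp (- y\<^sup>2 / (2 * x v))) * exp (\<i> * of_real (q * y / x v)) \<partial>lborel)"
    using gauss_fourier(1)[OF xv]
    by (intro P.product_integral_singleton) measurable
  also have "\<dots> = of_real (2 * pi * x v * gauss (x v) q)"
    by (rule gauss_fourier(2)[OF xv])
  finally show ?case by simp
next
  case (3 v u ws)
  have xv: "x v > 0" using "3.prems" by simp
  let ?P = "\<Prod>k\<in>set (u # ws). 2 * pi * x k"
  let ?E = "exp (\<delta> / 2 * (\<Sum>k\<leftarrow>u # ws. x k * x v * (real k - real v)))"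
  define T where "T = threshold X (sum x (set (u # ws)))"
  have T': "threshold X (\<Sum>k\<leftarrow>u # ws. x k) = T"
    using sum_list_distinct_conv_sum_set[of "u # ws" x] "3.prems"(1) unfolding T_def
    by (simp del: sum_list.Cons list.map set_simps)
  have IH: "word_integral X x \<delta> (u # ws) r = of_real (?P * word_chain X x \<delta> (u # ws) r)" for r
    by (rule "3.IH"(2)) (use "3.prems" in auto)
  let ?h = "\<lambda>t. step_sign u v t * exp (- (\<delta> * (real u - real v)) * t) * gauss (x v) (q - T + t) * word_chain X x \<delta> (u # ws) (T - t)"
  have "word_integral X x \<delta> (v # u # ws) q = of_real ?E *
    (\<integral>t. of_real (2 * pi * x v * (step_sign u v t * exp (- (\<delta> * (real u - real v)) * t) * gauss (x v) (q - T + t))) *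
       word_integral X x \<delta> (u # ws) (T - t) \<partial>lborel)"
    unfolding T_def by (rule word_integral_Cons) (use "3.prems" in auto)
  also have "(\<integral>t. of_real (2 * pi * x v * (step_sign u v t * exp (- (\<delta> * (real u - real v)) * t) * gauss (x v) (q - T + t))) *
       word_integral X x \<delta> (u # ws) (T - t) \<partial>lborel) =
     (\<integral>t. complex_of_real (2 * pi * x v * ?P * ?h t) \<partial>lborel)"
    unfolding IH by (intro Bochner_Integration.integral_cong refl) (simp only: of_real_mult[symmetric] mult_ac)
  also have "\<dots> = of_real (\<integral>t. 2 * pi * x v * ?P * ?h t \<partial>lborel)"
    by (rule integral_complex_of_real)
  also have "(\<integral>t. 2 * pi * x v * ?P * ?h t \<partial>lborel) = 2 * pi * x v * ?P * (\<integral>t. ?h t \<partial>lborel)"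
    by (rule integral_mult_right_zero)
  \<comment> \<open>With \<open>r = T - t\<close> the Laplace variable becomes the intermediate
    position of a walk, and its sign condition becomes a comparison of \<open>r\<close> with the
    threshold.\<close>
  also have "(\<integral>t. ?h t \<partial>lborel) = (\<integral>r. ?h (T + (- 1) * r) \<partial>lborel)"
    using lborel_integral_real_affine[of "- 1" ?h T] by simp
  also have "\<dots> = gauss_conv (x v) (\<lambda>r. step_sign u v (T - r) * exp (- \<delta> * (real u - real v) * (T - r)) *
      word_chain X x \<delta> (u # ws) r) q"
    unfolding gauss_conv_def by (intro Bochner_Integration.integral_cong refl) (simp add: mult_ac)
  finally have "word_integral X x \<delta> (v # u # ws) q = of_real (2 * pi * x v * ?P * word_chain X x \<delta> (v # u # ws) q)"
    unfolding word_chain.simps T' of_real_mult by (simp only: mult_ac)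
  moreover have "(\<Prod>k\<in>set (v # u # ws). 2 * pi * x k) = 2 * pi * x v * ?P"
    using "3.prems"(1) by simp
  ultimately show ?case by (simp only:)
qed simp

section \<open>Generic points and the limit of vanishing shift\<close>

lemma AE_PiM_coordinate_neq:
  fixes F :: "('i \<Rightarrow> real) \<Rightarrow> real"
  assumes fin: "finite I" and p: "p \<in> I" and F: "F \<in> borel_measurable (lborel_pow I)"
    and indep: "\<And>a y. F (a(p := y)) = F a"
  shows "AE a in lborel_pow I. a p \<noteq> F a"
proof -
  interpret P: product_sigma_finite "\<lambda>_::'i. lborel :: real measure" by standard
  let ?M = "lborel_pow I"
  note [measurable] = F
  have [measurable]: "(\<lambda>a. a p) \<in> borel_measurable ?M"
    using measurable_component_singleton[OF p, of "\<lambda>_. lborel"] by simp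
  let ?N = "{a \<in> space ?M. a p = F a}"
  have N: "?N \<in> sets ?M" by measurable
  have I: "insert p (I - {p}) = I" using p by auto
  have "emeasure ?M ?N = (\<integral>\<^sup>+ a. indicator ?N a \<partial>?M)" using N by simp
  also have "\<dots> = (\<integral>\<^sup>+ a. (\<integral>\<^sup>+ y. indicator ?N (a(p := y)) \<partial>lborel) \<partial>lborel_pow (I - {p}))"
    using P.product_nn_integral_insert[of "I - {p}" p "indicator ?N"] fin N p by (simp add: insert_absorb)
  \<comment> \<open>On each line in direction \<open>p\<close> the value of \<open>F\<close> is
    constant, so the set meets that line in at most one point.\<close>
  also have "\<dots> \<le> (\<integral>\<^sup>+ a. (\<integral>\<^sup>+ y. indicator {F a} y \<partial>lborel) \<partial>lborel_pow (I - {p}))"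
    by (intro nn_integral_mono) (auto simp: indep split: split_indicator)
  also have "\<dots> = 0" by simp
  finally have "emeasure ?M ?N = 0" by simp
  then show ?thesis using N by (subst AE_iff_measurable[OF N]) auto
qed

lemma coincidence_commute: "coincidence b p q = coincidence b q p"
proof -
  have "(b p - b q) / (real p - real q) = (b q - b p) / (real q - real p)"
    by (metis minus_diff_eq minus_divide_divide)
  then show ?thesis by (simp add: coincidence_def)
qed

lemma generic_inj_on: "generic S b \<Longrightarrow> inj_on (line_pt b 0) S"
  by (auto simp: generic_def inj_on_def line_pt_def)

text \<open>If two different pairs collide at the same shift, one letter of the first pair is
  missing from the second, and the equation can be solved for its coordinate. Together with the ties
  in \<open>b\<close> this makes the exceptional set a finite union of graphs, each a null
  set.\<close>

lemma AE_generic: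
  assumes fin: "finite I" and x: "\<And>k. k \<in> I \<Longrightarrow> x k > 0"
  shows "AE a in lborel_pow I. generic I (\<lambda>k. a k / x k)"
proof -
  let ?M = "lborel_pow I"
  have 1: "AE a in ?M. \<forall>p\<in>I. \<forall>q\<in>I. p \<noteq> q \<longrightarrow> a p \<noteq> x p * (a q / x q)"
  proof (intro AE_finite_allI fin)
    fix p q assume pq: "p \<in> I" "q \<in> I"
    show "AE a in ?M. p \<noteq> q \<longrightarrow> a p \<noteq> x p * (a q / x q)"
    proof (cases "p = q")
      case False
      then have "AE a in ?M. a p \<noteq> x p * (a q / x q)"
        using pq by (intro AE_PiM_coordinate_neq fin borel_measurable_times borel_measurable_const
          borel_measurable_divide measurable_coordinate) auto
      then show ?thesis by simp
    qed simp
  qed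
  have 2: "AE a in ?M. \<forall>p\<in>I. \<forall>q\<in>I. \<forall>r\<in>I. \<forall>s\<in>I. p \<noteq> q \<longrightarrow> p \<noteq> r \<longrightarrow> p \<noteq> s \<longrightarrow>
     a p \<noteq> x p * (a q / x q + (real p - real q) * ((a r / x r - a s / x s) / (real r - real s)))"
  proof (intro AE_finite_allI fin)
    fix p q r s assume pq: "p \<in> I" "q \<in> I" "r \<in> I" "s \<in> I"
    show "AE a in ?M. p \<noteq> q \<longrightarrow> p \<noteq> r \<longrightarrow> p \<noteq> s \<longrightarrow>
      a p \<noteq> x p * (a q / x q + (real p - real q) * ((a r / x r - a s / x s) / (real r - real s)))"
    proof (cases "p \<noteq> q \<and> p \<noteq> r \<and> p \<noteq> s")
      case True
      then have "AE a in ?M. a p \<noteq> x p * (a q / x q + (real p - real q) * ((a r / x r - a s / x s) / (real r - real s)))"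
        using pq by (intro AE_PiM_coordinate_neq fin borel_measurable_times borel_measurable_const borel_measurable_add
          borel_measurable_diff borel_measurable_divide measurable_coordinate) auto
      then show ?thesis by simp
    qed auto
  qed
  show ?thesis
    using 1 2
  proof eventually_elim
    fix a
    assume 1: "\<forall>p\<in>I. \<forall>q\<in>I. p \<noteq> q \<longrightarrow> a p \<noteq> x p * (a q / x q)"
      and 2: "\<forall>p\<in>I. \<forall>q\<in>I. \<forall>r\<in>I. \<forall>s\<in>I. p \<noteq> q \<longrightarrow> p \<noteq> r \<longrightarrow> p \<noteq> s \<longrightarrow>
        a p \<noteq> x p * (a q / x q + (real p - real q) * ((a r / x r - a s / x s) / (real r - real s)))"
    let ?b = "\<lambda>k. a k / x k"
    have inj: "inj_on ?b I"
    proof (rule inj_onI)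
      fix p q assume pq: "p \<in> I" "q \<in> I" "?b p = ?b q"
      then have "a p = x p * (a q / x q)" using x[of p] by (simp add: field_simps)
      then show "p = q" using 1 pq by blast
    qed
    have ne: "coincidence ?b p q \<noteq> coincidence ?b r s"
      if "p \<in> I" "q \<in> I" "r \<in> I" "s \<in> I" "p \<noteq> q" "p \<noteq> r" "p \<noteq> s" for p q r s
    proof
      assume "coincidence ?b p q = coincidence ?b r s"
      then have "(?b p - ?b q) / (real p - real q) = (?b r - ?b s) / (real r - real s)"
        unfolding coincidence_def by (simp only: mult_cancel_left of_real_eq_iff) simp
      then have "?b p = ?b q + (real p - real q) * ((?b r - ?b s) / (real r - real s))"
        using that(5) by (simp add: field_simps)
      then have "a p = x p * (a q / x q + (real p - real q) * ((a r / x r - a s / x s) / (real r - real s)))"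
        using x[OF that(1)] by (simp add: field_simps)
      then show False using 2 that by blast
    qed
    have "coincidence ?b p q \<noteq> coincidence ?b r s"
      if "p \<in> I" "q \<in> I" "r \<in> I" "s \<in> I" "p \<noteq> q" "{p, q} \<noteq> {r, s}" for p q r s
    proof (cases "p \<in> {r, s}")
      case False
      then show ?thesis using ne[of p q r s] that by auto
    next
      case True
      then have "q \<notin> {r, s}" using that by auto
      then show ?thesis using ne[of q p r s] that by (auto simp: coincidence_commute[of _ p q])
    qed
    then show "generic I ?b" unfolding generic_def using inj by blast
  qed
qed

lemma measurable_nested_term:
  assumes "set vis \<subseteq> S" "u \<in> S" "set vs \<subseteq> S"
  shows "(\<lambda>a. nested_term y (line_pt (\<lambda>k. a k / x k) z) vis u vs) \<in> borel_measurable (lborel_pow S)"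
  using assms
proof (induction vs arbitrary: vis u)
  case (Cons v vs)
  have [measurable]: "(\<lambda>a. nested_term y (line_pt (\<lambda>k. a k / x k) z) (vis @ [v]) v vs) \<in> borel_measurable (lborel_pow S)"
    by (rule Cons.IH) (use Cons.prems in auto)
  have [measurable]: "(\<lambda>a. line_pt (\<lambda>k. a k / x k) z u) \<in> borel_measurable (lborel_pow S)"
    "(\<lambda>a. line_pt (\<lambda>k. a k / x k) z v) \<in> borel_measurable (lborel_pow S)"
    using Cons.prems by (auto intro!: measurable_line_pt)
  have [measurable]: "(\<lambda>a. cross_sum y (line_pt (\<lambda>k. a k / x k) z) vis v) \<in> borel_measurable (lborel_pow S)"
    by (rule measurable_cross_sum) (use Cons.prems in auto)
  show ?case unfolding nested_term.simps zeta_def by measurable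
qed simp

lemma isCont_word_term:
  assumes "distinct w" "inj_on (line_pt b k) (set w)"
  shows "isCont (\<lambda>z. word_term x (line_pt b z) w) k"
  using assms
proof (induction w rule: induct_list012)
  case (3 v u ws)
  have "isCont (\<lambda>z. word_term x (line_pt b z) (u # ws)) k"
    by (rule "3.IH"(2)) (use "3.prems" in \<open>auto intro: inj_on_subset\<close>)
  moreover have "line_pt b k u - line_pt b k v \<noteq> 0"
    using "3.prems" by (auto simp: inj_on_def)
  ultimately show ?case by (auto intro!: continuous_intros simp del: cross_sum_simps)
qed simp_all

lemma word_integral_full:
  "word_integral (sum x (set w)) x \<delta> w 0 =
    (\<integral>a. of_real (gauss_weight x (set w) a) * shifted_word x \<delta> w a \<partial>lborel_pow (set w))"
  by (simp add: word_integral_def threshold_def)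

text \<open>The integral is split into words only at a positive shift, since at shift 0 single words
  have poles in the domain of integration. The bound on the whole sum, valid almost everywhere, lets
  the shift tend to 0 under the integral; on the other side the chains converge one by one.\<close>

lemma gauss_integral_word_sum:
  assumes fin: "finite S" and ne: "S \<noteq> {}" and x: "\<And>k. k \<in> S \<Longrightarrow> x k > 0"
  shows "(\<integral>a. of_real (gauss_weight x S a) * (\<Sum>w\<in>permutations_of_set S. shifted_word x 0 w a) \<partial>lborel_pow S) =
    of_real ((\<Prod>k\<in>S. 2 * pi * x k) * word_sum (sum x S) x S 0)"
proof -
  let ?P = "permutations_of_set S" and ?M = "lborel_pow S"
  let ?\<Phi> = "\<lambda>\<delta> a. of_real (gauss_weight x S a) * (\<Sum>w\<in>?P. shifted_word x \<delta> w a)"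
  define d where "d = (\<lambda>m. 1 / real (Suc m))"
  have d: "d \<longlonglongrightarrow> 0" "\<And>m. 0 < d m" "\<And>m. d m \<le> 1"
    using LIMSEQ_inverse_real_of_nat by (auto simp: d_def divide_simps inverse_eq_divide)
  have wset: "set w = S" "distinct w" if "w \<in> ?P" for w
    using that by (auto simp: permutations_of_set_def)
  obtain C where C: "\<And>b z. generic S b \<Longrightarrow> norm z \<le> 1 \<Longrightarrow> inj_on (line_pt b z) S \<Longrightarrow>
     norm (\<Sum>w\<in>?P. word_term (\<lambda>k. of_real (x k)) (line_pt b z) w) \<le> C"
    using word_sum_bounded[OF fin, of x] by blast
  have injd: "inj_on (line_pt b (of_real t)) S" if "t > 0" for b t
  proof (rule inj_onI)
    fix p q assume "line_pt b (of_real t) p = line_pt b (of_real t) q"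
    then have "Re (line_pt b (of_real t) p) = Re (line_pt b (of_real t) q)" by simp
    then show "p = q" using that by (simp add: line_pt_def)
  qed
  have [measurable]: "gauss_weight x S \<in> borel_measurable ?M"
    using integrable_gauss_weight[OF fin x] by auto
  have [measurable]: "shifted_word x t w \<in> borel_measurable ?M" if "w \<in> ?P" for t w
    unfolding shifted_word_def using that wset by (intro measurable_word_term) auto
  have gen_ae: "AE a in ?M. generic S (\<lambda>k. a k / x k)" by (rule AE_generic[OF fin x])
  have lim: "(\<lambda>m. \<integral>a. ?\<Phi> (d m) a \<partial>?M) \<longlonglongrightarrow> (\<integral>a. ?\<Phi> 0 a \<partial>?M)"
  proof (rule integral_dominated_convergence[where w = "\<lambda>a. \<bar>C\<bar> * gauss_weight x S a"])
    show "integrable ?M (\<lambda>a. \<bar>C\<bar> * gauss_weight x S a)"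
      using integrable_gauss_weight[OF fin x] by simp
    show "AE a in ?M. (\<lambda>m. ?\<Phi> (d m) a) \<longlonglongrightarrow> ?\<Phi> 0 a"
      using gen_ae
    proof eventually_elim
      fix a assume gen: "generic S (\<lambda>k. a k / x k)"
      show "(\<lambda>m. ?\<Phi> (d m) a) \<longlonglongrightarrow> ?\<Phi> 0 a"
      proof (intro tendsto_mult tendsto_const tendsto_sum)
        fix w assume w: "w \<in> ?P"
        have "isCont (\<lambda>z. word_term (\<lambda>k. of_real (x k)) (line_pt (\<lambda>k. a k / x k) z) w) 0"
          using wset[OF w] generic_inj_on[OF gen] by (intro isCont_word_term) auto
        moreover have "(\<lambda>m. complex_of_real (d m)) \<longlonglongrightarrow> 0"
          using tendsto_of_real[OF d(1), where 'a = complex] by simp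
        ultimately have "(\<lambda>m. word_term (\<lambda>k. of_real (x k)) (line_pt (\<lambda>k. a k / x k) (of_real (d m))) w) \<longlonglongrightarrow>
            word_term (\<lambda>k. of_real (x k)) (line_pt (\<lambda>k. a k / x k) 0) w"
          by (rule isCont_tendsto_compose)
        then show "(\<lambda>m. shifted_word x (d m) w a) \<longlonglongrightarrow> shifted_word x 0 w a"
          by (simp add: shifted_word_def)
      qed
    qed
    show "AE a in ?M. norm (?\<Phi> (d m) a) \<le> \<bar>C\<bar> * gauss_weight x S a" for m
      using gen_ae
    proof eventually_elim
      fix a assume gen: "generic S (\<lambda>k. a k / x k)"
      have "norm (\<Sum>w\<in>?P. shifted_word x (d m) w a) \<le> C"
        unfolding shifted_word_def
        by (rule C[OF gen]) (use d(2,3)[of m] injd in \<open>auto intro: less_imp_le\<close>)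
      then have "norm (\<Sum>w\<in>?P. shifted_word x (d m) w a) \<le> \<bar>C\<bar>" by linarith
      then show "norm (?\<Phi> (d m) a) \<le> \<bar>C\<bar> * gauss_weight x S a"
        using gauss_weight_nonneg[of x S a] unfolding norm_mult by (simp add: mult.commute[of "\<bar>C\<bar>"] mult_left_mono)
    qed
  qed measurable
  have "(\<integral>a. ?\<Phi> (d m) a \<partial>?M) = of_real ((\<Prod>k\<in>S. 2 * pi * x k) * (\<Sum>w\<in>?P. word_chain (sum x S) x (d m) w 0))" for m
  proof -
    have int: "integrable ?M (\<lambda>a. of_real (gauss_weight x S a) * shifted_word x (d m) w a)" if w: "w \<in> ?P" for w
      using integrable_shifted_word[of w S x "d m" "\<lambda>_. 0"] wset[OF w] x d by simp
    have "(\<integral>a. ?\<Phi> (d m) a \<partial>?M) = (\<Sum>w\<in>?P. \<integral>a. of_real (gauss_weight x S a) * shifted_word x (d m) w a \<partial>?M)"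
      unfolding sum_distrib_left by (rule Bochner_Integration.integral_sum[OF int])
    also have "\<dots> = (\<Sum>w\<in>?P. of_real ((\<Prod>k\<in>S. 2 * pi * x k) * word_chain (sum x S) x (d m) w 0))"
    proof (rule sum.cong[OF refl])
      fix w assume w: "w \<in> ?P"
      then have "w \<noteq> []" using ne wset(1)[OF w] by auto
      then show "(\<integral>a. of_real (gauss_weight x S a) * shifted_word x (d m) w a \<partial>?M) =
        of_real ((\<Prod>k\<in>S. 2 * pi * x k) * word_chain (sum x S) x (d m) w 0)"
        using word_integral_full[of x w "d m"] word_integral_eq_chain[of w x "d m" "sum x S" 0] wset[OF w] x d by simp
    qed
    finally show ?thesis by (simp add: sum_distrib_left)
  qed
  moreover have "(\<lambda>m. of_real ((\<Prod>k\<in>S. 2 * pi * x k) * (\<Sum>w\<in>?P. word_chain (sum x S) x (d m) w 0))) \<longlonglongrightarrow>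
     complex_of_real ((\<Prod>k\<in>S. 2 * pi * x k) * word_sum (sum x S) x S 0)"
    unfolding word_sum_def
    by (intro tendsto_of_real tendsto_mult tendsto_const tendsto_sum word_chain_tendsto d less_imp_le[OF d(2)])
       (use wset x in auto)
  ultimately show ?thesis using LIMSEQ_unique[OF lim] by simp
qed

theorem F_Bur_eq_word_sum:
  assumes n: "n \<ge> 1" and x: "\<And>j. j < n \<Longrightarrow> x j > 0"
  defines "X \<equiv> sum x {..<n}"
  shows "F_Bur n x = of_real (exp (X ^ 3 / 24) / X * ((2 * pi) powr (real n / 2) / (\<Prod>j<n. sqrt (x j))) * word_sum X x {..<n} 0)"
proof -
  let ?S = "{..<n}" and ?M = "lborel_pow {..<n}"
  let ?xc = "\<lambda>j. complex_of_real (x j)"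
  have xS: "\<And>k. k \<in> ?S \<Longrightarrow> x k > 0" using x by auto
  have S: "finite ?S" "?S \<noteq> {}" "0 \<in> ?S" using n by (auto simp: lessThan_empty_iff)
  let ?b = "\<lambda>a k. a k / x k"
  have gen_ae: "AE a in ?M. generic ?S (?b a)" by (rule AE_generic[OF S(1) xS])
  have lp: "(\<lambda>j. \<i> * complex_of_real (a j) / ?xc j) = line_pt (?b a) 0" for a
    by (auto simp: line_pt_def)
  have Pn: "Pn n (\<lambda>j. \<i> * complex_of_real (a j)) ?xc =
     (\<Sum>vs\<in>permutations_of_set (?S - {0}). nested_term ?xc (line_pt (?b a) 0) [0] 0 vs) / (\<Prod>j<n. ?xc j)" for a
    using Pn_eq_sum_nested[OF n, of ?xc "\<lambda>j. \<i> * complex_of_real (a j)"] x unfolding lp by force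
  \<comment> \<open>The two integrands may differ where a denominator vanishes, through the
    convention for division by 0; this is confined to a null set.\<close>
  have "(\<integral>a. complex_of_real (\<Prod>j<n. exp (- (a j)\<^sup>2 / (2 * x j))) * Pn n (\<lambda>j. \<i> * complex_of_real (a j)) ?xc \<partial>?M)
     = (\<integral>a. of_real (gauss_weight x ?S a) * (\<Sum>w\<in>permutations_of_set ?S. shifted_word x 0 w a) / (\<Prod>j<n. ?xc j) \<partial>?M)"
  proof (rule integral_cong_AE)
    have [measurable]: "gauss_weight x ?S \<in> borel_measurable ?M"
      using integrable_gauss_weight[OF S(1) xS] by auto
    have [measurable]: "(\<lambda>a. nested_term ?xc (line_pt (?b a) 0) [0] 0 vs) \<in> borel_measurable ?M"
      if "vs \<in> permutations_of_set (?S - {0})" for vs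
      by (rule measurable_nested_term) (use that n in \<open>auto simp: permutations_of_set_def\<close>)
    have [measurable]: "shifted_word x 0 w \<in> borel_measurable ?M" if "w \<in> permutations_of_set ?S" for w
      unfolding shifted_word_def using that by (intro measurable_word_term) (auto simp: permutations_of_set_def)
    show "(\<lambda>a. complex_of_real (\<Prod>j<n. exp (- (a j)\<^sup>2 / (2 * x j))) * Pn n (\<lambda>j. \<i> * complex_of_real (a j)) ?xc) \<in> borel_measurable ?M"
      unfolding Pn gauss_weight_def[symmetric] by measurable
    show "(\<lambda>a. of_real (gauss_weight x ?S a) * (\<Sum>w\<in>permutations_of_set ?S. shifted_word x 0 w a) / (\<Prod>j<n. ?xc j)) \<in> borel_measurable ?M"
      by measurable
    show "AE a in ?M. complex_of_real (\<Prod>j<n. exp (- (a j)\<^sup>2 / (2 * x j))) * Pn n (\<lambda>j. \<i> * complex_of_real (a j)) ?xc =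
       of_real (gauss_weight x ?S a) * (\<Sum>w\<in>permutations_of_set ?S. shifted_word x 0 w a) / (\<Prod>j<n. ?xc j)"
      using gen_ae
    proof eventually_elim
      fix a assume "generic ?S (?b a)"
      then have "inj_on (line_pt (?b a) 0) ?S" by (rule generic_inj_on)
      from sum_nested_eq_sum_words[OF S(1,3) this, of ?xc]
      show "complex_of_real (\<Prod>j<n. exp (- (a j)\<^sup>2 / (2 * x j))) * Pn n (\<lambda>j. \<i> * complex_of_real (a j)) ?xc =
        of_real (gauss_weight x ?S a) * (\<Sum>w\<in>permutations_of_set ?S. shifted_word x 0 w a) / (\<Prod>j<n. ?xc j)"
        unfolding Pn gauss_weight_def[symmetric] shifted_word_def by simp
    qed
  qed
  also have "\<dots> = of_real ((\<Prod>k\<in>?S. 2 * pi * x k) * word_sum X x ?S 0) / (\<Prod>j<n. ?xc j)"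
    unfolding integral_divide_zero X_def by (subst gauss_integral_word_sum[OF S(1,2) xS]) auto
  also have "\<dots> = of_real ((\<Prod>k<n. 2 * pi * x k) * word_sum X x ?S 0 / (\<Prod>j<n. x j))" by simp
  finally have I: "(\<integral>a. complex_of_real (\<Prod>j<n. exp (- (a j)\<^sup>2 / (2 * x j))) * Pn n (\<lambda>j. \<i> * complex_of_real (a j)) ?xc \<partial>?M)
     = of_real ((\<Prod>k<n. 2 * pi * x k) * word_sum X x ?S 0 / (\<Prod>j<n. x j))" .
  \<comment> \<open>Per letter, 2 pi x from the Gaussian integration, 1/sqrt(2 pi x) from the
    normalization and 1/x from \<open>Pn_eq_sum_nested\<close> leave sqrt(2 pi)/sqrt(x).\<close>
  have pr: "(\<Prod>k<n. 2 * pi * x k) / ((\<Prod>j<n. sqrt (2 * pi * x j)) * (\<Prod>j<n. x j)) = (2 * pi) powr (real n / 2) / (\<Prod>j<n. sqrt (x j))"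
  proof -
    have e: "2 * pi * x k / (sqrt (2 * pi * x k) * x k) = sqrt (2 * pi) / sqrt (x k)" if "k < n" for k
    proof -
      define A B where "A = sqrt (2 * pi)" and "B = sqrt (x k)"
      have "A * A = 2 * pi" "B * B = x k"
        unfolding A_def B_def using x[OF that] by (intro real_sqrt_mult_self[THEN trans] abs_of_nonneg; simp)+
      moreover have "sqrt (2 * pi * x k) = A * B" "A \<noteq> 0" "B \<noteq> 0"
        using x[OF that] by (simp_all add: A_def B_def real_sqrt_mult)
      ultimately have "2 * pi * x k / (sqrt (2 * pi * x k) * x k) = (A * A) * (B * B) / ((A * B) * (B * B))"
        by (simp only:)
      also have "\<dots> = A / B" using \<open>A \<noteq> 0\<close> \<open>B \<noteq> 0\<close> by simp
      finally show ?thesis unfolding A_def B_def .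
    qed
    have "(\<Prod>k<n. 2 * pi * x k) / ((\<Prod>j<n. sqrt (2 * pi * x j)) * (\<Prod>j<n. x j)) = (\<Prod>k<n. sqrt (2 * pi) / sqrt (x k))"
      unfolding prod.distrib[symmetric] prod_dividef[symmetric] by (intro prod.cong refl e) auto
    also have "\<dots> = sqrt (2 * pi) ^ n / (\<Prod>j<n. sqrt (x j))" by (simp add: prod_dividef)
    also have "sqrt (2 * pi) ^ n = (2 * pi) powr (real n / 2)"
      by (simp add: powr_half_sqrt[symmetric] powr_powr powr_realpow[symmetric])
    finally show ?thesis .
  qed
  have "F_Bur n x = of_real (exp (X ^ 3 / 24) / (X * (\<Prod>j<n. sqrt (2 * pi * x j)))) *
     of_real ((\<Prod>k<n. 2 * pi * x k) * word_sum X x ?S 0 / (\<Prod>j<n. x j))"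
    unfolding F_Bur_def I X_def ..
  also have "\<dots> = of_real (exp (X ^ 3 / 24) / X * ((\<Prod>k<n. 2 * pi * x k) / ((\<Prod>j<n. sqrt (2 * pi * x j)) * (\<Prod>j<n. x j))) * word_sum X x ?S 0)"
    unfolding of_real_mult[symmetric] by (simp add: mult.assoc)
  finally show ?thesis unfolding pr .
qed

section \<open>Loop integrals\<close>

definition cube_root_2 :: real where "cube_root_2 = 2 powr (1/3)"

lemma cube_root_2: "cube_root_2 > 0" "cube_root_2 ^ 3 = 2"
  by (simp_all add: cube_root_2_def powr_realpow[symmetric] powr_powr)

definition ring_weight :: "nat \<Rightarrow> (nat \<Rightarrow> real) \<Rightarrow> (nat \<Rightarrow> real) \<Rightarrow> real" where
  "ring_weight l y s = exp (- (\<Sum>j<l. (s j - s ((j+1) mod l))\<^sup>2 / (4 * y j) + (s j + s ((j+1) mod l)) * y j / 2))"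

definition link :: "real \<Rightarrow> real \<Rightarrow> real \<Rightarrow> real" where
  "link y p q = exp (- ((p - q)\<^sup>2 / (4 * y) + (p + q) * y / 2))"

lemma link_measurable [measurable]:
  assumes [measurable]: "f \<in> borel_measurable M" "g \<in> borel_measurable M"
  shows "(\<lambda>a. link y (f a) (g a)) \<in> borel_measurable M"
  unfolding link_def by measurable

lemma link_nonneg [simp]: "0 \<le> link y p q"
  by (simp add: link_def)

text \<open>Weighted paths that start at \<open>c\<close> and keep their intermediate points on or
  above \<open>c\<close>, the future minimum of the loop. Values in \<open>ennreal\<close> allow the
  order of integration to be changed without integrability conditions.\<close>

fun link_chain :: "(nat \<Rightarrow> real) \<Rightarrow> real \<Rightarrow> nat \<Rightarrow> real \<Rightarrow> ennreal" where
  "link_chain y c 0 q = ennreal (link (y 0) c q)"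
| "link_chain y c (Suc m) q = (\<integral>\<^sup>+r. link_chain y c m r * indicator {c..} r * ennreal (link (y (Suc m)) r q) \<partial>lborel)"

lemma link_chain_measurable [measurable]: "link_chain y c m \<in> borel_measurable borel"
proof (induction m)
  case (Suc m)
  note [measurable] = Suc
  show ?case unfolding link_chain.simps by measurable
qed simp

lemma measurable_links:
  fixes y :: "nat \<Rightarrow> real"
  shows "(\<lambda>s. (\<Prod>j<m. ennreal (link (y j) (if j = 0 then c else s (j - 1)) (s j)) * indicator {c..} (s j)) *
      ennreal (link (y m) (if m = 0 then c else s (m - 1)) q)) \<in> borel_measurable (lborel_pow {..<m})"
proof (intro borel_measurable_times_ennreal borel_measurable_prod_ennreal measurable_compose[OF _ measurable_ennreal] link_measurable)
  have coord: "(\<lambda>s. s k) \<in> borel_measurable (lborel_pow {..<m})" if "k < m" for k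
    using measurable_component_singleton[of k "{..<m}" "\<lambda>_. lborel"] that by simp
  {
    fix j assume j: "j \<in> {..<m}"
    show "(\<lambda>s. if j = 0 then c else s (j - 1)) \<in> borel_measurable (lborel_pow {..<m})"
      using j by (cases "j = 0") (auto intro!: coord)
    show "(\<lambda>s. s j) \<in> borel_measurable (lborel_pow {..<m})" using j by (intro coord) auto
    then show "(\<lambda>s. indicator {c..} (s j) :: ennreal) \<in> borel_measurable (lborel_pow {..<m})"
      by measurable
  next
    show "(\<lambda>s. if m = 0 then c else s (m - 1)) \<in> borel_measurable (lborel_pow {..<m})"
      by (cases "m = 0") (auto intro!: coord)
  }
qed auto

lemma nn_integral_links:
  "(\<integral>\<^sup>+s. (\<Prod>j<m. ennreal (link (y j) (if j = 0 then c else s (j - 1)) (s j)) * indicator {c..} (s j)) *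
      ennreal (link (y m) (if m = 0 then c else s (m - 1)) q) \<partial>lborel_pow {..<m}) = link_chain y c m q"
proof (induction m arbitrary: q)
  case 0
  interpret P: product_sigma_finite "\<lambda>_::nat. lborel :: real measure" by standard
  show ?case by (simp add: PiM_empty)
next
  case (Suc m)
  interpret P: product_sigma_finite "\<lambda>_::nat. lborel :: real measure" by standard
  let ?g = "\<lambda>j s. ennreal (link (y j) (if j = 0 then c else s (j - 1)) (s j)) * indicator {c..} (s j)"
  let ?f = "\<lambda>s. (\<Prod>j<Suc m. ?g j s) * ennreal (link (y (Suc m)) (s m) q)"
  have I: "{..<Suc m} = insert m {..<m}" by auto
  have meas: "?f \<in> borel_measurable (lborel_pow (insert m {..<m}))"
    unfolding I[symmetric] using measurable_links[of y c "Suc m" q] by simp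
  have upd: "?f (s(m := r)) = (\<Prod>j<m. ?g j s) * ennreal (link (y m) (if m = 0 then c else s (m - 1)) r) *
      (indicator {c..} r * ennreal (link (y (Suc m)) r q))" for s r
  proof -
    have "(\<Prod>j<m. ?g j (s(m := r))) = (\<Prod>j<m. ?g j s)" by (intro prod.cong) auto
    moreover have "(if m = 0 then c else (s(m := r)) (m - 1)) = (if m = 0 then c else s (m - 1))" by auto
    ultimately show ?thesis unfolding prod.lessThan_Suc fun_upd_same by (simp only: mult_ac)
  qed
  have "(\<integral>\<^sup>+s. ?f s \<partial>lborel_pow {..<Suc m}) = (\<integral>\<^sup>+r. (\<integral>\<^sup>+s. ?f (s(m := r)) \<partial>lborel_pow {..<m}) \<partial>lborel)"
    by (rule P.product_nn_integral_insert_rev[OF _ _ meas, unfolded I[symmetric]]) auto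
  also have "\<dots> = (\<integral>\<^sup>+r. link_chain y c m r * (indicator {c..} r * ennreal (link (y (Suc m)) r q)) \<partial>lborel)"
    unfolding upd nn_integral_multc[OF measurable_links] Suc.IH ..
  finally show ?case by (simp add: mult.assoc)
qed

definition tilt :: "real \<Rightarrow> real \<Rightarrow> real \<Rightarrow> real \<Rightarrow> real \<Rightarrow> real" where
  "tilt X c Z S q = exp (- c * Z / cube_root_2 + q * (X - 2 * Z) / 2 + Z * X\<^sup>2 / 8 - (X ^ 3 - (X - 2 * Z) ^ 3) / 24 - S / 24)"

text \<open>Completing the square: the linear potential shifts the path by the parabola \<^term>\<open>threshold X\<close>. The exponent of
  \<^const>\<open>tilt\<close> telescopes because the cubes of \<open>X - 2 Z\<close> do.\<close>

lemma link_tilt: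
  assumes y: "y > 0"
  shows "link (y / cube_root_2) (c + cube_root_2 * (p - threshold X Z)) (c + cube_root_2 * (q - threshold X (Z + y))) * tilt X c Z S p
    = tilt X c (Z + y) (S + y ^ 3) q * (sqrt (2 * pi * y) * gauss y (q - p))"
proof -
  define k where "k = cube_root_2"
  have k: "k > 0" "k ^ 3 = 2" using cube_root_2 by (auto simp: k_def)
  \<comment> \<open>\<open>w\<close> is the midpoint of \<open>X - 2 * Z\<close> and
    \<open>X - 2 * (Z + y)\<close>. So the increment of \<open>threshold\<close> is
    \<open>y * w / 2\<close>, and the two cubes differ by
    \<open>6 * y * w^2 + 2 * y^3\<close>.\<close>
  define w where "w = X - 2 * Z - y"
  have th: "threshold X (Z + y) - threshold X Z = y * w / 2"
    by (simp add: threshold_def w_def field_simps)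
  define D where "D = (q - p) - y * w / 2"
  have diff: "(c + k * (p - threshold X Z)) - (c + k * (q - threshold X (Z + y))) = - (k * D)"
  proof -
    have "threshold X (Z + y) = threshold X Z + y * w / 2" using th by linarith
    then show ?thesis by (simp add: D_def algebra_simps)
  qed
  \<comment> \<open>Here \<open>k ^ 3 = 2\<close> enters: the exponent of a link, with 4y, becomes
    the exponent of \<open>gauss\<close>, with 2y.\<close>
  have sq: "(- (k * D))\<^sup>2 / (4 * (y / k)) = D\<^sup>2 / (2 * y)"
  proof -
    have "(- (k * D))\<^sup>2 / (4 * (y / k)) = k ^ 3 * D\<^sup>2 / (4 * y)"
      using k(1) y by (simp add: field_simps power2_eq_square power3_eq_cube)
    then show ?thesis unfolding k(2) using y by (simp add: field_simps)
  qed
  have lin: "((c + k * (p - threshold X Z)) + (c + k * (q - threshold X (Z + y)))) * (y / k) / 2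
      = c * y / k + (p + q - threshold X Z - threshold X (Z + y)) * y / 2"
    using k(1) by (simp add: field_simps)
  have Dsq: "D\<^sup>2 / (2 * y) = (q - p)\<^sup>2 / (2 * y) - (q - p) * w / 2 + y * w\<^sup>2 / 8"
    using y unfolding D_def by (simp add: field_simps power2_eq_square)
  have alg: "- (c * y / k) + (q - p) * w / 2 - y * w\<^sup>2 / 8 - (p + q - threshold X Z - threshold X (Z + y)) * y / 2
      + (- c * Z / k + p * (X - 2 * Z) / 2 + Z * X\<^sup>2 / 8 - (X ^ 3 - (X - 2 * Z) ^ 3) / 24 - S / 24)
      = - c * (Z + y) / k + q * (X - 2 * (Z + y)) / 2 + (Z + y) * X\<^sup>2 / 8 - (X ^ 3 - (X - 2 * (Z + y)) ^ 3) / 24 - (S + y ^ 3) / 24"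
  proof -
    have "- (c * y / k) + - c * Z / k = - c * (Z + y) / k" by (simp add: ring_distribs add_divide_distrib diff_divide_distrib)
    moreover have "(q - p) * w / 2 - y * w\<^sup>2 / 8 - (p + q - threshold X Z - threshold X (Z + y)) * y / 2
      + (p * (X - 2 * Z) / 2 + Z * X\<^sup>2 / 8 - (X ^ 3 - (X - 2 * Z) ^ 3) / 24 - S / 24)
      = q * (X - 2 * (Z + y)) / 2 + (Z + y) * X\<^sup>2 / 8 - (X ^ 3 - (X - 2 * (Z + y)) ^ 3) / 24 - (S + y ^ 3) / 24"
      unfolding w_def threshold_def by (simp add: field_simps power2_eq_square power3_eq_cube)
    ultimately show ?thesis by linarith
  qed
  have "link (y / k) (c + k * (p - threshold X Z)) (c + k * (q - threshold X (Z + y))) * tilt X c Z S p =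
     exp (- ((- (k * D))\<^sup>2 / (4 * (y / k)) + ((c + k * (p - threshold X Z)) + (c + k * (q - threshold X (Z + y)))) * (y / k) / 2)
      + (- c * Z / k + p * (X - 2 * Z) / 2 + Z * X\<^sup>2 / 8 - (X ^ 3 - (X - 2 * Z) ^ 3) / 24 - S / 24))"
    unfolding link_def diff tilt_def k_def[symmetric] exp_add[symmetric] ..
  also have "\<dots> = exp ((- c * (Z + y) / k + q * (X - 2 * (Z + y)) / 2 + (Z + y) * X\<^sup>2 / 8 - (X ^ 3 - (X - 2 * (Z + y)) ^ 3) / 24 - (S + y ^ 3) / 24)
      + - ((q - p)\<^sup>2 / (2 * y)))"
    unfolding sq lin Dsq alg[symmetric] by (rule arg_cong[of _ _ exp]) linarith
  also have "\<dots> = tilt X c (Z + y) (S + y ^ 3) q * (sqrt (2 * pi * y) * gauss y (q - p))"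
    unfolding exp_add tilt_def k_def[symmetric] gauss_def using y by simp
  finally show ?thesis unfolding k_def .
qed

lemma block_chain_nonneg:
  assumes "\<And>y. y \<in> set ys \<Longrightarrow> y > 0"
  shows "0 \<le> block_chain X ys q"
  using assms
proof (induction ys arbitrary: q rule: induct_list012)
  case (3 y z zs)
  have "0 \<le> block_chain X (z # zs) r" for r by (rule "3.IH"(2)) (use "3.prems" in auto)
  then show ?case
    using gauss_nonneg[of y] "3.prems"
    unfolding block_chain.simps gauss_conv_def by (intro integral_nonneg_AE AE_I2) auto
qed (auto simp: gauss_nonneg)

text \<open>The substitution \<open>r = c + cube_root_2 * (p - threshold X Z)\<close> carries the
  constraint \<open>r \<ge> c\<close> to \<open>p \<ge> threshold X Z\<close>, the constraint of
  \<open>block_chain\<close>, and \<open>link_tilt\<close> moves the tilt past each link. Each of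
  the \<open>m\<close> integrations contributes one Jacobian \<open>cube_root_2\<close>.\<close>

lemma link_chain_eq_block_chain:
  fixes x :: "nat \<Rightarrow> real"
  assumes x: "\<And>j. j \<le> m \<Longrightarrow> x j > 0"
  shows "link_chain (\<lambda>j. x j / cube_root_2) c m (c + cube_root_2 * (q - threshold X (\<Sum>j\<le>m. x j))) =
    ennreal (tilt X c (\<Sum>j\<le>m. x j) (\<Sum>j\<le>m. x j ^ 3) q * (cube_root_2 ^ m * (\<Prod>j\<le>m. sqrt (2 * pi * x j)) *
      block_chain X (map x (rev [0..<Suc m])) q))"
  using x
proof (induction m arbitrary: q)
  case 0
  have "link (x 0 / cube_root_2) c (c + cube_root_2 * (q - threshold X (x 0))) =
      tilt X c (x 0) (x 0 ^ 3) q * (sqrt (2 * pi * x 0) * gauss (x 0) q)"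
    using link_tilt[of "x 0" c 0 X 0 q 0] 0 by (simp add: threshold_def tilt_def)
  then show ?case by simp
next
  case (Suc m)
  let ?k = "cube_root_2"
  define Z where "Z = (\<Sum>j\<le>m. x j)"
  define S where "S = (\<Sum>j\<le>m. x j ^ 3)"
  define Q where "Q = (\<Prod>j\<le>m. sqrt (2 * pi * x j))"
  define y where "y = x (Suc m)"
  define B where "B = block_chain X (map x (rev [0..<Suc m]))"
  have y: "y > 0" using Suc.prems by (simp add: y_def)
  have k: "?k > 0" by (rule cube_root_2)
  have pos: "r > 0" if "r \<in> set (map x (rev [0..<Suc m]))" for r using that Suc.prems by auto
  have B0: "0 \<le> B p" for p unfolding B_def using pos by (intro block_chain_nonneg) auto
  have Bb: "bdd_borel B" unfolding B_def using pos by (intro bdd_borel_block_chain) auto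
  note [measurable] = bdd_borel_measurable[OF Bb]
  have Q0: "0 \<le> Q" unfolding Q_def by (intro prod_nonneg) (use Suc.prems in \<open>auto intro!: less_imp_le\<close>)
  have IH: "link_chain (\<lambda>j. x j / ?k) c m (c + ?k * (p - threshold X Z)) =
      ennreal (tilt X c Z S p * (?k ^ m * Q * B p))" for p
    unfolding Z_def S_def Q_def B_def by (rule Suc.IH) (use Suc.prems in auto)
  let ?q = "c + ?k * (q - threshold X (Z + y))"
  let ?st = "\<lambda>p. if threshold X Z \<le> p then 1 else 0 :: real"
  have "link_chain (\<lambda>j. x j / ?k) c (Suc m) ?q =
     (\<integral>\<^sup>+r. link_chain (\<lambda>j. x j / ?k) c m r * indicator {c..} r * ennreal (link (y / ?k) r ?q) \<partial>lborel)"
    by (simp add: y_def)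
  also have "\<dots> = ennreal \<bar>?k\<bar> * (\<integral>\<^sup>+p. link_chain (\<lambda>j. x j / ?k) c m ((c - ?k * threshold X Z) + ?k * p) * indicator {c..} ((c - ?k * threshold X Z) + ?k * p) *
      ennreal (link (y / ?k) ((c - ?k * threshold X Z) + ?k * p) ?q) \<partial>lborel)"
    by (rule nn_integral_real_affine) (use k in auto)
  also have "(\<integral>\<^sup>+p. link_chain (\<lambda>j. x j / ?k) c m ((c - ?k * threshold X Z) + ?k * p) * indicator {c..} ((c - ?k * threshold X Z) + ?k * p) *
      ennreal (link (y / ?k) ((c - ?k * threshold X Z) + ?k * p) ?q) \<partial>lborel) =
     (\<integral>\<^sup>+p. ennreal (tilt X c (Z + y) (S + y ^ 3) q * (sqrt (2 * pi * y) * ?k ^ m * Q)) * ennreal (?st p * B p * gauss y (q - p)) \<partial>lborel)"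
  proof (rule nn_integral_cong)
    fix p
    have e: "(c - ?k * threshold X Z) + ?k * p = c + ?k * (p - threshold X Z)" by (simp add: algebra_simps)
    have ind: "indicator {c..} (c + ?k * (p - threshold X Z)) = ennreal (?st p)"
      using k by (auto simp: indicator_def zero_le_mult_iff)
    have t0: "0 \<le> tilt X c Z S p" "0 \<le> tilt X c (Z + y) (S + y ^ 3) q" by (auto simp: tilt_def)
    have "tilt X c Z S p * (?k ^ m * Q * B p) * ?st p * link (y / ?k) (c + ?k * (p - threshold X Z)) ?q =
       (link (y / ?k) (c + ?k * (p - threshold X Z)) ?q * tilt X c Z S p) * (?k ^ m * Q * B p * ?st p)"
      by (simp only: mult_ac)
    also have "\<dots> = tilt X c (Z + y) (S + y ^ 3) q * (sqrt (2 * pi * y) * ?k ^ m * Q) * (?st p * B p * gauss y (q - p))"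
      unfolding link_tilt[OF y] by (simp only: mult_ac)
    finally have eq: "tilt X c Z S p * (?k ^ m * Q * B p) * ?st p * link (y / ?k) (c + ?k * (p - threshold X Z)) ?q =
       tilt X c (Z + y) (S + y ^ 3) q * (sqrt (2 * pi * y) * ?k ^ m * Q) * (?st p * B p * gauss y (q - p))" .
    have nn: "0 \<le> tilt X c Z S p * (?k ^ m * Q * B p)" "0 \<le> ?st p"
      "0 \<le> tilt X c (Z + y) (S + y ^ 3) q * (sqrt (2 * pi * y) * ?k ^ m * Q)" "0 \<le> ?st p * B p * gauss y (q - p)"
      using t0 B0 Q0 k y gauss_nonneg[OF y] by auto
    show "link_chain (\<lambda>j. x j / ?k) c m ((c - ?k * threshold X Z) + ?k * p) * indicator {c..} ((c - ?k * threshold X Z) + ?k * p) *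
      ennreal (link (y / ?k) ((c - ?k * threshold X Z) + ?k * p) ?q) =
      ennreal (tilt X c (Z + y) (S + y ^ 3) q * (sqrt (2 * pi * y) * ?k ^ m * Q)) * ennreal (?st p * B p * gauss y (q - p))"
      unfolding e IH ind ennreal_mult''[OF nn(2), symmetric] ennreal_mult''[OF nn(4), symmetric]
        ennreal_mult''[OF link_nonneg, symmetric] eq ..
  qed
  also have "\<dots> = ennreal (tilt X c (Z + y) (S + y ^ 3) q * (sqrt (2 * pi * y) * ?k ^ m * Q)) * (\<integral>\<^sup>+p. ennreal (?st p * B p * gauss y (q - p)) \<partial>lborel)"
    by (rule nn_integral_cmult) measurable
  also have "(\<integral>\<^sup>+p. ennreal (?st p * B p * gauss y (q - p)) \<partial>lborel) = ennreal (gauss_conv y (\<lambda>p. ?st p * B p) q)"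
    unfolding gauss_conv_def
    by (rule nn_integral_eq_integral[OF integrable_gauss_conv[OF y bdd_borel_mult[OF bdd_borel_step Bb]]])
       (use B0 gauss_nonneg[OF y] in auto)
  also have "gauss_conv y (\<lambda>p. ?st p * B p) q = block_chain X (map x (rev [0..<Suc (Suc m)])) q"
  proof -
    obtain z zs where zs: "map x (rev [0..<Suc m]) = z # zs" by simp
    have "sum_list (z # zs) = Z"
      unfolding zs[symmetric] Z_def
      by (simp add: rev_map[symmetric] interv_sum_list_conv_sum_set_nat atLeast0LessThan lessThan_Suc_atMost[symmetric])
    moreover have "map x (rev [0..<Suc (Suc m)]) = y # z # zs" using zs by (simp add: y_def)
    ultimately show ?thesis unfolding B_def zs by (simp only: block_chain.simps)
  qed
  finally have main: "link_chain (\<lambda>j. x j / ?k) c (Suc m) ?q = ennreal \<bar>?k\<bar> *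
     (ennreal (tilt X c (Z + y) (S + y ^ 3) q * (sqrt (2 * pi * y) * ?k ^ m * Q)) *
      ennreal (block_chain X (map x (rev [0..<Suc (Suc m)])) q))" .
  have bn: "0 \<le> block_chain X (map x (rev [0..<Suc (Suc m)])) q"
    by (rule block_chain_nonneg) (use Suc.prems in auto)
  have sums: "(\<Sum>j\<le>Suc m. x j) = Z + y" "(\<Sum>j\<le>Suc m. x j ^ 3) = S + y ^ 3" "(\<Prod>j\<le>Suc m. sqrt (2 * pi * x j)) = Q * sqrt (2 * pi * y)"
    by (simp_all add: Z_def S_def Q_def y_def)
  have "link_chain (\<lambda>j. x j / ?k) c (Suc m) ?q = ennreal (\<bar>?k\<bar> * (tilt X c (Z + y) (S + y ^ 3) q * (sqrt (2 * pi * y) * ?k ^ m * Q) *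
      block_chain X (map x (rev [0..<Suc (Suc m)])) q))"
    unfolding main ennreal_mult''[OF bn, symmetric] ennreal_mult'[OF abs_ge_zero, symmetric] ..
  also have "\<bar>?k\<bar> * (tilt X c (Z + y) (S + y ^ 3) q * (sqrt (2 * pi * y) * ?k ^ m * Q) * block_chain X (map x (rev [0..<Suc (Suc m)])) q) =
     tilt X c (Z + y) (S + y ^ 3) q * (?k ^ Suc m * (Q * sqrt (2 * pi * y)) * block_chain X (map x (rev [0..<Suc (Suc m)])) q)"
    using k by (simp only: abs_of_pos power_Suc mult_ac)
  finally show ?case unfolding sums .
qed

section \<open>Splitting the loop at its minimum\<close>

lemma nn_integral_PiM_reindex:
  fixes \<pi> :: "'i \<Rightarrow> 'i"
  assumes fin: "finite I" and \<pi>: "bij_betw \<pi> I I" and f: "f \<in> borel_measurable (lborel_pow I)"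
  shows "(\<integral>\<^sup>+s. f (\<lambda>i\<in>I. s (\<pi> i)) \<partial>lborel_pow I) = (\<integral>\<^sup>+s. f s \<partial>lborel_pow I)"
proof -
  interpret P: product_sigma_finite "\<lambda>_::'i. lborel :: real measure" by standard
  let ?M = "lborel_pow I"
  let ?T = "\<lambda>s. \<lambda>i\<in>I. s (\<pi> i)"
  have \<pi>I: "\<pi> i \<in> I" if "i \<in> I" for i using \<pi> that by (auto simp: bij_betw_def)
  have T: "?T \<in> measurable ?M ?M"
    by (intro measurable_restrict measurable_component_singleton \<pi>I)
  have "distr ?M ?M ?T = ?M"
  proof (rule P.PiM_eqI[OF fin])
    fix A :: "'i \<Rightarrow> real set" assume A: "\<And>i. i \<in> I \<Longrightarrow> A i \<in> sets lborel"
    have inv: "inv_into I \<pi> i \<in> I" "\<pi> (inv_into I \<pi> i) = i" "inv_into I \<pi> (\<pi> i) = i" if "i \<in> I" for i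
      using \<pi> that by (auto simp: bij_betw_def inv_into_into f_inv_into_f)
    have "?T -` Pi\<^sub>E I A \<inter> space ?M = Pi\<^sub>E I (\<lambda>i. A (inv_into I \<pi> i))"
    proof (intro equalityI subsetI)
      fix s assume "s \<in> ?T -` Pi\<^sub>E I A \<inter> space ?M"
      then have s: "\<And>i. i \<in> I \<Longrightarrow> s (\<pi> i) \<in> A i" "s \<in> extensional I"
        by (auto simp: PiE_iff space_PiM)
      then show "s \<in> Pi\<^sub>E I (\<lambda>i. A (inv_into I \<pi> i))"
        using inv by (auto simp: PiE_iff) (metis inv(1,2))
    next
      fix s assume s: "s \<in> Pi\<^sub>E I (\<lambda>i. A (inv_into I \<pi> i))"
      then have "s (\<pi> i) \<in> A i" if "i \<in> I" for i
        using \<pi>I[OF that] inv(3)[OF that] by (metis PiE_mem)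
      then show "s \<in> ?T -` Pi\<^sub>E I A \<inter> space ?M"
        using s by (auto simp: PiE_iff space_PiM)
    qed
    then have "emeasure (distr ?M ?M ?T) (Pi\<^sub>E I A) = emeasure ?M (Pi\<^sub>E I (\<lambda>i. A (inv_into I \<pi> i)))"
      using A fin by (subst emeasure_distr[OF T]) (auto intro!: sets_PiM_I_finite)
    also have "\<dots> = (\<Prod>i\<in>I. emeasure lborel (A (inv_into I \<pi> i)))"
      by (rule P.emeasure_PiM[OF fin]) (use A inv in auto)
    also have "\<dots> = (\<Prod>i\<in>I. emeasure lborel (A i))"
      using bij_betw_inv_into[OF \<pi>] by (rule prod.reindex_bij_betw)
    finally show "emeasure (distr ?M ?M ?T) (Pi\<^sub>E I A) = (\<Prod>i\<in>I. emeasure lborel (A i))" .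
  qed simp
  then have "(\<integral>\<^sup>+s. f s \<partial>?M) = (\<integral>\<^sup>+s. f s \<partial>distr ?M ?M ?T)" by simp
  also have "\<dots> = (\<integral>\<^sup>+s. f (?T s) \<partial>?M)" by (rule nn_integral_distr[OF T]) (use f in simp)
  finally show ?thesis ..
qed

lemma bij_betw_rotate: "bij_betw (\<lambda>j. (j + r) mod l) {..<l} {..<l :: nat}"
proof -
  have *: "i = j" if "i \<le> j" "j < l" "(i + r) mod l = (j + r) mod l" for i j
  proof -
    have "l dvd (j + r) - (i + r)" using that mod_eq_dvd_iff_nat[of "i + r" "j + r" l] by simp
    then have "l dvd j - i" by simp
    then show ?thesis using that by (metis diff_is_0_eq dvd_imp_le le_antisym less_imp_diff_less linorder_not_le neq0_conv)
  qed
  have "inj_on (\<lambda>j. (j + r) mod l) {..<l}"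
  proof (rule inj_onI)
    fix i j assume "i \<in> {..<l}" "j \<in> {..<l}" "(i + r) mod l = (j + r) mod l"
    then show "i = j" using *[of i j] *[of j i] by (cases "i \<le> j") auto
  qed
  moreover have "(\<lambda>j. (j + r) mod l) ` {..<l} \<subseteq> {..<l}"
    by (auto intro: mod_less_divisor)
  ultimately show ?thesis
    unfolding bij_betw_def using endo_inj_surj[OF finite_lessThan] by blast
qed

text \<open>Kept as a product over coordinates, so that a rotation of the coordinates is a
  reindexing of the product.\<close>

definition nonneg_ind :: "nat \<Rightarrow> (nat \<Rightarrow> real) \<Rightarrow> ennreal" where
  "nonneg_ind l s = (\<Prod>j<l. indicator {0..} (s j))"

definition min_ind :: "nat \<Rightarrow> nat \<Rightarrow> (nat \<Rightarrow> real) \<Rightarrow> ennreal" where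
  "min_ind l r s = (\<Prod>j<l. indicator {s r..} (s j))"

text \<open>The loop weight with each edge indexed by its end point:
  \<open>(j + (l - 1)) mod l\<close> is the cyclic predecessor of \<open>j\<close>. A minimum at
  coordinate \<open>l - 1\<close> is then both start and end of a path through the coordinates 0,
  ..., l - 2 in this order.\<close>

definition cyclic_links :: "nat \<Rightarrow> (nat \<Rightarrow> real) \<Rightarrow> (nat \<Rightarrow> real) \<Rightarrow> real" where
  "cyclic_links l y s = (\<Prod>j<l. link (y j) (s ((j + (l - 1)) mod l)) (s j))"

context
  fixes l :: nat
  assumes l: "l \<ge> 1"
begin

lemma measurable_coord [measurable]:
  "k < l \<Longrightarrow> (\<lambda>s. s k) \<in> borel_measurable (lborel_pow {..<l})"
  using measurable_component_singleton[of k "{..<l}" "\<lambda>_. lborel"] by simp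

lemma mod_l_less: "k mod l < l" using l by simp

lemma measurable_nonneg_ind [measurable]: "nonneg_ind l \<in> borel_measurable (lborel_pow {..<l})"
  unfolding nonneg_ind_def
proof (intro borel_measurable_prod_ennreal)
  fix j assume "j \<in> {..<l}"
  then have [measurable]: "(\<lambda>s. s j) \<in> borel_measurable (lborel_pow {..<l})" by simp
  show "(\<lambda>s. indicator {0..} (s j) :: ennreal) \<in> borel_measurable (lborel_pow {..<l})"
    by measurable
qed

lemma measurable_min_ind: "r < l \<Longrightarrow> min_ind l r \<in> borel_measurable (lborel_pow {..<l})"
  unfolding min_ind_def
proof (intro borel_measurable_prod_ennreal)
  fix j assume "r < l" "j \<in> {..<l}"
  then have [measurable]: "(\<lambda>s. s j) \<in> borel_measurable (lborel_pow {..<l})"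
    "(\<lambda>s. s r) \<in> borel_measurable (lborel_pow {..<l})" by simp_all
  have "(\<lambda>s. indicator {s r..} (s j) :: ennreal) = (\<lambda>s. if s r \<le> s j then 1 else 0)" by (auto split: split_indicator)
  also have "\<dots> \<in> borel_measurable (lborel_pow {..<l})" by measurable
  finally show "(\<lambda>s. indicator {s r..} (s j) :: ennreal) \<in> borel_measurable (lborel_pow {..<l})" .
qed

lemma measurable_cyclic_links [measurable]: "cyclic_links l y \<in> borel_measurable (lborel_pow {..<l})"
  unfolding cyclic_links_def
  by (intro borel_measurable_prod link_measurable measurable_coord mod_l_less) auto

lemma ring_weight_eq: "ring_weight l y s = (\<Prod>j<l. link (y j) (s j) (s ((j + 1) mod l)))"
  by (simp add: ring_weight_def link_def sum_negf exp_sum flip: sum_negf)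

lemma measurable_ring_weight [measurable]: "ring_weight l y \<in> borel_measurable (lborel_pow {..<l})"
  unfolding ring_weight_eq
  by (intro borel_measurable_prod link_measurable measurable_coord mod_l_less) auto

lemma E_fun_nn_integral:
  "E_fun l y = exp ((\<Sum>j<l. y j ^ 3) / 12) / (\<Prod>j<l. sqrt (4 * pi * y j)) *
     enn2real (\<integral>\<^sup>+s. nonneg_ind l s * ennreal (ring_weight l y s) \<partial>lborel_pow {..<l})"
proof -
  let ?M = "lborel_pow {..<l}"
  let ?A = "{s :: nat \<Rightarrow> real. \<forall>j<l. 0 \<le> s j}"
  have ind: "ennreal (indicator ?A s) = nonneg_ind l s" for s
  proof (cases "s \<in> ?A")
    case False
    then obtain j where "j < l" "s j < 0" by auto
    then show ?thesis using False by (auto simp: nonneg_ind_def intro!: prod_zero[symmetric] bexI[of _ j])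
  qed (auto simp: nonneg_ind_def)
  have indr: "indicator ?A s = enn2real (nonneg_ind l s)" for s
    using ind[of s] by (metis enn2real_ennreal indicator_pos_le)
  have "(LINT s : ?A | ?M. ring_weight l y s) = enn2real (\<integral>\<^sup>+s. ennreal (indicator ?A s *\<^sub>R ring_weight l y s) \<partial>?M)"
    unfolding set_lebesgue_integral_def
  proof (rule integral_eq_nn_integral)
    show "(\<lambda>s. indicator ?A s *\<^sub>R ring_weight l y s) \<in> borel_measurable ?M"
      unfolding indr by measurable
    show "AE s in ?M. 0 \<le> indicator ?A s *\<^sub>R ring_weight l y s" by (auto simp: ring_weight_def)
  qed
  also have "(\<integral>\<^sup>+s. ennreal (indicator ?A s *\<^sub>R ring_weight l y s) \<partial>?M) = (\<integral>\<^sup>+s. nonneg_ind l s * ennreal (ring_weight l y s) \<partial>?M)"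
    by (intro nn_integral_cong) (simp add: ennreal_mult' flip: ind)
  finally show ?thesis unfolding E_fun_def ring_weight_def by simp
qed

text \<open>Ties between coordinates form a null set, and without ties the minimum sits at exactly
  one position.\<close>

lemma AE_sum_min_ind: "AE s in lborel_pow {..<l}. (\<Sum>r<l. min_ind l r s) = 1"
proof -
  let ?M = "lborel_pow {..<l}"
  have "AE s in ?M. \<forall>p\<in>{..<l}. \<forall>q\<in>{..<l}. p \<noteq> q \<longrightarrow> s p \<noteq> s q"
  proof (intro AE_finite_allI finite_lessThan)
    fix p q assume pq: "p \<in> {..<l}" "q \<in> {..<l}"
    show "AE s in ?M. p \<noteq> q \<longrightarrow> s p \<noteq> s q"
    proof (cases "p = q")
      case False
      then have "AE s in ?M. s p \<noteq> s q"
        using pq by (intro AE_PiM_coordinate_neq) auto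
      then show ?thesis by simp
    qed simp
  qed
  then show ?thesis
  proof eventually_elim
    fix s :: "nat \<Rightarrow> real" assume d: "\<forall>p\<in>{..<l}. \<forall>q\<in>{..<l}. p \<noteq> q \<longrightarrow> s p \<noteq> s q"
    have "finite (s ` {..<l})" "s ` {..<l} \<noteq> {}" using l by (auto simp: lessThan_empty_iff)
    then have "Min (s ` {..<l}) \<in> s ` {..<l}" by (rule Min_in)
    then obtain m where m: "m < l" "s m = Min (s ` {..<l})" by auto
    have le: "s m \<le> s j" if "j < l" for j using m that by simp
    have "min_ind l r s = (if r = m then 1 else 0)" if "r < l" for r
    proof (cases "r = m")
      case True
      then show ?thesis using le by (auto simp: min_ind_def)
    next
      case False
      then have "s m < s r" using le[OF that] d m that by (metis lessThan_iff order_le_less)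
      then show ?thesis using False m by (auto simp: min_ind_def intro!: prod_zero bexI[of _ m])
    qed
    then have "(\<Sum>r<l. min_ind l r s) = (\<Sum>r<l. if r = m then 1 else 0)" by (intro sum.cong) auto
    then show "(\<Sum>r<l. min_ind l r s) = 1" using m by (simp add: sum.delta)
  qed
qed

lemma rotate_last:
  assumes "r < l"
  shows "(l - 1 + r + 1) mod l = r"
  using l assms by simp

lemma nn_integral_ring_split:
  "(\<integral>\<^sup>+s. nonneg_ind l s * ennreal (ring_weight l y s) \<partial>lborel_pow {..<l}) =
   (\<Sum>r<l. \<integral>\<^sup>+s. nonneg_ind l s * min_ind l (l - 1) s * ennreal (cyclic_links l (\<lambda>j. y ((j + r) mod l)) s) \<partial>lborel_pow {..<l})"
proof -
  let ?M = "lborel_pow {..<l}"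
  have "(\<integral>\<^sup>+s. nonneg_ind l s * ennreal (ring_weight l y s) \<partial>?M) =
      (\<integral>\<^sup>+s. (\<Sum>r<l. nonneg_ind l s * min_ind l r s * ennreal (ring_weight l y s)) \<partial>?M)"
  proof (rule nn_integral_cong_AE)
    show "AE s in ?M. nonneg_ind l s * ennreal (ring_weight l y s) = (\<Sum>r<l. nonneg_ind l s * min_ind l r s * ennreal (ring_weight l y s))"
      using AE_sum_min_ind
    proof eventually_elim
      fix s assume 1: "(\<Sum>r<l. min_ind l r s) = 1"
      have "(\<Sum>r<l. nonneg_ind l s * min_ind l r s * ennreal (ring_weight l y s)) =
        nonneg_ind l s * (\<Sum>r<l. min_ind l r s) * ennreal (ring_weight l y s)"
        by (simp only: sum_distrib_left sum_distrib_right)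
      then show "nonneg_ind l s * ennreal (ring_weight l y s) = (\<Sum>r<l. nonneg_ind l s * min_ind l r s * ennreal (ring_weight l y s))"
        unfolding 1 by simp
    qed
  qed
  also have "\<dots> = (\<Sum>r<l. \<integral>\<^sup>+s. nonneg_ind l s * min_ind l r s * ennreal (ring_weight l y s) \<partial>?M)"
  proof (rule nn_integral_sum)
    fix r assume "r \<in> {..<l}"
    then have [measurable]: "min_ind l r \<in> borel_measurable ?M" using measurable_min_ind by simp
    show "(\<lambda>s. nonneg_ind l s * min_ind l r s * ennreal (ring_weight l y s)) \<in> borel_measurable ?M" by measurable
  qed
  also have "\<dots> = (\<Sum>r<l. \<integral>\<^sup>+s. nonneg_ind l s * min_ind l (l - 1) s * ennreal (cyclic_links l (\<lambda>j. y ((j + r) mod l)) s) \<partial>?M)"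
  proof (rule sum.cong[OF refl])
    fix r assume r: "r \<in> {..<l}"
    \<comment> \<open>The shift by \<open>r + 1\<close> reads coordinate \<open>r\<close> at
      position \<open>l - 1\<close>, which brings the minimum to the last place.\<close>
    let ?\<pi> = "\<lambda>j. (j + (r + 1)) mod l"
    let ?F = "\<lambda>s. nonneg_ind l s * min_ind l (l - 1) s * ennreal (cyclic_links l (\<lambda>j. y ((j + r) mod l)) s)"
    have [measurable]: "min_ind l (l - 1) \<in> borel_measurable ?M" using measurable_min_ind l by simp
    have F: "?F \<in> borel_measurable ?M" by measurable
    have bij: "bij_betw ?\<pi> {..<l} {..<l}" by (rule bij_betw_rotate)
    have "?F (\<lambda>i\<in>{..<l}. s (?\<pi> i)) = nonneg_ind l s * min_ind l r s * ennreal (ring_weight l y s)" for s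
    proof -
      let ?s = "\<lambda>i\<in>{..<l}. s (?\<pi> i)"
      have "nonneg_ind l ?s = (\<Prod>j<l. indicator {0..} (s (?\<pi> j)))"
        unfolding nonneg_ind_def by (intro prod.cong) auto
      also have "\<dots> = nonneg_ind l s"
        unfolding nonneg_ind_def by (rule prod.reindex_bij_betw[OF bij])
      finally have 1: "nonneg_ind l ?s = nonneg_ind l s" .
      have sl: "?s (l - 1) = s r"
        using rotate_last[of r] r l by simp
      have "min_ind l (l - 1) ?s = (\<Prod>j<l. indicator {s r..} (s (?\<pi> j)))"
        unfolding min_ind_def sl by (intro prod.cong) auto
      also have "\<dots> = min_ind l r s"
        unfolding min_ind_def by (rule prod.reindex_bij_betw[OF bij])
      finally have 2: "min_ind l (l - 1) ?s = min_ind l r s" .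
      have "cyclic_links l (\<lambda>j. y ((j + r) mod l)) ?s =
         (\<Prod>j<l. link (y ((j + r) mod l)) (s ((j + r) mod l)) (s (((j + r) mod l + 1) mod l)))"
        unfolding cyclic_links_def
      proof (rule prod.cong[OF refl])
        fix j assume j: "j \<in> {..<l}"
        have "?s ((j + (l - 1)) mod l) = s (((j + (l - 1)) mod l + (r + 1)) mod l)"
          using mod_l_less by simp
        also have "((j + (l - 1)) mod l + (r + 1)) mod l = (j + (l - 1) + (r + 1)) mod l"
          by (rule mod_add_left_eq)
        also have "j + (l - 1) + (r + 1) = (j + r) + l" using l by simp
        finally have e1: "?s ((j + (l - 1)) mod l) = s ((j + r) mod l)" by simp
        have e2: "?s j = s (((j + r) mod l + 1) mod l)"
          using j by (simp add: mod_add_left_eq add.assoc mod_Suc_eq)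
        show "link (y ((j + r) mod l)) (?s ((j + (l - 1)) mod l)) (?s j) =
           link (y ((j + r) mod l)) (s ((j + r) mod l)) (s (((j + r) mod l + 1) mod l))"
          unfolding e1 e2 ..
      qed
      also have "\<dots> = ring_weight l y s"
        unfolding ring_weight_eq by (rule prod.reindex_bij_betw[OF bij_betw_rotate])
      finally have 3: "cyclic_links l (\<lambda>j. y ((j + r) mod l)) ?s = ring_weight l y s" .
      show ?thesis unfolding 1 2 3 ..
    qed
    then show "(\<integral>\<^sup>+s. nonneg_ind l s * min_ind l r s * ennreal (ring_weight l y s) \<partial>?M) = (\<integral>\<^sup>+s. ?F s \<partial>?M)"
      using nn_integral_PiM_reindex[OF finite_lessThan bij F] by simp
  qed
  finally show ?thesis .
qed

text \<open>Fix the value \<open>c \<ge> 0\<close> of the minimum at coordinate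
  \<open>l - 1\<close>. The other coordinates only have to stay on or above \<open>c\<close>, which
  is the path from \<open>c\<close> to \<open>c\<close> measured by \<open>link_chain\<close>. As
  \<open>threshold X X = 0\<close>, its end point corresponds to \<open>q = 0\<close>. The value
  \<open>c\<close> survives only in exp(-cX/k) with k = \<open>cube_root_2\<close>, whose integral
  k/X supplies the factor 1/X and the last power of k.\<close>

lemma nn_integral_cyclic_links:
  assumes x: "\<And>j. j < l \<Longrightarrow> x j > 0"
  defines "X \<equiv> \<Sum>j<l. x j"
  shows "(\<integral>\<^sup>+s. nonneg_ind l s * min_ind l (l - 1) s * ennreal (cyclic_links l (\<lambda>j. x j / cube_root_2) s) \<partial>lborel_pow {..<l}) =
    ennreal (exp ((X ^ 3 - (\<Sum>j<l. x j ^ 3)) / 24) * cube_root_2 ^ l * (\<Prod>j<l. sqrt (2 * pi * x j)) / X *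
      block_chain X (map x (rev [0..<l])) 0)"
proof -
  interpret P: product_sigma_finite "\<lambda>_::nat. lborel :: real measure" by standard
  let ?k = cube_root_2
  obtain m where m: "l = Suc m" using l by (cases l) auto
  let ?y = "\<lambda>j. x j / ?k"
  let ?F = "\<lambda>s. nonneg_ind l s * min_ind l (l - 1) s * ennreal (cyclic_links l ?y s)"
  let ?g = "\<lambda>c s. (\<Prod>j<m. ennreal (link (?y j) (if j = 0 then c else s (j - 1)) (s j)) * indicator {c..} (s j)) *
      ennreal (link (?y m) (if m = 0 then c else s (m - 1)) c)"
  have I: "{..<l} = insert m {..<m}" unfolding m by auto
  have [measurable]: "min_ind l (l - 1) \<in> borel_measurable (lborel_pow {..<l})" using measurable_min_ind l by simp
  have F: "?F \<in> borel_measurable (lborel_pow {..<l})" by measurable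
  have X0: "X > 0" unfolding X_def by (intro sum_pos) (use x l in \<open>auto simp: lessThan_empty_iff\<close>)
  define S where "S = (\<Sum>j<l. x j ^ 3)"
  define Q where "Q = (\<Prod>j<l. sqrt (2 * pi * x j))"
  define B where "B = block_chain X (map x (rev [0..<l])) 0"
  have B0: "0 \<le> B" unfolding B_def by (rule block_chain_nonneg) (use x in auto)
  have Q0: "0 \<le> Q" unfolding Q_def by (intro prod_nonneg) (use x in \<open>auto intro: less_imp_le\<close>)
  have upd: "?F (s(m := c)) = indicator {0..} c * ?g c s" for s c
  proof (cases "c \<ge> 0")
    case False
    then show ?thesis by (simp add: nonneg_ind_def m)
  next
    case True
    have "cyclic_links l ?y (s(m := c)) = (\<Prod>j<m. link (?y j) (if j = 0 then c else s (j - 1)) (s j)) *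
       link (?y m) (if m = 0 then c else s (m - 1)) c"
    proof -
      have "(s(m := c)) ((j + (l - 1)) mod l) = (if j = 0 then c else s (j - 1))" if "j \<le> m" for j
      proof (cases j)
        case 0
        then show ?thesis by (simp add: m)
      next
        case (Suc i)
        then have "j + (l - 1) = i + l" "i < l" using that m by auto
        then have "(j + (l - 1)) mod l = i" by simp
        then show ?thesis using Suc that by simp
      qed
      then show ?thesis unfolding cyclic_links_def m prod.lessThan_Suc by (intro arg_cong2[of _ _ _ _ "(*)"] prod.cong) auto
    qed
    then have cl: "ennreal (cyclic_links l ?y (s(m := c))) = (\<Prod>j<m. ennreal (link (?y j) (if j = 0 then c else s (j - 1)) (s j))) *
       ennreal (link (?y m) (if m = 0 then c else s (m - 1)) c)"
      by (simp add: ennreal_mult' prod_ennreal prod_nonneg)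
    have "nonneg_ind l (s(m := c)) * min_ind l (l - 1) (s(m := c)) = (\<Prod>j<m. indicator {c..} (s j))"
    proof -
      have pr: "(\<Prod>j<m. indicator D ((s(m := c)) j)) = (\<Prod>j<m. indicator D (s j) :: ennreal)" for D
        by (intro prod.cong) auto
      have "nonneg_ind l (s(m := c)) = (\<Prod>j<m. indicator {0..} (s j))"
        unfolding nonneg_ind_def m prod.lessThan_Suc pr using True by simp
      moreover have "min_ind l (l - 1) (s(m := c)) = (\<Prod>j<m. indicator {c..} (s j))"
        unfolding min_ind_def m prod.lessThan_Suc diff_Suc_1 fun_upd_same pr by simp
      moreover have "indicator {0..} (s j) * indicator {c..} (s j) = (indicator {c..} (s j) :: ennreal)" for j
        using True by (auto split: split_indicator)
      ultimately show ?thesis by (simp flip: prod.distrib)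
    qed
    then show ?thesis unfolding cl using True by (simp add: prod.distrib mult_ac)
  qed
  have gm: "?g c \<in> borel_measurable (lborel_pow {..<m})" for c
    by (rule measurable_links)
  have "(\<integral>\<^sup>+s. ?F s \<partial>lborel_pow {..<l}) = (\<integral>\<^sup>+c. (\<integral>\<^sup>+s. ?F (s(m := c)) \<partial>lborel_pow {..<m}) \<partial>lborel)"
    by (rule P.product_nn_integral_insert_rev[of "{..<m}" m ?F, unfolded I[symmetric]]) (use F in auto)
  also have "\<dots> = (\<integral>\<^sup>+c. indicator {0..} c * link_chain ?y c m c \<partial>lborel)"
    unfolding upd nn_integral_cmult[OF gm] by (simp only: nn_integral_links[where y = ?y])
  also have "\<dots> = (\<integral>\<^sup>+c. ennreal (exp ((X ^ 3 - S) / 24) * (?k ^ m * Q * B)) * (ennreal (exp (- (X / ?k) * c)) * indicator {0..} c) \<partial>lborel)"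
  proof (rule nn_integral_cong)
    fix c
    have s: "(\<Sum>j\<le>m. x j) = X" "(\<Sum>j\<le>m. x j ^ 3) = S" "(\<Prod>j\<le>m. sqrt (2 * pi * x j)) = Q"
      by (simp_all add: X_def S_def Q_def m lessThan_Suc_atMost)
    have "link_chain ?y c m (c + ?k * (0 - threshold X (\<Sum>j\<le>m. x j))) =
      ennreal (tilt X c X S 0 * (?k ^ m * Q * B))"
      using link_chain_eq_block_chain[of m x c 0 X] x unfolding s B_def m by simp
    then have "link_chain ?y c m c = ennreal (tilt X c X S 0 * (?k ^ m * Q * B))"
      unfolding s by (simp add: threshold_def)
    also have "tilt X c X S 0 = exp ((X ^ 3 - S) / 24) * exp (- (X / ?k) * c)"
    proof -
      have "- c * X / ?k + 0 * (X - 2 * X) / 2 + X * X\<^sup>2 / 8 - (X ^ 3 - (X - 2 * X) ^ 3) / 24 - S / 24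
        = (X ^ 3 - S) / 24 + - (X / ?k) * c"
        using cube_root_2(1) by (simp add: field_simps power2_eq_square power3_eq_cube)
      then show ?thesis unfolding tilt_def exp_add[symmetric] by simp
    qed
    finally have "link_chain ?y c m c = ennreal (exp ((X ^ 3 - S) / 24) * (?k ^ m * Q * B) * exp (- (X / ?k) * c))"
      by (simp only: mult_ac)
    then have "link_chain ?y c m c = ennreal (exp ((X ^ 3 - S) / 24) * (?k ^ m * Q * B)) * ennreal (exp (- (X / ?k) * c))"
      by (simp only: ennreal_mult''[OF exp_ge_zero])
    then show "indicator {0..} c * link_chain ?y c m c =
      ennreal (exp ((X ^ 3 - S) / 24) * (?k ^ m * Q * B)) * (ennreal (exp (- (X / ?k) * c)) * indicator {0..} c)"
      by (simp only: mult_ac)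
  qed
  also have "\<dots> = ennreal (exp ((X ^ 3 - S) / 24) * (?k ^ m * Q * B)) * ennreal (1 / (X / ?k))"
    using nn_integral_exp_half_line[of "X / ?k"] X0 cube_root_2(1) by (subst nn_integral_cmult) auto
  also have "\<dots> = ennreal (exp ((X ^ 3 - S) / 24) * (?k ^ m * Q * B) * (1 / (X / ?k)))"
    using X0 cube_root_2(1) by (intro ennreal_mult''[symmetric]) auto
  also have "exp ((X ^ 3 - S) / 24) * (?k ^ m * Q * B) * (1 / (X / ?k)) = exp ((X ^ 3 - S) / 24) * ?k ^ l * Q / X * B"
    by (simp add: m)
  finally show ?thesis unfolding S_def Q_def B_def .
qed

text \<open>Each position \<open>r\<close> of the minimum gives one rotation of the chain. The sum
  of cubes in the prefactor of \<open>E_fun\<close> cancels against the one from the tilt and leaves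
  the cube of the total \<open>X\<close>.\<close>

lemma E_fun_eq_block_chains:
  assumes x: "\<And>j. j < l \<Longrightarrow> x j > 0"
  defines "X \<equiv> \<Sum>j<l. x j"
  shows "E_fun l (\<lambda>j. x j / cube_root_2) =
    exp (X ^ 3 / 24) / X * (\<Sum>r<l. block_chain X (map (\<lambda>j. x ((j + r) mod l)) (rev [0..<l])) 0)"
proof -
  let ?k = cube_root_2
  define S where "S = (\<Sum>j<l. x j ^ 3)"
  define Q where "Q = (\<Prod>j<l. sqrt (2 * pi * x j))"
  define B where "B = (\<lambda>r. block_chain X (map (\<lambda>j. x ((j + r) mod l)) (rev [0..<l])) 0)"
  have k: "?k > 0" "?k ^ 3 = 2" by (rule cube_root_2)+
  have X0: "X > 0" unfolding X_def by (intro sum_pos) (use x l in \<open>auto simp: lessThan_empty_iff\<close>)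
  have Q0: "0 < Q" unfolding Q_def by (intro prod_pos) (use x in auto)
  have B0: "0 \<le> B r" for r unfolding B_def by (rule block_chain_nonneg) (use x mod_l_less in auto)
  have piece: "(\<integral>\<^sup>+s. nonneg_ind l s * min_ind l (l - 1) s * ennreal (cyclic_links l (\<lambda>j. x ((j + r) mod l) / ?k) s) \<partial>lborel_pow {..<l}) =
    ennreal (exp ((X ^ 3 - S) / 24) * ?k ^ l * Q / X * B r)" for r
  proof -
    have rot: "(\<Sum>j<l. f (x ((j + r) mod l))) = (\<Sum>j<l. f (x j))" "(\<Prod>j<l. f (x ((j + r) mod l))) = (\<Prod>j<l. f (x j))" for f :: "real \<Rightarrow> real"
      using sum.reindex_bij_betw[OF bij_betw_rotate[of r l], of "\<lambda>j. f (x j)"]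
        prod.reindex_bij_betw[OF bij_betw_rotate[of r l], of "\<lambda>j. f (x j)"] by auto
    have "0 < x ((j + r) mod l)" for j using x mod_l_less by blast
    from nn_integral_cyclic_links[of "\<lambda>j. x ((j + r) mod l)", OF this]
    show ?thesis
      using rot(1)[of "\<lambda>t. t"] rot(1)[of "\<lambda>t. t ^ 3"] rot(2)[of "\<lambda>t. sqrt (2 * pi * t)"]
      unfolding X_def S_def Q_def B_def by simp
  qed
  let ?c = "exp ((X ^ 3 - S) / 24) * ?k ^ l * Q / X"
  have c0: "0 \<le> ?c" using k X0 Q0 by auto
  have "(\<integral>\<^sup>+s. nonneg_ind l s * ennreal (ring_weight l (\<lambda>j. x j / ?k) s) \<partial>lborel_pow {..<l}) = (\<Sum>r<l. ennreal (?c * B r))"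
    unfolding nn_integral_ring_split piece ..
  also have "\<dots> = ennreal (\<Sum>r<l. ?c * B r)" by (rule sum_ennreal) (rule mult_nonneg_nonneg[OF c0 B0])
  finally have R: "enn2real (\<integral>\<^sup>+s. nonneg_ind l s * ennreal (ring_weight l (\<lambda>j. x j / ?k) s) \<partial>lborel_pow {..<l}) = ?c * (\<Sum>r<l. B r)"
    using mult_nonneg_nonneg[OF c0 B0] by (simp only: enn2real_ennreal sum_nonneg sum_distrib_left)
  \<comment> \<open>Again \<open>k ^ 3 = 2\<close>: the scaling turns the factor 1/12 of the cubes
    into 1/24 and, in the next step, 4 pi x/k into k^2 times 2 pi x.\<close>
  have y3: "(\<Sum>j<l. (x j / ?k) ^ 3) / 12 = S / 24"
    by (simp add: power_divide k(2) S_def flip: sum_divide_distrib)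
  have sq: "(\<Prod>j<l. sqrt (4 * pi * (x j / ?k))) = ?k ^ l * Q"
  proof -
    have "sqrt (4 * pi * (x j / ?k)) = ?k * sqrt (2 * pi * x j)" for j
    proof -
      have "4 * pi * (x j / ?k) = ?k\<^sup>2 * (2 * pi * x j)"
      proof -
        have "4 * pi * (x j / ?k) = 2 * ?k ^ 3 * pi * (x j / ?k)" unfolding k(2) by simp
        also have "\<dots> = ?k\<^sup>2 * (2 * pi * x j)" using k(1) by (simp add: power2_eq_square power3_eq_cube)
        finally show ?thesis .
      qed
      then show ?thesis using k(1) by (simp add: real_sqrt_mult)
    qed
    then show ?thesis by (simp add: prod.distrib Q_def)
  qed
  have "E_fun l (\<lambda>j. x j / ?k) = exp (S / 24) / (?k ^ l * Q) * (?c * (\<Sum>r<l. B r))"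
    unfolding E_fun_nn_integral y3 sq R ..
  also have "\<dots> = exp (S / 24) * exp ((X ^ 3 - S) / 24) / X * (\<Sum>r<l. B r)"
    using k(1) Q0 by simp
  also have "exp (S / 24) * exp ((X ^ 3 - S) / 24) = exp (X ^ 3 / 24)"
    unfolding exp_add[symmetric] by (simp add: diff_divide_distrib)
  finally show ?thesis unfolding B_def .
qed

end

section \<open>From cyclic orderings to ordered partitions\<close>

definition rotate_ordering :: "'b set \<Rightarrow> nat \<Rightarrow> (nat \<Rightarrow> 'b) \<Rightarrow> nat \<Rightarrow> 'b" where
  "rotate_ordering B r f = restrict (\<lambda>k. f ((k + r) mod card B)) {..<card B}"

lemma finite_orderings:
  assumes "finite B"
  shows "finite (orderings B)"
proof (rule finite_subset)
  show "orderings B \<subseteq> Pi\<^sub>E {..<card B} (\<lambda>_. B)"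
    by (auto simp: orderings_def bij_betw_def PiE_def)
  show "finite (Pi\<^sub>E {..<card B} (\<lambda>_. B))" using assms by (intro finite_PiE) auto
qed

lemma cyc_rel_class:
  assumes B: "finite B" "B \<noteq> {}" and f: "f \<in> orderings B"
  shows "cyc_rel B `` {f} = (\<lambda>r. rotate_ordering B r f) ` {..<card B}"
proof -
  let ?l = "card B"
  have l: "?l > 0" using B by (simp add: card_gt_0_iff)
  have mem: "rotate_ordering B r f \<in> orderings B" for r
  proof -
    have "bij_betw (f \<circ> (\<lambda>k. (k + r) mod ?l)) {..<?l} B"
      using f by (intro bij_betw_trans[OF bij_betw_rotate]) (auto simp: orderings_def)
    then have "bij_betw (rotate_ordering B r f) {..<?l} B"
      by (rule bij_betw_cong[THEN iffD1, rotated]) (simp add: rotate_ordering_def)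
    then show ?thesis by (simp add: orderings_def rotate_ordering_def)
  qed
  show ?thesis
  proof (intro equalityI subsetI)
    fix g assume "g \<in> cyc_rel B `` {f}"
    then obtain m where g: "g \<in> orderings B" "\<And>k. k < ?l \<Longrightarrow> g k = f ((k + m) mod ?l)"
      by (auto simp: cyc_rel_def)
    have "g = rotate_ordering B (m mod ?l) f"
    proof (rule extensionalityI[of _ "{..<?l}"])
      show "g \<in> extensional {..<?l}" using g(1) by (simp add: orderings_def)
    qed (auto simp: rotate_ordering_def g(2) mod_add_right_eq)
    then show "g \<in> (\<lambda>r. rotate_ordering B r f) ` {..<?l}" using l by auto
  next
    fix g assume "g \<in> (\<lambda>r. rotate_ordering B r f) ` {..<?l}"
    then obtain r where r: "g = rotate_ordering B r f" by auto
    then show "g \<in> cyc_rel B `` {f}"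
      using mem[of r] f by (auto simp: cyc_rel_def rotate_ordering_def intro!: exI[of _ r])
  qed
qed

lemma inj_on_rotate_ordering:
  assumes B: "finite B" "B \<noteq> {}" and f: "f \<in> orderings B"
  shows "inj_on (\<lambda>r. rotate_ordering B r f) {..<card B}"
proof (rule inj_onI)
  fix r s assume rs: "r \<in> {..<card B}" "s \<in> {..<card B}" "rotate_ordering B r f = rotate_ordering B s f"
  have "rotate_ordering B r f 0 = rotate_ordering B s f 0" using rs by simp
  then have "f r = f s" using rs B by (simp add: rotate_ordering_def card_gt_0_iff)
  then show "r = s" using rs f by (auto simp: orderings_def bij_betw_def inj_on_def)
qed

lemma equiv_cyc_rel:
  assumes B: "finite B" "B \<noteq> {}"
  shows "equiv (orderings B) (cyc_rel B)"
proof (rule equivI)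
  let ?l = "card B"
  have l: "?l > 0" using B by (simp add: card_gt_0_iff)
  show "cyc_rel B \<subseteq> orderings B \<times> orderings B" by (auto simp: cyc_rel_def)
  show "refl_on (orderings B) (cyc_rel B)"
    by (auto simp: refl_on_def cyc_rel_def intro!: exI[of _ 0])
  show "sym (cyc_rel B)"
  proof (rule symI)
    fix f g assume "(f, g) \<in> cyc_rel B"
    then obtain m where fg: "f \<in> orderings B" "g \<in> orderings B" "\<And>k. k < ?l \<Longrightarrow> g k = f ((k + m) mod ?l)"
      by (auto simp: cyc_rel_def)
    \<comment> \<open>Rotation by \<open>?l - m mod ?l\<close> undoes rotation by \<open>m\<close>,
      and this amount is a natural number without truncation.\<close>
    have "f k = g ((k + (?l - m mod ?l)) mod ?l)" if k: "k < ?l" for k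
    proof -
      have "?l * (m div ?l) + m mod ?l = m" "m mod ?l < ?l" using l by auto
      then have "(?l - m mod ?l) + m = ?l + ?l * (m div ?l)" by linarith
      then have s: "k + (?l - m mod ?l) + m = k + ?l * Suc (m div ?l)" by simp
      have "((k + (?l - m mod ?l)) mod ?l + m) mod ?l = (k + (?l - m mod ?l) + m) mod ?l"
        by (rule mod_add_left_eq)
      also have "\<dots> = k" unfolding s using k by (simp only: mod_mult_self2 mod_less)
      finally have e: "((k + (?l - m mod ?l)) mod ?l + m) mod ?l = k" .
      have "g ((k + (?l - m mod ?l)) mod ?l) = f (((k + (?l - m mod ?l)) mod ?l + m) mod ?l)"
        by (rule fg(3)) (use l in simp)
      then show ?thesis unfolding e ..
    qed
    then have "\<exists>m. \<forall>k<?l. f k = g ((k + m) mod ?l)" by blast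
    with fg(1,2) show "(g, f) \<in> cyc_rel B" unfolding cyc_rel_def by blast
  qed
  show "trans (cyc_rel B)"
  proof (rule transI)
    fix f g h assume "(f, g) \<in> cyc_rel B" "(g, h) \<in> cyc_rel B"
    then obtain m m' where fg: "f \<in> orderings B" "h \<in> orderings B" "\<And>k. k < ?l \<Longrightarrow> g k = f ((k + m) mod ?l)"
      "\<And>k. k < ?l \<Longrightarrow> h k = g ((k + m') mod ?l)"
      by (auto simp: cyc_rel_def)
    have "h k = f ((k + (m' + m)) mod ?l)" if "k < ?l" for k
    proof -
      have "g ((k + m') mod ?l) = f (((k + m') mod ?l + m) mod ?l)"
        by (rule fg(3)) (use l in simp)
      then show ?thesis unfolding fg(4)[OF that] mod_add_left_eq add.assoc .
    qed
    then have "\<exists>m. \<forall>k<?l. h k = f ((k + m) mod ?l)" by blast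
    with fg(1,2) show "(f, h) \<in> cyc_rel B" unfolding cyc_rel_def by blast
  qed
qed

text \<open>Each class is the rotation orbit of any of its members and has exactly
  \<open>card B\<close> elements. So the rotations of the representative picked by
  \<open>SOME\<close> run through the class once each, whichever representative it is.\<close>

lemma sum_cyc_classes:
  assumes B: "finite B" "B \<noteq> {}"
  shows "(\<Sum>C\<in>orderings B // cyc_rel B. \<Sum>r<card B. h (rotate_ordering B r (SOME f. f \<in> C))) = (\<Sum>g\<in>orderings B. h g)"
proof -
  note eq = equiv_cyc_rel[OF B]
  have "(\<Sum>r<card B. h (rotate_ordering B r (SOME f. f \<in> C))) = (\<Sum>g\<in>C. h g)" if C: "C \<in> orderings B // cyc_rel B" for C
  proof -
    have "(SOME f. f \<in> C) \<in> C"
      using in_quotient_imp_non_empty[OF eq C] by (simp only: some_in_eq not_False_eq_True)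
    moreover define f where "f = (SOME f. f \<in> C)"
    ultimately have fC: "f \<in> C" by simp
    have f: "f \<in> orderings B" using fC in_quotient_imp_subset[OF eq C] by auto
    obtain f0 where f0: "C = cyc_rel B `` {f0}" using C by (auto simp: quotient_def)
    then have "(f0, f) \<in> cyc_rel B" using fC by simp
    from equiv_class_eq[OF eq this] have "C = cyc_rel B `` {f}" using f0 by simp
    then show ?thesis
      unfolding f_def[symmetric]
      by (simp add: cyc_rel_class[OF B f] sum.reindex[OF inj_on_rotate_ordering[OF B f]])
  qed
  then have "(\<Sum>C\<in>orderings B // cyc_rel B. \<Sum>r<card B. h (rotate_ordering B r (SOME f. f \<in> C))) =
     (\<Sum>C\<in>orderings B // cyc_rel B. \<Sum>g\<in>C. h g)" by simp
  also have "\<dots> = (\<Sum>g\<in>\<Union>(orderings B // cyc_rel B). h g)"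
  proof (rule sum.Union_disjoint[symmetric, unfolded comp_def])
    show "\<forall>C\<in>orderings B // cyc_rel B. finite C"
      using in_quotient_imp_subset[OF eq] finite_orderings[OF B(1)] by (blast intro: finite_subset)
    show "\<forall>C\<in>orderings B // cyc_rel B. \<forall>D\<in>orderings B // cyc_rel B. C \<noteq> D \<longrightarrow> C \<inter> D = {}"
      using quotient_disj[OF eq] by blast
  qed
  finally show ?thesis unfolding Union_quotient[OF eq] .
qed

text \<open>An ordering numbers the blocks from the first step on, while chains store the last step
  at the head; hence the reversal.\<close>

lemma sum_orderings_eq_permutations:
  assumes "finite B"
  shows "(\<Sum>g\<in>orderings B. h (map g (rev [0..<card B]))) = (\<Sum>xs\<in>permutations_of_set B. h xs)"
proof (rule sum.reindex_bij_witness[where j = "\<lambda>g. map g (rev [0..<card B])" and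
      i = "\<lambda>xs. restrict (\<lambda>k. rev xs ! k) {..<card B}"])
  fix g assume g: "g \<in> orderings B"
  show "restrict (\<lambda>k. rev (map g (rev [0..<card B])) ! k) {..<card B} = g"
  proof (rule extensionalityI[of _ "{..<card B}"])
    show "g \<in> extensional {..<card B}" using g by (simp add: orderings_def)
  qed (auto simp: rev_map[symmetric])
  show "map g (rev [0..<card B]) \<in> permutations_of_set B"
    using g by (auto simp: orderings_def bij_betw_def permutations_of_set_def distinct_map atLeast0LessThan)
next
  fix xs assume xs: "xs \<in> permutations_of_set B"
  have len: "length xs = card B" by (rule length_finite_permutations_of_set[OF xs])
  have d: "distinct (rev xs)" "set (rev xs) = B" using xs by (auto simp: permutations_of_set_def)
  show "map (restrict (\<lambda>k. rev xs ! k) {..<card B}) (rev [0..<card B]) = xs"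
  proof -
    have "map (restrict (\<lambda>k. rev xs ! k) {..<card B}) [0..<card B] = rev xs"
      by (rule nth_equalityI) (auto simp: len)
    then show ?thesis by (simp flip: rev_map)
  qed
  have "bij_betw ((!) (rev xs)) {..<card B} B"
    by (rule bij_betw_nth) (use d len in auto)
  then have "bij_betw (restrict (\<lambda>k. rev xs ! k) {..<card B}) {..<card B} B"
    by (rule bij_betw_cong[THEN iffD1, rotated]) simp
  then show "restrict (\<lambda>k. rev xs ! k) {..<card B} \<in> orderings B"
    by (simp add: orderings_def)
qed auto

text \<open>The positions of the minimum within one loop supply exactly the rotations by which
  linear orderings outnumber cyclic ones.\<close>

lemma E_circ_eq:
  assumes A: "finite A" "A \<noteq> {}" and x: "\<And>j. j \<in> A \<Longrightarrow> x j > 0" and P: "partition_on A P"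
  defines "X \<equiv> sum x A"
  shows "E_circ P (\<lambda>I. \<Sum>j\<in>I. x j / cube_root_2) =
    exp (X ^ 3 / 24) / X * (\<Sum>Bs\<in>permutations_of_set P. block_chain X (map (sum x) Bs) 0)"
proof -
  have finP: "finite P" by (rule finite_elements[OF A(1) P])
  have neP: "P \<noteq> {}" using P A(2) by (auto simp: partition_on_def)
  have cP: "card P \<ge> 1" using finP neP by (simp add: Suc_le_eq card_gt_0_iff)
  have pos: "sum x I > 0" if "I \<in> P" for I
  proof (rule sum_pos)
    have "I \<subseteq> A" "I \<noteq> {}" using P that by (auto simp: partition_on_def)
    then show "finite I" "I \<noteq> {}" "\<And>i. i \<in> I \<Longrightarrow> 0 < x i" using A(1) x by (auto intro: finite_subset)
  qed
  let ?h = "\<lambda>g. block_chain X (map (sum x) (map g (rev [0..<card P]))) 0"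
  have "E_fun (card P) (\<lambda>k. \<Sum>j\<in>(SOME f. f \<in> C) k. x j / cube_root_2) =
      exp (X ^ 3 / 24) / X * (\<Sum>r<card P. ?h (rotate_ordering P r (SOME f. f \<in> C)))"
    if C: "C \<in> orderings P // cyc_rel P" for C
  proof -
    note eq = equiv_cyc_rel[OF finP neP]
    define f where "f = (SOME f. f \<in> C)"
    have "f \<in> C" unfolding f_def using in_quotient_imp_non_empty[OF eq C] by (simp only: some_in_eq not_False_eq_True)
    then have f: "bij_betw f {..<card P} P" using in_quotient_imp_subset[OF eq C] by (auto simp: orderings_def)
    have X: "(\<Sum>k<card P. sum x (f k)) = X"
    proof -
      have "(\<Sum>k<card P. sum x (f k)) = (\<Sum>I\<in>P. sum x I)" by (rule sum.reindex_bij_betw[OF f])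
      also have "\<dots> = sum x (\<Union>P)"
        using P A(1) by (subst sum.Union_disjoint) (auto simp: partition_on_def disjoint_def intro: finite_subset)
      also have "\<Union>P = A" using P by (auto simp: partition_on_def)
      finally show ?thesis unfolding X_def .
    qed
    have "E_fun (card P) (\<lambda>k. sum x (f k) / cube_root_2) =
       exp (X ^ 3 / 24) / X * (\<Sum>r<card P. block_chain X (map (\<lambda>j. sum x (f ((j + r) mod card P))) (rev [0..<card P])) 0)"
      unfolding X[symmetric]
      by (rule E_fun_eq_block_chains[OF cP]) (use f pos in \<open>auto simp: bij_betw_def\<close>)
    also have "(\<lambda>r. map (\<lambda>j. sum x (f ((j + r) mod card P))) (rev [0..<card P])) =
       (\<lambda>r. map (sum x) (map (rotate_ordering P r f) (rev [0..<card P])))"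
      by (auto simp: fun_eq_iff rotate_ordering_def)
    finally show ?thesis unfolding f_def[symmetric] by (simp only: sum_divide_distrib)
  qed
  then have "E_circ P (\<lambda>I. \<Sum>j\<in>I. x j / cube_root_2) =
     (\<Sum>C\<in>orderings P // cyc_rel P. exp (X ^ 3 / 24) / X * (\<Sum>r<card P. ?h (rotate_ordering P r (SOME f. f \<in> C))))"
    unfolding E_circ_def by (intro sum.cong refl)
  also have "\<dots> = exp (X ^ 3 / 24) / X * (\<Sum>g\<in>orderings P. ?h g)"
    unfolding sum_distrib_left[symmetric] sum_cyc_classes[OF finP neP, of ?h] ..
  also have "(\<Sum>g\<in>orderings P. ?h g) = (\<Sum>Bs\<in>permutations_of_set P. block_chain X (map (sum x) Bs) 0)"
    by (rule sum_orderings_eq_permutations[OF finP])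
  finally show ?thesis .
qed

text \<open>A partition with a linear order on its blocks is an ordered partition, and the number of
  blocks, which fixes the sign, is the length of the list.\<close>

lemma G_fun_eq_block_sum:
  assumes n: "n \<ge> 1" and x: "\<And>j. j < n \<Longrightarrow> x j > 0"
  defines "X \<equiv> sum x {..<n}"
  shows "G_fun n (\<lambda>j. x j / cube_root_2) = exp (X ^ 3 / 24) / X * block_sum X x {..<n} 0"
proof -
  let ?A = "{..<n}"
  let ?f = "\<lambda>Bs. (- 1) ^ (length Bs + 1) * block_chain X (map (sum x) Bs) 0"
  have A: "finite ?A" "?A \<noteq> {}" using n by (auto simp: lessThan_empty_iff)
  have OP: "ordered_partitions ?A = (\<Union>P\<in>{P. partition_on ?A P}. permutations_of_set P)"
    by (auto simp: ordered_partitions_def permutations_of_set_def)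
  have "block_sum X x ?A 0 = (\<Sum>P | partition_on ?A P. \<Sum>Bs\<in>permutations_of_set P. ?f Bs)"
    unfolding block_sum_def OP
    using finitely_many_partition_on[OF A(1)] by (subst sum.UNION_disjoint) (auto dest: permutations_of_setD)
  also have "\<dots> = (\<Sum>P | partition_on ?A P. (- 1) ^ (card P + 1) * (\<Sum>Bs\<in>permutations_of_set P. block_chain X (map (sum x) Bs) 0))"
    unfolding sum_distrib_left
    by (intro sum.cong refl) (simp add: length_finite_permutations_of_set)
  finally have bs: "block_sum X x ?A 0 = (\<Sum>P | partition_on ?A P. (- 1) ^ (card P + 1) * (\<Sum>Bs\<in>permutations_of_set P. block_chain X (map (sum x) Bs) 0))" .
  have "E_circ P (\<lambda>I. \<Sum>j\<in>I. x j / cube_root_2) =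
    exp (X ^ 3 / 24) / X * (\<Sum>Bs\<in>permutations_of_set P. block_chain X (map (sum x) Bs) 0)" if "partition_on ?A P" for P
    unfolding X_def by (rule E_circ_eq[OF A _ that]) (use x in auto)
  note E = this
  show ?thesis
    unfolding G_fun_def bs sum_distrib_left[of "exp (X ^ 3 / 24) / X"]
  proof (rule sum.cong[OF refl])
    fix P assume "P \<in> {P. partition_on ?A P}"
    then have "partition_on ?A P" by simp
    from E[OF this] show "(- 1) ^ (card P + 1) * E_circ P (\<lambda>I. \<Sum>j\<in>I. x j / cube_root_2) =
      exp (X ^ 3 / 24) / X * ((- 1) ^ (card P + 1) * (\<Sum>Bs\<in>permutations_of_set P. block_chain X (map (sum x) Bs) 0))"
      by (simp only: mult.left_commute)
  qed
qed

theorem theorem2p3: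
  fixes n :: nat and x :: "nat \<Rightarrow> real"
  assumes "n \<ge> 1" and "\<And>j. j < n \<Longrightarrow> x j > 0"
  shows "F_Bur n x = complex_of_real (F_Ok n x)"
proof -
  let ?X = "sum x {..<n}"
  have "word_sum ?X x {..<n} 0 = block_sum ?X x {..<n} 0"
    by (rule word_sum_eq_block_sum) (use assms in \<open>auto simp: lessThan_empty_iff\<close>)
  moreover have "G_fun n (\<lambda>j. x j / 2 powr (1/3)) = exp (?X ^ 3 / 24) / ?X * block_sum ?X x {..<n} 0"
    using G_fun_eq_block_sum[OF assms] unfolding cube_root_2_def .
  moreover have "F_Bur n x = of_real (exp (?X ^ 3 / 24) / ?X *
      ((2 * pi) powr (real n / 2) / (\<Prod>j<n. sqrt (x j))) * word_sum ?X x {..<n} 0)"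
    by (rule F_Bur_eq_word_sum) (use assms in auto)
  ultimately show ?thesis
    unfolding F_Ok_def by (simp only: mult_ac times_divide_eq_left times_divide_eq_right)
qed

end
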